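(* The composite $$\mathbf{Diff}\xrightarrow{\ {}^\bullet(-)\ }{}^\bullet\mathcal C^\infty\xrightarrow{\ {}_\bullet(-)\ }\mathbf{Diff}$$ is the identity functor, up to canonical natural isomorphism.
   Context: FERMAT EXTENSIONS. For $U\subseteq\mathbb R^n$ open, a little-oh polynomial on $U$ is a function $x:[0,\epsilon)\to U$ (some $\epsilon>0$, not fixed) such that for some $r\in U$, $k\in\mathbb N$, $\alpha_i\in\mathbb R^n$, $a_i>0$ one has $x(0)=r$ and $\|x(t)-r-\sum_{i=1}^k\alpha_it^{a_i}\|=o(t)$ as $t\to0^+$. Two such $x,y$ are equivalent if $x(0)=y(0)$ and $x(t)-y(t)=o(t)$; ${}^\bullet U$ is the set of equivalence classes, and ${}^\circ x:=x(0)\in U$ is the standard part. Identify ${}^\bullet U=\{x\in{}^\bullet\mathbb R^n: {}^\circ x\in U\}$ and ${}^\bullet(U\times V)={}^\bullet U\times{}^\bullet V$. The map $i_U:U\to{}^\bullet U$ sends $u$ to the class of the constant function $u$, and $ev_0:{}^\bullet U\to U$ is $x\mapsto{}^\circ x$. A smooth map $f:U\to V$ of open subsets of Euclidean spaces has the Fermat extension ${}^\bullet f:{}^\bullet U\to{}^\bullet V$, $[x]\mapsto[f\circ x]$. The Fermat topology on ${}^\bullet\mathbb R^n$ has as open sets exactly the ${}^\bullet U$ with $U\subseteq\mathbb R^n$ open; subsets carry the subspace topology. For $A\subseteq{}^\bullet\mathbb R^n$, $B\subseteq{}^\bullet\mathbb R^m$, a function $f:A\to B$ is quasi-standard smooth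 if for every $a\in A$ there are an open neighborhood $U$ of ${}^\circ a$ in $\mathbb R^n$, an open subset $P$ of a Euclidean space, a smooth map $\alpha:P\times U\to\mathbb R^m$ and a point $p\in{}^\bullet P$ with $f(x)={}^\bullet\alpha(p,x)$ for all $x\in A\cap{}^\bullet U$. SITES AND SPACES. $\mathcal S$ is the site of all open subsets of all $\mathbb R^n$, $n\in\mathbb N$, with smooth maps and usual open coverings. $\mathcal F$ is the site of all subsets of all ${}^\bullet\mathbb R^n$, with quasi-standard smooth maps and coverings by Fermat-open subsets. $\mathcal F'$ is the full subcategory of $\mathcal F$ on the objects ${}^\bullet U$ with $U$ an open subset of some $\mathbb R^n$. For $\mathcal A=\mathcal S$ or $\mathcal F$, a concrete sheaf $X$ over $\mathcal A$ is a set $|X|$ with, for each object $A$ of $\mathcal A$, a collection of functions $A\to|X|$ called sections, such that constant functions are sections, sections are stable under precomposition with morphisms of $\mathcal A$, and a function that is a section on each member of a cover of $A$ is a section. Morphisms are functions sending sections to sections by composition. Concrete sheaves over $\mathcal S$ are the diffeological spaces (sections: plots; morphisms: smooth maps; category $\mathbf{Diff}$); those over $\mathcal F$ are the Fermat spaces (sections: Fermat plots; morphisms: Fermat maps; category ${}^\bullet\mathcal C^\infty$). Each object of $\mathcal A$ is a concrete sheaf whose sections are the morphisms of $\mathcal A$ into it. A colimit of concrete sheaves has as underlying set the colimit of underlying sets, and its sections are the functions that locally (on a cover) factor through sections of members of the diagram. ADDING INFINITESIMALS. For a diffeological space $X$, $\mathcal S/X$ has as objects the plots $p:U\to X$ and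 as morphisms from $p:U\to X$ to $q:V\to X$ the smooth maps $f:U\to V$ with $q\circ f=p$. The Fermat space ${}^\bullet X$ is $\operatorname{colim}_{U\in\mathcal S/X}{}^\bullet U$ in ${}^\bullet\mathcal C^\infty$ (with transition maps ${}^\bullet f$). A smooth map $g:X\to Y$ induces a Fermat map ${}^\bullet g:{}^\bullet X\to{}^\bullet Y$ via $p\mapsto g\circ p$. DELETING INFINITESIMALS. For a Fermat space $Y$, $\mathcal F'/Y$ has as objects the Fermat plots $p:{}^\bullet U\to Y$ with ${}^\bullet U\in\mathcal F'$ and as morphisms from $p:{}^\bullet U\to Y$ to $q:{}^\bullet V\to Y$ the quasi-standard smooth $f:{}^\bullet U\to{}^\bullet V$ with $q\circ f=p$. The diffeological space ${}_\bullet Y$ is $\operatorname{colim}_{{}^\bullet U\in\mathcal F'/Y}U$ in $\mathbf{Diff}$, with transition maps ${}_\bullet f:=ev_0\circ f\circ i_U:U\to V$. A Fermat map $g:Y\to Z$ induces a smooth map ${}_\bullet g$ via $p\mapsto g\circ p$. *)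

theory Defs
  imports "HOL-Analysis.Analysis" "HOL-Library.Landau_Symbols"
begin

section \<open>Concrete sheaves on a concrete site\<close>

text \<open>An object of a site is a pair \<open>(n, A)\<close>: the set \<open>A\<close> together with the dimension of the ambient
  Euclidean space. All functions between sets are extensional (\<open>\<rightarrow>\<^sub>E\<close>), so that equality of HOL
  functions is equality of functions on the given domain.\<close>

type_synonym 'p obj = "nat \<times> 'p set"

record 'p site =
  Obj :: "'p obj set"
  Hom :: "'p obj \<Rightarrow> 'p obj \<Rightarrow> ('p \<Rightarrow> 'p) set"
  Cov :: "'p obj \<Rightarrow> 'p set set set"

record ('p, 'a) csheaf =
  points :: "'a set"
  sections :: "'p obj \<Rightarrow> ('p \<Rightarrow> 'a) set"

definition concrete_sheaf :: "'p site \<Rightarrow> ('p, 'a) csheaf \<Rightarrow> bool" where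
  "concrete_sheaf \<A> X \<longleftrightarrow>
     (\<forall>A\<in>Obj \<A>. sections X A \<subseteq> snd A \<rightarrow>\<^sub>E points X) \<and>
     (\<forall>A\<in>Obj \<A>. \<forall>c\<in>points X. (\<lambda>_\<in>snd A. c) \<in> sections X A) \<and>
     (\<forall>A\<in>Obj \<A>. \<forall>B\<in>Obj \<A>. \<forall>f\<in>Hom \<A> A B. \<forall>s\<in>sections X B. compose (snd A) s f \<in> sections X A) \<and>
     (\<forall>A\<in>Obj \<A>. \<forall>s\<in>snd A \<rightarrow>\<^sub>E points X. \<forall>\<W>\<in>Cov \<A> A.
        (\<forall>W\<in>\<W>. restrict s W \<in> sections X (fst A, W)) \<longrightarrow> s \<in> sections X A)"

definition sheaf_maps :: "'p site \<Rightarrow> ('p, 'a) csheaf \<Rightarrow> ('p, 'b) csheaf \<Rightarrow> ('a \<Rightarrow> 'b) set" where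
  "sheaf_maps \<A> X Y =
     {g \<in> points X \<rightarrow>\<^sub>E points Y. \<forall>A\<in>Obj \<A>. \<forall>s\<in>sections X A. compose (snd A) g s \<in> sections Y A}"

abbreviation id_on :: "'a set \<Rightarrow> 'a \<Rightarrow> 'a" where
  "id_on A \<equiv> (\<lambda>x\<in>A. x)"

definition sheaf_iso :: "'p site \<Rightarrow> ('p, 'a) csheaf \<Rightarrow> ('p, 'b) csheaf \<Rightarrow> ('a \<Rightarrow> 'b) \<Rightarrow> bool" where
  "sheaf_iso \<A> X Y \<eta> \<longleftrightarrow> \<eta> \<in> sheaf_maps \<A> X Y \<and>
     (\<exists>\<theta>\<in>sheaf_maps \<A> Y X.
        compose (points X) \<theta> \<eta> = id_on (points X) \<and> compose (points Y) \<eta> \<theta> = id_on (points Y))"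

definition representable :: "'p site \<Rightarrow> 'p obj \<Rightarrow> ('p, 'p) csheaf" where
  "representable \<A> B = \<lparr>points = snd B, sections = (\<lambda>A. Hom \<A> A B)\<rparr>"

text \<open>Colimit of the diagram with index objects \<open>I\<close>, vertices \<open>D i\<close> and transition maps \<open>M i j\<close>.\<close>

definition colim_rel ::
  "'i set \<Rightarrow> ('i \<Rightarrow> ('p, 'b) csheaf) \<Rightarrow> ('i \<Rightarrow> 'i \<Rightarrow> ('b \<Rightarrow> 'b) set) \<Rightarrow> (('i \<times> 'b) \<times> ('i \<times> 'b)) set" where
  "colim_rel I D M =
     {(a, b). a \<in> (SIGMA i:I. points (D i)) \<and> b \<in> (SIGMA i:I. points (D i)) \<and>
        equivclp (\<lambda>(i, x) (j, y). i \<in> I \<and> j \<in> I \<and> x \<in> points (D i) \<and> (\<exists>f\<in>M i j. y = f x)) a b}"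

definition colimit ::
  "'p site \<Rightarrow> 'i set \<Rightarrow> ('i \<Rightarrow> ('p, 'b) csheaf) \<Rightarrow> ('i \<Rightarrow> 'i \<Rightarrow> ('b \<Rightarrow> 'b) set)
     \<Rightarrow> ('p, ('i \<times> 'b) set) csheaf" where
  "colimit \<A> I D M =
     \<lparr>points = (SIGMA i:I. points (D i)) // colim_rel I D M,
      sections = (\<lambda>A. {s \<in> snd A \<rightarrow>\<^sub>E (SIGMA i:I. points (D i)) // colim_rel I D M.
        \<exists>\<W>\<in>Cov \<A> A. \<forall>W\<in>\<W>. \<exists>i\<in>I. \<exists>\<sigma>\<in>sections (D i) (fst A, W).
          \<forall>w\<in>W. s w = colim_rel I D M `` {(i, \<sigma> w)}})\<rparr>"


section \<open>The site of open subsets of Euclidean spaces\<close>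

type_synonym pt = "nat \<Rightarrow> real"

abbreviation Rn :: "nat \<Rightarrow> pt set" where
  "Rn n \<equiv> topspace (Euclidean_space n)"

text \<open>\<open>C\<^sup>k\<close> real-valued functions on an open \<open>U \<subseteq> \<real>\<^sup>n\<close>: all iterated partial derivatives of order at
  most \<open>k\<close> exist and are continuous. Values outside \<open>U\<close> play no role because \<open>U\<close> is open.\<close>

fun Ck :: "nat \<Rightarrow> nat \<Rightarrow> pt set \<Rightarrow> (pt \<Rightarrow> real) \<Rightarrow> bool" where
  "Ck 0 n U f \<longleftrightarrow> continuous_map (subtopology (Euclidean_space n) U) euclideanreal f"
| "Ck (Suc k) n U f \<longleftrightarrow> continuous_map (subtopology (Euclidean_space n) U) euclideanreal f \<and>
     (\<forall>i<n. \<exists>g. Ck k n U g \<and>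
        (\<forall>x\<in>U. ((\<lambda>t. f (x(i := t))) has_real_derivative g x) (at (x i))))"

definition smooth :: "nat \<Rightarrow> pt set \<Rightarrow> nat \<Rightarrow> pt set \<Rightarrow> (pt \<Rightarrow> pt) \<Rightarrow> bool" where
  "smooth n U m V f \<longleftrightarrow> f \<in> U \<rightarrow> V \<and> (\<forall>j<m. \<forall>k. Ck k n U (\<lambda>x. f x j))"

definition S_site :: "pt site" where
  "S_site =
     \<lparr>Obj = {(n, U). openin (Euclidean_space n) U},
      Hom = (\<lambda>(n, U) (m, V). {f \<in> U \<rightarrow>\<^sub>E V. smooth n U m V f}),
      Cov = (\<lambda>(n, U). {\<W>. (\<forall>W\<in>\<W>. openin (Euclidean_space n) W) \<and> \<Union>\<W> = U})\<rparr>"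


section \<open>Fermat extensions\<close>

text \<open>A function \<open>[0, \<epsilon>) \<rightarrow> U\<close> is encoded as a total function whose values outside \<open>[0, \<epsilon>)\<close> are ignored.\<close>

definition little_o :: "nat \<Rightarrow> (real \<Rightarrow> pt) \<Rightarrow> bool" where
  "little_o n d \<longleftrightarrow> (\<lambda>t. L2_set (d t) {..<n}) \<in> o[at_right 0](\<lambda>t. t)"

definition little_oh_poly :: "nat \<Rightarrow> pt set \<Rightarrow> (real \<Rightarrow> pt) \<Rightarrow> bool" where
  "little_oh_poly n U x \<longleftrightarrow>
     (\<exists>\<epsilon>>0. \<forall>t\<in>{0..<\<epsilon>}. x t \<in> U) \<and>
     (\<exists>r\<in>U. \<exists>(k::nat) \<alpha> a. (\<forall>i\<in>{1..k}. \<alpha> i \<in> Rn n \<and> a i > 0) \<and> x 0 = r \<and>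
        little_o n (\<lambda>t j. x t j - r j - (\<Sum>i=1..k. \<alpha> i j * t powr a i)))"

definition fermat_rel :: "nat \<Rightarrow> pt set \<Rightarrow> ((real \<Rightarrow> pt) \<times> (real \<Rightarrow> pt)) set" where
  "fermat_rel n U = {(x, y). little_oh_poly n U x \<and> little_oh_poly n U y \<and>
     x 0 = y 0 \<and> little_o n (\<lambda>t j. x t j - y t j)}"

type_synonym fpt = "(real \<Rightarrow> pt) set"

definition fermat :: "nat \<Rightarrow> pt set \<Rightarrow> fpt set" where
  "fermat n U = {x. little_oh_poly n U x} // fermat_rel n U"

definition std :: "fpt \<Rightarrow> pt" where
  "std c = the_elem ((\<lambda>x. x 0) ` c)"

definition const_pt :: "nat \<Rightarrow> pt set \<Rightarrow> pt \<Rightarrow> fpt" where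
  "const_pt n U u = fermat_rel n U `` {\<lambda>_. u}"

text \<open>The Fermat extension \<open>[x] \<mapsto> [f \<circ> x]\<close> of a smooth map \<open>f\<close> from \<open>U \<subseteq> \<real>\<^sup>n\<close> to \<open>V \<subseteq> \<real>\<^sup>m\<close>.\<close>

definition fermat_map :: "nat \<Rightarrow> pt set \<Rightarrow> nat \<Rightarrow> pt set \<Rightarrow> (pt \<Rightarrow> pt) \<Rightarrow> fpt \<Rightarrow> fpt" where
  "fermat_map n U m V f = (\<lambda>c\<in>fermat n U. \<Union>x\<in>c. fermat_rel m V `` {f \<circ> x})"

text \<open>\<open>\<real>\<^sup>k \<times> \<real>\<^sup>n\<close> is \<open>\<real>\<^sup>k\<^sup>+\<^sup>n\<close> by concatenation of coordinates.\<close>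

definition cat :: "nat \<Rightarrow> pt \<Rightarrow> pt \<Rightarrow> pt" where
  "cat k p x = (\<lambda>i. if i < k then p i else x (i - k))"

definition pt_prod :: "nat \<Rightarrow> pt set \<Rightarrow> pt set \<Rightarrow> pt set" where
  "pt_prod k P U = (\<lambda>(p, x). cat k p x) ` (P \<times> U)"

text \<open>The identification \<open>\<^sup>\<bullet>P \<times> \<^sup>\<bullet>U = \<^sup>\<bullet>(P \<times> U)\<close>, for \<open>P \<subseteq> \<real>\<^sup>k\<close> and \<open>U \<subseteq> \<real>\<^sup>n\<close>.\<close>

definition fermat_pair :: "nat \<Rightarrow> pt set \<Rightarrow> nat \<Rightarrow> pt set \<Rightarrow> fpt \<Rightarrow> fpt \<Rightarrow> fpt" where
  "fermat_pair k P n U c d =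
     (\<Union>p\<in>c. \<Union>x\<in>d. fermat_rel (k + n) (pt_prod k P U) `` {\<lambda>t. cat k (p t) (x t)})"

definition fermat_topology :: "nat \<Rightarrow> fpt topology" where
  "fermat_topology n = topology (\<lambda>S. \<exists>U. openin (Euclidean_space n) U \<and> S = fermat n U)"

definition quasi_standard_smooth ::
  "nat \<Rightarrow> fpt set \<Rightarrow> nat \<Rightarrow> fpt set \<Rightarrow> (fpt \<Rightarrow> fpt) \<Rightarrow> bool" where
  "quasi_standard_smooth n A m B f \<longleftrightarrow> f \<in> A \<rightarrow> B \<and>
     (\<forall>a\<in>A. \<exists>U k P \<alpha>. \<exists>p\<in>fermat k P.
        openin (Euclidean_space n) U \<and> std a \<in> U \<and> openin (Euclidean_space k) P \<and>
        smooth (k + n) (pt_prod k P U) m (Rn m) \<alpha> \<and>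
        (\<forall>x\<in>A \<inter> fermat n U.
           f x = fermat_map (k + n) (pt_prod k P U) m (Rn m) \<alpha> (fermat_pair k P n U p x)))"

definition F_site :: "fpt site" where
  "F_site =
     \<lparr>Obj = {(n, A). A \<subseteq> fermat n (Rn n)},
      Hom = (\<lambda>(n, A) (m, B). {f \<in> A \<rightarrow>\<^sub>E B. quasi_standard_smooth n A m B f}),
      Cov = (\<lambda>(n, A). {\<W>. (\<forall>W\<in>\<W>. openin (subtopology (fermat_topology n) A) W) \<and> \<Union>\<W> = A})\<rparr>"

text \<open>The sets \<open>\<^sup>\<bullet>U\<close> and \<open>{x \<in> \<^sup>\<bullet>\<real>\<^sup>n. \<^sup>\<circ>x \<in> U}\<close> coincide, and the sets \<open>\<^sup>\<bullet>U\<close> do form a topology.\<close>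

lemma std_fermat_rel:
  assumes "little_oh_poly n U x"
  shows "std (fermat_rel n U `` {x}) = x 0"
proof -
  have "x \<in> fermat_rel n U `` {x}"
    using assms by (auto simp: fermat_rel_def little_o_def L2_set_def)
  then have "(\<lambda>x. x 0) ` (fermat_rel n U `` {x}) = {x 0}"
    by (auto simp: fermat_rel_def image_iff)
  then show ?thesis
    by (simp add: std_def)
qed

lemma little_oh_poly_alt:
  "little_oh_poly n U x \<longleftrightarrow> (\<exists>\<epsilon>>0. \<forall>t\<in>{0..<\<epsilon>}. x t \<in> U) \<and> x 0 \<in> U \<and>
     (\<exists>(k::nat) \<alpha> a. (\<forall>i\<in>{1..k}. \<alpha> i \<in> Rn n \<and> a i > 0) \<and>
        little_o n (\<lambda>t j. x t j - x 0 j - (\<Sum>i=1..k. \<alpha> i j * t powr a i)))"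
  unfolding little_oh_poly_def by (intro conj_cong refl iffI; elim bexE conjE exE)
    ((hypsubst)?, (intro conjI exI bexI[of _ "x 0"] refl; assumption))+

lemma little_oh_poly_tendsto:
  assumes "little_oh_poly n (Rn n) x"
  shows "((\<lambda>t. x t i) \<longlongrightarrow> x 0 i) (at_right 0)"
proof -
  obtain \<epsilon> where \<epsilon>: "\<epsilon> > 0" "\<And>t. t \<in> {0..<\<epsilon>} \<Longrightarrow> x t \<in> Rn n"
    using assms unfolding little_oh_poly_alt by blast
  obtain k :: nat and \<alpha> a where ka: "\<forall>i\<in>{1..k}. \<alpha> i \<in> Rn n \<and> a i > 0"
    and lo: "little_o n (\<lambda>t j. x t j - x 0 j - (\<Sum>i=1..k. \<alpha> i j * t powr a i))"
    using assms unfolding little_oh_poly_alt by blast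
  show ?thesis
  proof (cases "i < n")
    case True
    define d where "d = (\<lambda>t j. x t j - x 0 j - (\<Sum>i=1..k. \<alpha> i j * t powr a i))"
    have "((\<lambda>t. L2_set (d t) {..<n} / t) \<longlongrightarrow> 0) (at_right 0)"
      using lo unfolding little_o_def d_def by (rule smalloD_tendsto)
    then have "((\<lambda>t. L2_set (d t) {..<n} / t * t) \<longlongrightarrow> 0 * 0) (at_right 0)"
      by (intro tendsto_mult tendsto_ident_at)
    moreover have "\<forall>\<^sub>F t in at_right (0::real). L2_set (d t) {..<n} / t * t = L2_set (d t) {..<n}"
      using eventually_at_right_less[of "0::real"] by eventually_elim auto
    ultimately have L: "((\<lambda>t. L2_set (d t) {..<n}) \<longlongrightarrow> 0) (at_right 0)"
      using filterlim_cong by fastforce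
    have "norm (d t i) \<le> L2_set (d t) {..<n}" for t
    proof -
      have "\<bar>d t i\<bar> = L2_set (d t) {i}" by (simp add: L2_set_def)
      also have "\<dots> \<le> L2_set (d t) {..<n}"
        unfolding L2_set_def using True by (intro real_sqrt_le_mono sum_mono2) auto
      finally show ?thesis by simp
    qed
    then have D: "((\<lambda>t. d t i) \<longlongrightarrow> 0) (at_right 0)"
      by (intro Lim_null_comparison[OF _ L] always_eventually) auto
    have "((\<lambda>t. \<Sum>l=1..k. \<alpha> l i * t powr a l) \<longlongrightarrow> (\<Sum>l=1..k. \<alpha> l i * 0)) (at_right 0)"
    proof (intro tendsto_sum tendsto_mult tendsto_const)
      fix l assume l: "l \<in> {1..k}"
      have "((\<lambda>t::real. t powr a l) \<longlongrightarrow> 0 powr a l) (at_right 0)"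
        using ka l eventually_at_right_less[of "0::real"]
        by (intro tendsto_powr2 tendsto_ident_at tendsto_const) (auto elim: eventually_mono)
      then show "((\<lambda>t::real. t powr a l) \<longlongrightarrow> 0) (at_right 0)" by simp
    qed
    with D have "((\<lambda>t. d t i + (\<Sum>l=1..k. \<alpha> l i * t powr a l) + x 0 i) \<longlongrightarrow> 0 + (\<Sum>l=1..k. \<alpha> l i * 0) + x 0 i)
        (at_right 0)"
      by (intro tendsto_add tendsto_const)
    then show ?thesis by (simp add: d_def)
  next
    case False
    then have eq: "x t i = x 0 i" if "t \<in> {0..<\<epsilon>}" for t
      using \<epsilon>(1) \<epsilon>(2)[of 0] \<epsilon>(2)[OF that] by (auto simp: topspace_Euclidean_space)
    have "\<forall>\<^sub>F t in at_right 0. x t i = x 0 i"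
      unfolding eventually_at_right_field
      by (intro exI[of _ \<epsilon>] conjI allI impI \<epsilon>(1) eq) simp
    then show ?thesis by (rule tendsto_eventually)
  qed
qed

lemma little_oh_poly_open_iff:
  assumes U: "openin (Euclidean_space n) U"
  shows "little_oh_poly n U x \<longleftrightarrow> little_oh_poly n (Rn n) x \<and> x 0 \<in> U"
proof
  assume x: "little_oh_poly n U x"
  then have "x 0 \<in> U" by (simp only: little_oh_poly_alt)
  moreover obtain \<epsilon> where "\<epsilon> > 0" "\<And>t. t \<in> {0..<\<epsilon>} \<Longrightarrow> x t \<in> U"
    using x unfolding little_oh_poly_alt by blast
  with openin_subset[OF U] have "\<exists>\<epsilon>>0. \<forall>t\<in>{0..<\<epsilon>}. x t \<in> Rn n"
    by (intro exI[of _ \<epsilon>]) (simp add: subset_iff)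
  ultimately show "little_oh_poly n (Rn n) x \<and> x 0 \<in> U"
    using x openin_subset[OF U] by (simp only: little_oh_poly_alt subset_iff simp_thms)
next
  assume x: "little_oh_poly n (Rn n) x \<and> x 0 \<in> U"
  have "Euclidean_space n = top_of_set (Rn n)"
    unfolding topspace_Euclidean_space by (simp only: Euclidean_space_def euclidean_product_topology)
  with U have "openin (top_of_set (Rn n)) U" by metis
  then obtain W where W: "open W" "U = W \<inter> Rn n"
    unfolding openin_open by blast
  have "limitin (powertop_real UNIV) x (x 0) (at_right 0)"
    unfolding limitin_componentwise using little_oh_poly_tendsto[OF conjunct1[OF x]]
    by (simp add: limitin_canonical_iff)
  then have "(x \<longlongrightarrow> x 0) (at_right 0)"
    unfolding euclidean_product_topology limitin_canonical_iff .
  then have "\<forall>\<^sub>F t in at_right 0. x t \<in> W"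
    using W x by (intro topological_tendstoD) blast+
  then obtain \<delta> where \<delta>: "\<delta> > 0" "\<And>t. 0 < t \<Longrightarrow> t < \<delta> \<Longrightarrow> x t \<in> W"
    unfolding eventually_at_right_field by blast
  obtain \<epsilon> where \<epsilon>: "\<epsilon> > 0" "\<And>t. t \<in> {0..<\<epsilon>} \<Longrightarrow> x t \<in> Rn n"
    using x unfolding little_oh_poly_alt by blast
  have "x t \<in> U" if "t \<in> {0..<min \<delta> \<epsilon>}" for t
  proof (cases "t = 0")
    case True
    with x show ?thesis by simp
  next
    case False
    with that have "x t \<in> W" "x t \<in> Rn n" using \<delta>(2)[of t] \<epsilon>(2)[of t] by simp_all
    with W show ?thesis by blast
  qed
  moreover have "min \<delta> \<epsilon> > 0" using \<delta> \<epsilon> by simp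
  ultimately have "\<exists>\<epsilon>>0. \<forall>t\<in>{0..<\<epsilon>}. x t \<in> U" by blast
  with x show "little_oh_poly n U x" by (simp only: little_oh_poly_alt simp_thms)
qed

lemma fermat_eq_std:
  assumes U: "openin (Euclidean_space n) U"
  shows "fermat n U = {c \<in> fermat n (Rn n). std c \<in> U}"
proof -
  note iff = little_oh_poly_open_iff[OF U]
  have eq: "fermat_rel n U `` {x} = fermat_rel n (Rn n) `` {x}" if "little_oh_poly n U x" for x
    using that unfolding fermat_rel_def Image_singleton by (auto simp: iff)
  show ?thesis
  proof (intro equalityI subsetI)
    fix c assume "c \<in> fermat n U"
    then obtain x where x: "little_oh_poly n U x" "c = fermat_rel n U `` {x}"
      unfolding fermat_def quotient_def by blast
    then have "std c = x 0" "little_oh_poly n (Rn n) x" "x 0 \<in> U"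
      using std_fermat_rel iff by simp_all
    with x eq show "c \<in> {c \<in> fermat n (Rn n). std c \<in> U}"
      unfolding fermat_def quotient_def by auto
  next
    fix c assume c: "c \<in> {c \<in> fermat n (Rn n). std c \<in> U}"
    then obtain x where x: "little_oh_poly n (Rn n) x" "c = fermat_rel n (Rn n) `` {x}"
      unfolding fermat_def quotient_def by blast
    with c have "little_oh_poly n U x"
      using std_fermat_rel iff by simp
    with x eq show "c \<in> fermat n U"
      unfolding fermat_def quotient_def by blast
  qed
qed

lemma openin_fermat_topology:
  "openin (fermat_topology n) S \<longleftrightarrow> (\<exists>U. openin (Euclidean_space n) U \<and> S = fermat n U)"
proof -
  have "istopology (\<lambda>S. \<exists>U. openin (Euclidean_space n) U \<and> S = fermat n U)"
    unfolding istopology_def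
  proof (intro conjI allI impI)
    fix S T
    assume "\<exists>U. openin (Euclidean_space n) U \<and> S = fermat n U"
      and "\<exists>U. openin (Euclidean_space n) U \<and> T = fermat n U"
    then obtain U V where U: "openin (Euclidean_space n) U" "S = fermat n U"
      and V: "openin (Euclidean_space n) V" "T = fermat n V" by blast
    have "S \<inter> T = fermat n (U \<inter> V)"
      unfolding U(2) V(2) fermat_eq_std[OF U(1)] fermat_eq_std[OF V(1)]
        fermat_eq_std[OF openin_Int[OF U(1) V(1)]] by blast
    with U V show "\<exists>U. openin (Euclidean_space n) U \<and> S \<inter> T = fermat n U"
      by blast
  next
    fix \<K> assume "\<forall>K\<in>\<K>. \<exists>U. openin (Euclidean_space n) U \<and> K = fermat n U"
    then obtain u where u: "\<And>K. K \<in> \<K> \<Longrightarrow> openin (Euclidean_space n) (u K)"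
      "\<And>K. K \<in> \<K> \<Longrightarrow> K = fermat n (u K)"
      by metis
    then have op: "openin (Euclidean_space n) (\<Union>(u ` \<K>))" by blast
    have "K = {c \<in> fermat n (Rn n). std c \<in> u K}" if "K \<in> \<K>" for K
      using u(2)[OF that] fermat_eq_std[OF u(1)[OF that]] by metis
    then have "\<Union>\<K> = fermat n (\<Union>(u ` \<K>))"
      unfolding fermat_eq_std[OF op] by blast
    with op show "\<exists>U. openin (Euclidean_space n) U \<and> \<Union>\<K> = fermat n U" by blast
  qed
  then show ?thesis
    by (simp add: fermat_topology_def)
qed


section \<open>Adding and deleting infinitesimals\<close>

abbreviation "diffeological_space \<equiv> concrete_sheaf S_site"
abbreviation "smooth_maps \<equiv> sheaf_maps S_site"
abbreviation "diffeomorphism \<equiv> sheaf_iso S_site"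
abbreviation "fermat_space \<equiv> concrete_sheaf F_site"
abbreviation "fermat_maps \<equiv> sheaf_maps F_site"

type_synonym 'a plot = "pt obj \<times> (pt \<Rightarrow> 'a)"
type_synonym 'a fplot = "pt obj \<times> (fpt \<Rightarrow> 'a)"

abbreviation fermat_obj :: "pt obj \<Rightarrow> fpt obj" where
  "fermat_obj A \<equiv> (fst A, fermat (fst A) (snd A))"

definition plots :: "(pt, 'a) csheaf \<Rightarrow> 'a plot set" where
  "plots X = {(A, p). A \<in> Obj S_site \<and> p \<in> sections X A}"

definition plot_homs :: "'a plot \<Rightarrow> 'a plot \<Rightarrow> (pt \<Rightarrow> pt) set" where
  "plot_homs = (\<lambda>(A, p) (B, q). {f \<in> Hom S_site A B. compose (snd A) q f = p})"

definition add_rel :: "(pt, 'a) csheaf \<Rightarrow> (('a plot \<times> fpt) \<times> ('a plot \<times> fpt)) set" where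
  "add_rel X = colim_rel (plots X)
     (\<lambda>(A, p). representable F_site (fermat_obj A))
     (\<lambda>(A, p) (B, q). fermat_map (fst A) (snd A) (fst B) (snd B) ` plot_homs (A, p) (B, q))"

definition add_inf :: "(pt, 'a) csheaf \<Rightarrow> (fpt, ('a plot \<times> fpt) set) csheaf" where
  "add_inf X = colimit F_site (plots X)
     (\<lambda>(A, p). representable F_site (fermat_obj A))
     (\<lambda>(A, p) (B, q). fermat_map (fst A) (snd A) (fst B) (snd B) ` plot_homs (A, p) (B, q))"

definition add_inf_map ::
  "(pt, 'a) csheaf \<Rightarrow> (pt, 'b) csheaf \<Rightarrow> ('a \<Rightarrow> 'b)
     \<Rightarrow> ('a plot \<times> fpt) set \<Rightarrow> ('b plot \<times> fpt) set" where
  "add_inf_map X Y g = (\<lambda>c\<in>points (add_inf X).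
     \<Union>((A, p), x)\<in>c. add_rel Y `` {((A, compose (snd A) g p), x)})"

text \<open>\<open>\<F>'/Y\<close>: an object \<open>p : \<^sup>\<bullet>U \<rightarrow> Y\<close> is recorded as \<open>((n, U), p)\<close>; \<open>U\<close> is determined by \<open>\<^sup>\<bullet>U\<close>.\<close>

definition fplots :: "(fpt, 'a) csheaf \<Rightarrow> 'a fplot set" where
  "fplots Y = {(A, p). A \<in> Obj S_site \<and> p \<in> sections Y (fermat_obj A)}"

definition fplot_homs :: "'a fplot \<Rightarrow> 'a fplot \<Rightarrow> (fpt \<Rightarrow> fpt) set" where
  "fplot_homs = (\<lambda>(A, p) (B, q).
     {f \<in> Hom F_site (fermat_obj A) (fermat_obj B). compose (snd (fermat_obj A)) q f = p})"

definition del_hom :: "pt obj \<Rightarrow> (fpt \<Rightarrow> fpt) \<Rightarrow> pt \<Rightarrow> pt" where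
  "del_hom A f = (\<lambda>u\<in>snd A. std (f (const_pt (fst A) (snd A) u)))"

definition del_rel :: "(fpt, 'a) csheaf \<Rightarrow> (('a fplot \<times> pt) \<times> ('a fplot \<times> pt)) set" where
  "del_rel Y = colim_rel (fplots Y)
     (\<lambda>(A, p). representable S_site A)
     (\<lambda>(A, p) (B, q). del_hom A ` fplot_homs (A, p) (B, q))"

definition del_inf :: "(fpt, 'a) csheaf \<Rightarrow> (pt, ('a fplot \<times> pt) set) csheaf" where
  "del_inf Y = colimit S_site (fplots Y)
     (\<lambda>(A, p). representable S_site A)
     (\<lambda>(A, p) (B, q). del_hom A ` fplot_homs (A, p) (B, q))"

definition del_inf_map ::
  "(fpt, 'a) csheaf \<Rightarrow> (fpt, 'b) csheaf \<Rightarrow> ('a \<Rightarrow> 'b)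
     \<Rightarrow> ('a fplot \<times> pt) set \<Rightarrow> ('b fplot \<times> pt) set" where
  "del_inf_map Y Z g = (\<lambda>c\<in>points (del_inf Y).
     \<Union>((A, p), u)\<in>c. del_rel Z `` {((A, compose (snd (fermat_obj A)) g p), u)})"

abbreviation del_add :: "(pt, 'a) csheaf \<Rightarrow> (pt, (('a plot \<times> fpt) set fplot \<times> pt) set) csheaf" where
  "del_add X \<equiv> del_inf (add_inf X)"

abbreviation del_add_map ::
  "(pt, 'a) csheaf \<Rightarrow> (pt, 'b) csheaf \<Rightarrow> ('a \<Rightarrow> 'b)
     \<Rightarrow> (('a plot \<times> fpt) set fplot \<times> pt) set \<Rightarrow> (('b plot \<times> fpt) set fplot \<times> pt) set" where
  "del_add_map X Y g \<equiv> del_inf_map (add_inf X) (add_inf Y) (add_inf_map X Y g)"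

text \<open>The colimit inclusion \<open>\<^sup>\<bullet>U \<rightarrow> \<^sup>\<bullet>X\<close> of the member of the diagram indexed by a plot \<open>p : U \<rightarrow> X\<close>.\<close>

definition add_incl :: "(pt, 'a) csheaf \<Rightarrow> 'a plot \<Rightarrow> fpt \<Rightarrow> ('a plot \<times> fpt) set" where
  "add_incl X = (\<lambda>(A, p). \<lambda>x\<in>snd (fermat_obj A). add_rel X `` {((A, p), x)})"

text \<open>The canonical comparison map: \<open>p u\<close>, for a plot \<open>p : U \<rightarrow> X\<close> and \<open>u \<in> U\<close>, is sent to the class of
  \<open>u\<close> in the copy of \<open>U\<close> indexed by the Fermat plot \<open>\<^sup>\<bullet>U \<rightarrow> \<^sup>\<bullet>X\<close> belonging to \<open>p\<close>.\<close>

definition canonical_map :: "(pt, 'a) csheaf \<Rightarrow> 'a \<Rightarrow> (('a plot \<times> fpt) set fplot \<times> pt) set" where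
  "canonical_map X = (\<lambda>x\<in>points X.
     \<Union>((A, p), u)\<in>{((A, p), u). (A, p) \<in> plots X \<and> u \<in> snd A \<and> p u = x}.
       del_rel (add_inf X) `` {((A, add_incl X (A, p)), u)})"

end

theory Submission
  imports Defs
begin

text \<open>Write a point of \<open>\<^sup>\<bullet>X\<close> as the class \<open>[q, v]\<close> of a plot \<open>q : U \<rightarrow> X\<close> and a point \<open>v \<in> \<^sup>\<bullet>U\<close>. The standard
  part \<open>[q, v] \<mapsto> q (\<^sup>\<circ>v)\<close> is a well defined map \<open>\<^sup>\<bullet>X \<rightarrow> X\<close>, because \<open>\<^sup>\<circ>(\<^sup>\<bullet>f v) = f (\<^sup>\<circ>v)\<close> for smooth \<open>f\<close>
  (\<open>std_point_class\<close>). A point of the composite is the class \<open>[P, u]\<close> of a Fermat plot \<open>P : \<^sup>\<bullet>U \<rightarrow> \<^sup>\<bullet>X\<close>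
  and a standard point \<open>u \<in> U\<close>; evaluating \<open>P\<close> at \<open>u\<close> and taking the standard part gives a map
  \<open>canonical_inverse\<close> from the composite to \<open>X\<close>, which turns out to invert \<open>canonical_map\<close>.

  Two properties of a quasi-standard smooth map \<open>\<sigma>\<close> make this work. Locally \<open>\<sigma> x = \<^sup>\<bullet>\<alpha> (p, x)\<close>, hence
  \<open>\<^sup>\<circ>(\<sigma> x) = \<alpha> (\<^sup>\<circ>p, \<^sup>\<circ>x)\<close>: the standard part of a value depends only on the standard part of the argument
  (\<open>qss_std_const\<close>), and it depends on it smoothly (\<open>qss_std_smooth\<close>). A Fermat plot \<open>P\<close> of \<open>\<^sup>\<bullet>X\<close> is
  locally \<open>v \<mapsto> [q, \<sigma> v]\<close> for such a \<open>\<sigma>\<close> (\<open>add_section_local\<close>), so the first property makes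
  \<open>canonical_inverse\<close> well defined, and the second one together with the sheaf condition of \<open>X\<close> makes it
  smooth. Restricting \<open>P\<close> to the neighbourhood where this local form holds does not change the class
  \<open>[P, u]\<close>, and there \<open>\<sigma>\<close> is a morphism from \<open>P\<close> to the Fermat plot belonging to \<open>q\<close>. So \<open>[P, u]\<close> is the
  class of a point in the copy of the domain of \<open>q\<close>, that is, a value of \<open>canonical_map\<close>
  (\<open>canonical_map_canonical_inverse\<close>). That \<open>canonical_map\<close> is itself well defined is seen by comparing
  every plot through \<open>x\<close> with the plot \<open>\<real>\<^sup>0 \<rightarrow> X\<close> at \<open>x\<close> (\<open>del_class_point_plot\<close>).

  The rest supplies the ground for this. Colimits of concrete sheaves are concrete sheaves, functorially,
  on every site with constant maps, refinements and pullbacks of covers (\<open>concrete_sheaf_colimit\<close>,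
  \<open>colim_map_sheaf_map\<close>). Both sites are of this kind; for Fermat sets this means that quasi-standard
  smooth maps are continuous and closed under composition. Behind the latter lie the chain rule for
  \<open>C\<^sup>k\<close> functions and the fact that a smooth function of a little-oh polynomial is again a little-oh
  polynomial, which is Taylor expansion along segments (\<open>Taylor_along_powsum\<close>).\<close>

abbreviation "open_Rn n \<equiv> openin (Euclidean_space n)"
abbreviation "lop \<equiv> little_oh_poly"
abbreviation "qss \<equiv> quasi_standard_smooth"
abbreviation "fermat_of A \<equiv> fermat (fst A) (snd A)"
abbreviation "fermat_map_of A B \<equiv> fermat_map (fst A) (snd A) (fst B) (snd B)"
abbreviation "const_of A \<equiv> const_pt (fst A) (snd A)"

section \<open>Calculus of \<open>C\<^sup>k\<close> functions on open subsets of \<open>\<real>\<^sup>n\<close>\<close>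

lemma Rn_iff: "x \<in> Rn n \<longleftrightarrow> (\<forall>i\<ge>n. x i = 0)"
  by (simp add: topspace_Euclidean_space)

lemma Euclidean_space_eq_top_of_set: "Euclidean_space n = top_of_set (Rn n)"
  unfolding topspace_Euclidean_space
  by (simp only: Euclidean_space_def euclidean_product_topology)

lemma openin_Euclidean_iff:
  "open_Rn n U \<longleftrightarrow> (\<exists>W. open W \<and> U = Rn n \<inter> W)"
  by (subst Euclidean_space_eq_top_of_set) (simp add: openin_open)

text \<open>The neighbourhoods used for all local estimates. A half-width \<open>d\<close> that serves finitely many coordinates
  at once is a minimum, and a cube around \<open>(p, x)\<close> is a product of cubes.\<close>

definition cube :: "nat \<Rightarrow> pt \<Rightarrow> real \<Rightarrow> pt set" where
  "cube n x d = {y \<in> Rn n. \<forall>j<n. \<bar>y j - x j\<bar> < d}"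

lemma center_in_cube: "x \<in> Rn n \<Longrightarrow> d > 0 \<Longrightarrow> x \<in> cube n x d"
  by (simp add: cube_def)

lemma cube_mono: "d \<le> e \<Longrightarrow> cube n x d \<subseteq> cube n x e"
  by (force simp: cube_def)

lemma openin_cube: "open_Rn n (cube n x d)"
proof -
  have "open (\<Inter>j\<in>{..<n}. {y::pt. \<bar>y j - x j\<bar> < d})"
    by (intro open_INT ballI open_Collect_less continuous_intros) auto
  moreover have "cube n x d = Rn n \<inter> (\<Inter>j\<in>{..<n}. {y::pt. \<bar>y j - x j\<bar> < d})"
    by (auto simp: cube_def)
  ultimately show ?thesis
    unfolding openin_Euclidean_iff by blast
qed

lemma openin_contains_cube:
  assumes U: "open_Rn n U" and x: "x \<in> U"
  obtains d where "d > 0" "cube n x d \<subseteq> U"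
proof -
  obtain W where W: "open W" "U = Rn n \<inter> W"
    using U unfolding openin_Euclidean_iff by blast
  have "openin (product_topology (\<lambda>_::nat. euclideanreal) UNIV) W"
    using W(1) by (simp add: euclidean_product_topology)
  then obtain X where X: "x \<in> Pi\<^sub>E UNIV X" "\<And>i. openin euclideanreal (X i)" "Pi\<^sub>E UNIV X \<subseteq> W"
    and fin: "finite {i. X i \<noteq> UNIV}"
    using product_topology_open_contains_basis[of "\<lambda>_. euclideanreal" UNIV W x] x W(2) by auto
  have "\<exists>e>0. \<forall>y. \<bar>y - x i\<bar> < e \<longrightarrow> y \<in> X i" for i
    using X(1) X(2)[of i] by (auto simp: open_real PiE_def Pi_def)
  then obtain e where e: "\<And>i. e i > 0" "\<And>i y. \<bar>y - x i\<bar> < e i \<Longrightarrow> y \<in> X i"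
    by metis
  define d where "d = Min (insert 1 (e ` {..<n}))"
  have "d > 0" using e by (auto simp: d_def)
  moreover have "cube n x d \<subseteq> U"
  proof
    fix y assume y: "y \<in> cube n x d"
    have "y i \<in> X i" for i
    proof (cases "i < n")
      case True
      then have "d \<le> e i" by (auto simp: d_def)
      with True y show ?thesis by (intro e(2)) (force simp: cube_def)
    next
      case False
      with y x W show ?thesis
        by (intro e(2)) (auto simp: cube_def Rn_iff e(1))
    qed
    with X(3) y W show "y \<in> U" by (auto simp: cube_def)
  qed
  ultimately show ?thesis by (rule that)
qed

lemma openin_Euclidean_cubeI:
  assumes "\<And>x. x \<in> U \<Longrightarrow> x \<in> Rn n \<and> (\<exists>d>0. cube n x d \<subseteq> U)"
  shows "open_Rn n U"
  by (subst openin_subopen) (meson assms center_in_cube openin_cube)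

lemma openin_le_Rn: "open_Rn n U \<Longrightarrow> U \<subseteq> Rn n"
  by (rule openin_subset)

lemma continuous_map_Euclidean_iff:
  assumes "U \<subseteq> Rn n"
  shows "continuous_map (subtopology (Euclidean_space n) U) euclideanreal f \<longleftrightarrow> continuous_on U f"
  using assms by (subst Euclidean_space_eq_top_of_set) (simp add: subtopology_subtopology Int_absorb1)

lemma openin_continuous_preimage:
  assumes U: "open_Rn n U" and f: "continuous_on U f" and W: "open W"
  shows "open_Rn n (U \<inter> f -` W)"
  using openin_trans[OF continuous_openin_preimage_gen[OF f W], of "Rn n"] U
  by (metis Euclidean_space_eq_top_of_set)

lemma continuous_on_into_Rn:
  assumes F: "F \<in> U \<rightarrow> Rn m" and "\<And>j. j < m \<Longrightarrow> continuous_on U (\<lambda>x. F x j)"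
  shows "continuous_on U F"
proof (rule continuous_on_coordinatewise_then_product)
  fix j show "continuous_on U (\<lambda>x. F x j)"
  proof (cases "j < m")
    case False
    with F have "F x j = 0" if "x \<in> U" for x using that by (auto simp: Rn_iff Pi_iff)
    then show ?thesis using continuous_on_eq[of U "\<lambda>_. 0"] by auto
  qed (use assms in blast)
qed

lemma continuous_on_cube:
  assumes U: "open_Rn n U" and f: "continuous_on U (f :: pt \<Rightarrow> real)"
    and x: "x \<in> U" and e: "e > 0"
  obtains d where "d > 0" "cube n x d \<subseteq> U" "\<And>y. y \<in> cube n x d \<Longrightarrow> \<bar>f y - f x\<bar> < e"
proof -
  have "open_Rn n (U \<inter> f -` ball (f x) e)"
    using U f by (intro openin_continuous_preimage) auto
  moreover have "x \<in> U \<inter> f -` ball (f x) e" using x e by auto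
  ultimately obtain d where "d > 0" "cube n x d \<subseteq> U \<inter> f -` ball (f x) e"
    by (rule openin_contains_cube)
  then show ?thesis
    by (intro that[of d]) (auto simp: dist_real_def abs_minus_commute subset_iff)
qed

lemma upd_in_openin:
  assumes U: "open_Rn n U" and x: "x \<in> U" and i: "i < n"
  shows "\<forall>\<^sub>F t in nhds (x i). x(i := t) \<in> U"
proof -
  obtain d where d: "d > 0" "cube n x d \<subseteq> U"
    using openin_contains_cube[OF U x] .
  have xR: "x \<in> Rn n" using openin_le_Rn[OF U] x by blast
  have "x(i := t) \<in> U" if "dist t (x i) < d" for t
  proof -
    have "x(i := t) \<in> cube n x d"
      using that i d(1) xR by (auto simp: cube_def Rn_iff dist_real_def)
    with d show ?thesis by blast
  qed
  with d(1) show ?thesis unfolding eventually_nhds_metric by blast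
qed

definition partials :: "nat \<Rightarrow> pt set \<Rightarrow> (pt \<Rightarrow> real) \<Rightarrow> (nat \<Rightarrow> pt \<Rightarrow> real) \<Rightarrow> bool" where
  "partials n U f g \<longleftrightarrow>
     (\<forall>i<n. \<forall>x\<in>U. ((\<lambda>t. f (x(i := t))) has_real_derivative g i x) (at (x i)))"

lemma Ck_0:
  "U \<subseteq> Rn n \<Longrightarrow> Ck 0 n U f \<longleftrightarrow> continuous_on U f"
  by (simp add: continuous_map_Euclidean_iff)

lemma Ck_Suc:
  assumes "U \<subseteq> Rn n"
  shows "Ck (Suc k) n U f \<longleftrightarrow>
     continuous_on U f \<and> (\<exists>g. partials n U f g \<and> (\<forall>i<n. Ck k n U (g i)))"
proof -
  have "(\<forall>i<n. \<exists>g. Ck k n U g \<and> (\<forall>x\<in>U. ((\<lambda>t. f (x(i := t))) has_real_derivative g x) (at (x i))))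
     \<longleftrightarrow> (\<exists>g. partials n U f g \<and> (\<forall>i<n. Ck k n U (g i)))"
  proof
    assume "\<forall>i<n. \<exists>g. Ck k n U g \<and> (\<forall>x\<in>U. ((\<lambda>t. f (x(i := t))) has_real_derivative g x) (at (x i)))"
    then obtain g where "\<And>i. i < n \<Longrightarrow> Ck k n U (g i) \<and>
        (\<forall>x\<in>U. ((\<lambda>t. f (x(i := t))) has_real_derivative g i x) (at (x i)))" by metis
    then show "\<exists>g. partials n U f g \<and> (\<forall>i<n. Ck k n U (g i))"
      unfolding partials_def by blast
  qed (auto simp: partials_def)
  then show ?thesis
    using continuous_map_Euclidean_iff[OF assms] by simp
qed

declare Ck.simps [simp del]

lemma Ck_continuous: "U \<subseteq> Rn n \<Longrightarrow> Ck k n U f \<Longrightarrow> continuous_on U f"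
  by (cases k) (simp_all add: Ck_0 Ck_Suc)

lemma Ck_mono_order: "U \<subseteq> Rn n \<Longrightarrow> Ck (Suc k) n U f \<Longrightarrow> Ck k n U f"
  by (induction k arbitrary: f) (auto simp: Ck_0 Ck_Suc)

lemma partials_cong:
  assumes U: "open_Rn n U" and "\<And>x. x \<in> U \<Longrightarrow> f x = f' x" and "partials n U f g"
  shows "partials n U f' g"
  unfolding partials_def
proof (intro allI impI ballI)
  fix i x assume ix: "i < n" "x \<in> U"
  have "\<forall>\<^sub>F t in nhds (x i). f (x(i := t)) = f' (x(i := t))"
    using upd_in_openin[OF U ix(2,1)] assms(2) by (auto elim: eventually_mono)
  moreover have "((\<lambda>t. f (x(i := t))) has_real_derivative g i x) (at (x i))"
    using assms(3) ix by (simp add: partials_def)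
  ultimately show "((\<lambda>t. f' (x(i := t))) has_real_derivative g i x) (at (x i))"
    using DERIV_cong_ev[OF refl _ refl, THEN iffD1] by fast
qed

lemma Ck_cong:
  assumes U: "open_Rn n U" and eq: "\<And>x. x \<in> U \<Longrightarrow> f x = f' x" and f: "Ck k n U f"
  shows "Ck k n U f'"
proof (cases k)
  case 0
  with f eq continuous_on_eq show ?thesis by (auto simp: Ck_0 openin_le_Rn[OF U])
next
  case (Suc l)
  with f obtain g where "continuous_on U f" "partials n U f g" "\<forall>i<n. Ck l n U (g i)"
    by (auto simp: Ck_Suc openin_le_Rn[OF U])
  moreover from this have "partials n U f' g" using partials_cong[OF U eq] by simp
  ultimately show ?thesis using eq continuous_on_eq[of U f f']
    by (auto simp: Suc Ck_Suc openin_le_Rn[OF U])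
qed

lemma Ck_subset:
  assumes "U \<subseteq> Rn n" "V \<subseteq> U" "Ck k n U f" shows "Ck k n V f"
proof -
  have V: "V \<subseteq> Rn n" using assms by blast
  show ?thesis
    using assms(3)
  proof (induction k arbitrary: f)
    case 0
    then show ?case using assms continuous_on_subset by (auto simp: Ck_0[OF assms(1)] Ck_0[OF V])
  next
    case (Suc k)
    then obtain g where g: "continuous_on U f" "partials n U f g" "\<forall>i<n. Ck k n U (g i)"
      by (auto simp: Ck_Suc[OF assms(1)])
    then have "partials n V f g" using assms(2) by (auto simp: partials_def)
    with g Suc.IH show ?case
      using continuous_on_subset[OF g(1) assms(2)] by (auto simp: Ck_Suc[OF V])
  qed
qed

lemma Ck_const: "U \<subseteq> Rn n \<Longrightarrow> Ck k n U (\<lambda>_. c)"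
proof (induction k arbitrary: c)
  case (Suc k)
  have "partials n U (\<lambda>_. c) (\<lambda>_ _. 0)" by (simp add: partials_def)
  with Suc show ?case by (auto simp: Ck_Suc)
qed (simp add: Ck_0)

lemma Ck_coord:
  assumes "U \<subseteq> Rn n" shows "Ck k n U (\<lambda>x. x j)"
proof -
  have c: "continuous_on U (\<lambda>x::pt. x j)"
    using continuous_on_product_coordinates by (rule continuous_on_subset) simp
  have "partials n U (\<lambda>x. x j) (\<lambda>i _. if i = j then 1 else 0)"
    by (simp add: partials_def)
  with c assms Ck_const show ?thesis
    by (cases k) (auto simp: Ck_0 Ck_Suc)
qed

lemma Ck_add:
  assumes "U \<subseteq> Rn n" "Ck k n U f" "Ck k n U g"
  shows "Ck k n U (\<lambda>x. f x + g x)"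
  using assms(2,3)
proof (induction k arbitrary: f g)
  case 0
  then show ?case by (simp add: Ck_0 assms continuous_on_add continuous_on_mult)
next
  case (Suc k)
  then obtain f' g' where f: "continuous_on U f" "partials n U f f'" "\<forall>i<n. Ck k n U (f' i)"
    and g: "continuous_on U g" "partials n U g g'" "\<forall>i<n. Ck k n U (g' i)"
    by (auto simp: Ck_Suc assms)
  have "partials n U (\<lambda>x. f x + g x) (\<lambda>i x. f' i x + g' i x)"
    using f g by (auto simp: partials_def intro!: derivative_intros)
  with f g Suc.IH show ?case by (auto simp: Ck_Suc assms intro!: continuous_intros exI)
qed

lemma Ck_mult:
  assumes "U \<subseteq> Rn n" "Ck k n U f" "Ck k n U g"
  shows "Ck k n U (\<lambda>x. f x * g x)"
  using assms(2,3)
proof (induction k arbitrary: f g)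
  case 0
  then show ?case by (simp add: Ck_0 assms continuous_on_add continuous_on_mult)
next
  case (Suc k)
  then obtain f' g' where f: "continuous_on U f" "partials n U f f'" "\<forall>i<n. Ck k n U (f' i)"
    and g: "continuous_on U g" "partials n U g g'" "\<forall>i<n. Ck k n U (g' i)"
    by (auto simp: Ck_Suc assms)
  have "partials n U (\<lambda>x. f x * g x) (\<lambda>i x. f' i x * g x + g' i x * f x)"
    unfolding partials_def
  proof (intro allI impI ballI)
    fix i x assume "i < n" "x \<in> U"
    then have "((\<lambda>t. f (x(i := t))) has_real_derivative f' i x) (at (x i))"
      "((\<lambda>t. g (x(i := t))) has_real_derivative g' i x) (at (x i))"
      using f g by (auto simp: partials_def)
    from DERIV_mult[OF this] 
    show "((\<lambda>t. f (x(i := t)) * g (x(i := t))) has_real_derivative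
        f' i x * g x + g' i x * f x) (at (x i))" by simp
  qed
  moreover have "Ck k n U (\<lambda>x. f' i x * g x + g' i x * f x)" if "i < n" for i
    using that f(3) g(3) Suc Ck_mono_order[OF assms(1)] by (intro Ck_add Suc.IH assms) auto
  ultimately show ?case using f g
    by (auto simp: Ck_Suc assms intro!: continuous_intros exI)
qed

lemma Ck_sum:
  assumes "U \<subseteq> Rn n" "\<And>j. j \<in> J \<Longrightarrow> Ck k n U (f j)"
  shows "Ck k n U (\<lambda>x. \<Sum>j\<in>J. f j x)"
  using assms(2)
  by (induction J rule: infinite_finite_induct) (simp_all add: assms(1) Ck_const Ck_add)

text \<open>Moving from \<open>z\<close> to \<open>y\<close> one coordinate at a time, each step is controlled by the mean value theorem and
  by the continuity of one partial derivative. Having two moving points instead of one moving and one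
  fixed point costs nothing and yields a local Lipschitz bound besides differentiability.\<close>

lemma strictly_differentiable:
  assumes U: "open_Rn n U" and f: "partials n U f g"
    and g: "\<And>i. i < n \<Longrightarrow> continuous_on U (g i)" and r: "r \<in> U" and e: "e > 0"
  obtains d where "d > 0" "cube n r d \<subseteq> U"
    "\<And>y z. y \<in> cube n r d \<Longrightarrow> z \<in> cube n r d \<Longrightarrow>
        \<bar>f y - f z - (\<Sum>i<n. g i r * (y i - z i))\<bar> \<le> e * (\<Sum>i<n. \<bar>y i - z i\<bar>)"
proof -
  have "\<exists>d. d > 0 \<and> cube n r d \<subseteq> U \<and> (\<forall>y\<in>cube n r d. \<bar>g i y - g i r\<bar> < e)" if "i < n" for i
    using continuous_on_cube[OF U g[OF that] r e] by metis
  then obtain \<delta> where \<delta>: "\<And>i. i < n \<Longrightarrow> \<delta> i > 0"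
    "\<And>i y. i < n \<Longrightarrow> y \<in> cube n r (\<delta> i) \<Longrightarrow> \<bar>g i y - g i r\<bar> < e"
    by metis
  obtain d0 where d0: "d0 > 0" "cube n r d0 \<subseteq> U" using openin_contains_cube[OF U r] .
  define d where "d = Min (insert d0 (\<delta> ` {..<n}))"
  have d: "d > 0" "d \<le> d0" "\<And>i. i < n \<Longrightarrow> d \<le> \<delta> i" using d0 \<delta> by (auto simp: d_def)
  have dU: "cube n r d \<subseteq> U" using cube_mono[OF d(2)] d0 by blast
  have ge: "\<bar>g i y - g i r\<bar> \<le> e" if "i < n" "y \<in> cube n r d" for i y
    using \<delta>(2)[OF that(1), of y] cube_mono[OF d(3)[OF that(1)]] that(2) by force
  show ?thesis
  proof (rule that[OF d(1) dU])
    fix y z assume y: "y \<in> cube n r d" and z: "z \<in> cube n r d"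
    \<comment> \<open>The path from \<open>z = w 0\<close> to \<open>y = w n\<close> that changes one coordinate at a time.\<close>
    define w where "w k = (\<lambda>j. if j < k then y j else z j)" for k
    have w0: "w 0 = z" by (simp add: w_def)
    have wn: "w n = y" using y z by (auto simp: w_def cube_def Rn_iff fun_eq_iff)
    have step: "\<bar>f (w (Suc k)) - f (w k) - g k r * (y k - z k)\<bar> \<le> e * \<bar>y k - z k\<bar>" if k: "k < n" for k
    proof -
      define S where "S = closed_segment (z k) (y k)"
      \<comment> \<open>Subtracting the linear term leaves a function whose derivative is at most \<open>e\<close> in absolute value.\<close>
      define \<phi> where "\<phi> t = f ((w k)(k := t)) - g k r * t" for t
      have inC: "(w k)(k := t) \<in> cube n r d" if "t \<in> S" for t
      proof -
        have "convex {t. \<bar>t - r k\<bar> < d}"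
          using convex_ball[of "r k" d] by (simp add: ball_def dist_real_def abs_minus_commute)
        moreover have "z k \<in> {t. \<bar>t - r k\<bar> < d}" "y k \<in> {t. \<bar>t - r k\<bar> < d}"
          using y z k by (auto simp: cube_def)
        ultimately have "S \<subseteq> {t. \<bar>t - r k\<bar> < d}"
          unfolding S_def by (simp add: closed_segment_subset)
        with that have "\<bar>t - r k\<bar> < d" by blast
        with y z k show ?thesis by (auto simp: cube_def Rn_iff w_def)
      qed
      have "norm (\<phi> (y k) - \<phi> (z k)) \<le> e * norm (y k - z k)"
      proof (rule field_differentiable_bound)
        show "convex S" by (simp add: S_def)
        fix t assume t: "t \<in> S"
        have "((\<lambda>u. f (((w k)(k := t))(k := u))) has_real_derivative g k ((w k)(k := t))) (at (((w k)(k := t)) k))"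
          using f k inC[OF t] dU unfolding partials_def by blast
        then have "((\<lambda>u. f ((w k)(k := u))) has_real_derivative g k ((w k)(k := t))) (at t)" by simp
        then have "(\<phi> has_real_derivative g k ((w k)(k := t)) - g k r) (at t)"
          unfolding \<phi>_def by (auto intro!: derivative_eq_intros)
        then show "(\<phi> has_field_derivative g k ((w k)(k := t)) - g k r) (at t within S)"
          by (rule has_field_derivative_at_within)
        show "norm (g k ((w k)(k := t)) - g k r) \<le> e" using ge[OF k inC[OF t]] by simp
      qed (auto simp: S_def)
      moreover have "(w k)(k := y k) = w (Suc k)" "(w k)(k := z k) = w k"
        by (auto simp: w_def fun_eq_iff)
      ultimately show ?thesis by (simp add: \<phi>_def algebra_simps)
    qed
    have "f y - f z - (\<Sum>i<n. g i r * (y i - z i)) =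
        (\<Sum>k<n. f (w (Suc k)) - f (w k)) - (\<Sum>i<n. g i r * (y i - z i))"
      using sum_lessThan_telescope[of "\<lambda>k. f (w k)" n] by (simp add: w0 wn)
    also have "\<dots> = (\<Sum>k<n. f (w (Suc k)) - f (w k) - g k r * (y k - z k))"
      by (simp add: sum_subtractf)
    finally show "\<bar>f y - f z - (\<Sum>i<n. g i r * (y i - z i))\<bar> \<le> e * (\<Sum>i<n. \<bar>y i - z i\<bar>)"
      unfolding sum_distrib_left
      using step by (auto intro!: order_trans[OF sum_abs] sum_mono)
  qed
qed

text \<open>The chain rule for a curve into \<open>\<real>\<^sup>n\<close>: the difference between the quotient of \<open>f \<circ> \<gamma>\<close> and the
  corresponding combination of the quotients of the coordinates is at most \<open>e\<close> times a bounded quantity.\<close>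

lemma DERIV_along_curve:
  assumes U: "open_Rn n U" and f: "partials n U f g"
    and g: "\<And>i. i < n \<Longrightarrow> continuous_on U (g i)"
    and \<gamma>U: "\<forall>\<^sub>F t in nhds t0. \<gamma> t \<in> U"
    and \<gamma>: "\<And>j. j < n \<Longrightarrow> ((\<lambda>t. \<gamma> t j) has_real_derivative \<gamma>' j) (at t0)"
  shows "((\<lambda>t. f (\<gamma> t)) has_real_derivative (\<Sum>j<n. g j (\<gamma> t0) * \<gamma>' j)) (at t0)"
proof -
  have r: "\<gamma> t0 \<in> U" using eventually_nhds_x_imp_x[OF \<gamma>U] .
  define q where "q j t = (\<gamma> t j - \<gamma> t0 j) / (t - t0)" for j t
  define Q where "Q t = (f (\<gamma> t) - f (\<gamma> t0)) / (t - t0)" for t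
  define L where "L t = (\<Sum>j<n. g j (\<gamma> t0) * q j t)" for t
  define S where "S t = (\<Sum>j<n. \<bar>q j t\<bar>)" for t
  have q: "((\<lambda>t. q j t) \<longlongrightarrow> \<gamma>' j) (at t0)" if "j < n" for j
    using \<gamma>[OF that] by (simp add: has_field_derivative_iff q_def)
  have L: "(L \<longlongrightarrow> (\<Sum>j<n. g j (\<gamma> t0) * \<gamma>' j)) (at t0)"
    unfolding L_def using q by (intro tendsto_intros) auto
  have S: "(S \<longlongrightarrow> (\<Sum>j<n. \<bar>\<gamma>' j\<bar>)) (at t0)"
    unfolding S_def using q by (intro tendsto_intros) auto
  have ev: "\<forall>\<^sub>F t in at t0. \<bar>Q t - L t\<bar> \<le> e * S t" if e: "e > 0" for e
  proof -
    obtain d where d: "d > 0" "cube n (\<gamma> t0) d \<subseteq> U"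
      "\<And>y z. y \<in> cube n (\<gamma> t0) d \<Longrightarrow> z \<in> cube n (\<gamma> t0) d \<Longrightarrow>
        \<bar>f y - f z - (\<Sum>i<n. g i (\<gamma> t0) * (y i - z i))\<bar> \<le> e * (\<Sum>i<n. \<bar>y i - z i\<bar>)"
    proof (rule strictly_differentiable[OF U f _ r e])
      show "\<And>i. i < n \<Longrightarrow> continuous_on U (g i)" by (rule g)
    qed (rule that)
    have near: "\<forall>\<^sub>F t in at t0. \<bar>\<gamma> t j - \<gamma> t0 j\<bar> < d" if "j < n" for j
    proof -
      have "((\<lambda>t. \<gamma> t j) \<longlongrightarrow> \<gamma> t0 j) (at t0)"
        using DERIV_isCont[OF \<gamma>[OF that]] by (simp add: isCont_def)
      from tendstoD[OF this d(1)] show ?thesis by (simp add: dist_real_def)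
    qed
    have "\<forall>\<^sub>F t in at t0. \<forall>j\<in>{..<n}. \<bar>\<gamma> t j - \<gamma> t0 j\<bar> < d"
      using near by (intro eventually_ball_finite) simp_all
    moreover have "\<forall>\<^sub>F t in at t0. \<gamma> t \<in> U"
      using \<gamma>U by (simp add: eventually_nhds_conv_at)
    ultimately show ?thesis
    proof (eventually_elim, goal_cases)
      case (1 t)
      show ?case
      proof (cases "t = t0")
        case True
        then show ?thesis by (simp add: Q_def L_def S_def q_def)
      next
        case False
        have "\<gamma> t \<in> cube n (\<gamma> t0) d" using 1 openin_le_Rn[OF U] by (auto simp: cube_def)
        moreover have "\<gamma> t0 \<in> cube n (\<gamma> t0) d" using r openin_le_Rn[OF U] d(1) by (auto simp: cube_def)
        ultimately have "\<bar>f (\<gamma> t) - f (\<gamma> t0) - (\<Sum>i<n. g i (\<gamma> t0) * (\<gamma> t i - \<gamma> t0 i))\<bar> / \<bar>t - t0\<bar>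
            \<le> e * (\<Sum>i<n. \<bar>\<gamma> t i - \<gamma> t0 i\<bar>) / \<bar>t - t0\<bar>"
          by (intro divide_right_mono d(3)) auto
        also have "\<dots> = e * S t" by (simp add: S_def q_def flip: sum_divide_distrib)
        finally have "\<bar>(f (\<gamma> t) - f (\<gamma> t0) - (\<Sum>i<n. g i (\<gamma> t0) * (\<gamma> t i - \<gamma> t0 i))) / (t - t0)\<bar> \<le> e * S t"
          by (simp add: abs_divide)
        moreover have "(f (\<gamma> t) - f (\<gamma> t0) - (\<Sum>i<n. g i (\<gamma> t0) * (\<gamma> t i - \<gamma> t0 i))) / (t - t0) = Q t - L t"
          unfolding Q_def L_def q_def diff_divide_distrib[of _ "sum _ _"] by (simp add: sum_divide_distrib)
        ultimately show ?thesis by simp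
      qed
    qed
  qed
  have "((\<lambda>t. Q t - L t) \<longlongrightarrow> 0) (at t0)"
  proof (rule tendstoI)
    fix e :: real assume e: "e > 0"
    define M where "M = (\<Sum>j<n. \<bar>\<gamma>' j\<bar>) + 1"
    have M: "M > 0" by (simp add: M_def add_nonneg_pos sum_nonneg)
    have "\<forall>\<^sub>F t in at t0. S t < M"
      using order_tendstoD(2)[OF S, of M] by (simp add: M_def)
    moreover have "\<forall>\<^sub>F t in at t0. \<bar>Q t - L t\<bar> \<le> e / (2 * M) * S t" using e M by (intro ev) simp
    ultimately show "\<forall>\<^sub>F t in at t0. dist (Q t - L t) 0 < e"
    proof eventually_elim
      case (elim t)
      have "\<bar>Q t - L t\<bar> \<le> e / (2 * M) * S t" by fact
      also have "\<dots> \<le> e / (2 * M) * M" using elim e M by (intro mult_left_mono) auto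
      also have "\<dots> < e" using e M by simp
      finally show ?case by simp
    qed
  qed
  from tendsto_add[OF this L] show ?thesis
    by (simp add: has_field_derivative_iff Q_def)
qed

text \<open>By induction on \<open>k\<close>, since the partial derivatives of a composite are sums of products of functions to
  which the induction hypothesis applies.\<close>

lemma Ck_compose:
  assumes U: "open_Rn n U" and V: "open_Rn m V"
    and F: "F \<in> U \<rightarrow> V" and "\<And>j. j < m \<Longrightarrow> Ck k n U (\<lambda>x. F x j)" and "Ck k m V h"
  shows "Ck k n U (\<lambda>x. h (F x))"
  using assms(4,5)
proof (induction k arbitrary: h)
  have UR: "U \<subseteq> Rn n" and VR: "V \<subseteq> Rn m" using U V openin_le_Rn by auto
  have cont: "continuous_on U (\<lambda>x. h (F x))"
    if "\<And>j. j < m \<Longrightarrow> Ck k n U (\<lambda>x. F x j)" "Ck k m V h" for h k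
  proof -
    have "continuous_on U F"
      using F VR that(1) Ck_continuous[OF UR] by (intro continuous_on_into_Rn[of F U m]) blast+
    with F show ?thesis using Ck_continuous[OF VR that(2)]
      by (intro continuous_on_compose2[of V h U F]) auto
  qed
  {
    case 0
    show ?case using cont[OF 0] by (simp add: Ck_0[OF UR])
  next
    case (Suc k)
    obtain h' where h: "partials m V h h'" "\<And>i. i < m \<Longrightarrow> Ck k m V (h' i)"
      using Suc.prems(2) by (auto simp: Ck_Suc[OF VR])
    have "\<exists>G. partials n U (\<lambda>x. F x j) G \<and> (\<forall>i<n. Ck k n U (G i))" if "j < m" for j
      using Suc.prems(1)[OF that] by (auto simp: Ck_Suc[OF UR])
    then obtain G where G: "\<And>j. j < m \<Longrightarrow> partials n U (\<lambda>x. F x j) (G j)"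
      "\<And>j i. j < m \<Longrightarrow> i < n \<Longrightarrow> Ck k n U (G j i)" by metis
    have Fk: "Ck k n U (\<lambda>x. F x j)" if "j < m" for j
      using Suc.prems(1)[OF that] Ck_mono_order[OF UR] by blast
    have "partials n U (\<lambda>x. h (F x)) (\<lambda>i x. \<Sum>j<m. h' j (F x) * G j i x)"
      unfolding partials_def
    proof (intro allI impI ballI)
      fix i x assume ix: "i < n" "x \<in> U"
      have "((\<lambda>t. h (F (x(i := t)))) has_real_derivative
          (\<Sum>j<m. h' j (F (x(i := x i))) * G j i x)) (at (x i))"
      proof (rule DERIV_along_curve[OF V h(1)])
        show "\<And>i. i < m \<Longrightarrow> continuous_on V (h' i)" using h(2) Ck_continuous[OF VR] by blast
        show "\<forall>\<^sub>F t in nhds (x i). F (x(i := t)) \<in> V"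
          using upd_in_openin[OF U ix(2,1)] by eventually_elim (use F in blast)
        show "((\<lambda>t. F (x(i := t)) j) has_real_derivative G j i x) (at (x i))" if "j < m" for j
          using G(1)[OF that] ix by (simp add: partials_def)
      qed
      then show "((\<lambda>t. h (F (x(i := t)))) has_real_derivative (\<Sum>j<m. h' j (F x) * G j i x)) (at (x i))"
        by simp
    qed
    moreover have "Ck k n U (\<lambda>x. \<Sum>j<m. h' j (F x) * G j i x)" if "i < n" for i
    proof (intro Ck_sum UR)
      fix j assume "j \<in> {..<m}"
      then have j: "j < m" by simp
      show "Ck k n U (\<lambda>x. h' j (F x) * G j i x)"
        using Suc.IH[OF Fk h(2)[OF j]] G(2)[OF j that] by (rule Ck_mult[OF UR])
    qed
    moreover have "continuous_on U (\<lambda>x. h (F x))"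
      using Suc.prems by (rule cont)
    ultimately show ?case unfolding Ck_Suc[OF UR]
      by (intro conjI exI[of _ "\<lambda>i x. \<Sum>j<m. h' j (F x) * G j i x"]) simp_all
  }
qed

section \<open>Expansions in real powers\<close>

abbreviation smallo_id :: "(real \<Rightarrow> real) set" where
  "smallo_id \<equiv> o[at_right 0](\<lambda>t. t)"

text \<open>All norms on \<open>\<real>\<^sup>n\<close> are equivalent; this reduces vectors to coordinates.\<close>

lemma little_o_iff: "little_o n d \<longleftrightarrow> (\<forall>j<n. (\<lambda>t. d t j) \<in> smallo_id)"
proof
  assume L: "little_o n d"
  show "\<forall>j<n. (\<lambda>t. d t j) \<in> smallo_id"
  proof (intro allI impI)
    fix j assume j: "j < n"
    have "\<bar>d t j\<bar> \<le> \<bar>L2_set (d t) {..<n}\<bar>" for t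
    proof -
      have "\<bar>d t j\<bar> = L2_set (d t) {j}" by (simp add: L2_set_def)
      also have "\<dots> \<le> L2_set (d t) {..<n}"
        unfolding L2_set_def using j by (intro real_sqrt_le_mono sum_mono2) auto
      finally show ?thesis by simp
    qed
    then have "(\<lambda>t. d t j) \<in> O[at_right 0](\<lambda>t. L2_set (d t) {..<n})"
      by (intro landau_o.bigI[of 1]) auto
    with L show "(\<lambda>t. d t j) \<in> smallo_id"
      unfolding little_o_def by (rule landau_o.big_small_trans[rotated])
  qed
next
  assume *: "\<forall>j<n. (\<lambda>t. d t j) \<in> smallo_id"
  have "(\<lambda>t. \<Sum>j<n. \<bar>d t j\<bar>) \<in> smallo_id"
    using * by (intro big_sum_in_smallo) auto
  moreover have "(\<lambda>t. L2_set (d t) {..<n}) \<in> O[at_right 0](\<lambda>t. \<Sum>j<n. \<bar>d t j\<bar>)"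
    by (intro landau_o.bigI[of 1]) (simp_all add: sum_nonneg L2_set_le_sum_abs)
  ultimately show "little_o n d"
    unfolding little_o_def by (rule landau_o.big_small_trans[rotated])
qed

lemma smallo_id_cmult: "f \<in> smallo_id \<Longrightarrow> (\<lambda>t. c * f t) \<in> smallo_id"
  by (cases "c = 0") simp_all

text \<open>Finite sums of terms \<open>c s\<^sup>k t\<^sup>a\<close> with \<open>a > 0\<close>. The second variable \<open>s\<close> is the position on the segment
  along which a function is expanded; keeping it makes the class closed under integration in \<open>s\<close>, so that
  Taylor polynomials need no multi-indices.\<close>

inductive powsum :: "(real \<Rightarrow> real \<Rightarrow> real) \<Rightarrow> bool" where
  zero: "powsum (\<lambda>s t. 0)"
| plus_monomial: "powsum g \<Longrightarrow> a > 0 \<Longrightarrow> powsum (\<lambda>s t. c * s ^ k * t powr a + g s t)"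

lemma powsum_monomial: "a > 0 \<Longrightarrow> powsum (\<lambda>s t. c * s ^ k * t powr a)"
  using powsum.plus_monomial[OF powsum.zero, of a c k] by simp

lemma powsum_add: "powsum f \<Longrightarrow> powsum g \<Longrightarrow> powsum (\<lambda>s t. f s t + g s t)"
proof (induction rule: powsum.induct)
  case (plus_monomial f a c k)
  then show ?case
    using powsum.plus_monomial[of "\<lambda>s t. f s t + g s t" a c k] by (simp add: add.assoc)
qed simp

lemma powsum_monomial_mult:
  assumes "powsum g" and "b > 0"
  shows "powsum (\<lambda>s t. (d * s ^ l * t powr b) * g s t)"
  using assms(1)
proof induction
  case zero
  then show ?case using powsum.zero by simp
next
  case (plus_monomial g a c k)
  have "(\<lambda>s t. d * s ^ l * t powr b * (c * s ^ k * t powr a + g s t)) =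
      (\<lambda>s t. (d * c) * s ^ (l + k) * t powr (b + a) + (d * s ^ l * t powr b) * g s t)"
    by (auto simp: fun_eq_iff algebra_simps powr_add power_add)
  with powsum.plus_monomial[OF plus_monomial.IH, of "b + a" "d * c" "l + k"] plus_monomial.hyps assms
  show ?case by simp
qed

lemma powsum_mult: "powsum f \<Longrightarrow> powsum g \<Longrightarrow> powsum (\<lambda>s t. f s t * g s t)"
proof (induction rule: powsum.induct)
  case zero
  then show ?case using powsum.zero by simp
next
  case (plus_monomial f a c k)
  then show ?case
    using powsum_add[OF powsum_monomial_mult[of g a c k] plus_monomial.IH]
    by (simp add: distrib_right)
qed

lemma powsum_cmult: "powsum g \<Longrightarrow> powsum (\<lambda>s t. d * g s t)"
proof (induction rule: powsum.induct)
  case zero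
  then show ?case using powsum.zero by simp
next
  case (plus_monomial g a c k)
  then show ?case using powsum.plus_monomial[OF plus_monomial.IH, of a "d * c" k]
    by (simp add: algebra_simps)
qed

lemma powsum_sum: "(\<And>j. j \<in> J \<Longrightarrow> powsum (f j)) \<Longrightarrow> powsum (\<lambda>s t. \<Sum>j\<in>J. f j s t)"
  by (induction J rule: infinite_finite_induct) (simp_all add: powsum.zero powsum_add)

lemma powsum_at_1: "powsum g \<Longrightarrow> powsum (\<lambda>s t. g 1 t)"
proof (induction rule: powsum.induct)
  case (plus_monomial g a c k)
  then show ?case using powsum.plus_monomial[OF plus_monomial.IH, of a c 0] by simp
qed (rule powsum.zero)

lemma powsum_primitive:
  assumes "powsum g"
  shows "\<exists>G. powsum G \<and> (\<forall>t. G 0 t = 0) \<and>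
    (\<forall>s t. ((\<lambda>u. G u t) has_real_derivative g s t) (at s))"
  using assms
proof induction
  case zero
  then show ?case by (intro exI[of _ "\<lambda>_ _. 0"]) (simp add: powsum.zero)
next
  case (plus_monomial g a c k)
  then obtain G where G: "powsum G" "\<And>t. G 0 t = 0"
    "\<And>s t. ((\<lambda>u. G u t) has_real_derivative g s t) (at s)" by blast
  let ?H = "\<lambda>s t. c / real (Suc k) * s ^ Suc k * t powr a + G s t"
  have "((\<lambda>u. ?H u t) has_real_derivative c * s ^ k * t powr a + g s t) (at s)" for s t
    by (rule derivative_eq_intros G(3) refl | simp add: field_simps)+
  moreover have "powsum ?H" by (intro powsum.plus_monomial G plus_monomial)
  ultimately show ?case using G(2) by (intro exI[of _ ?H]) auto
qed

text \<open>The smallest exponent dominates on \<open>[0, 1]\<close>.\<close>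

lemma powsum_bound:
  assumes "powsum g"
  shows "\<exists>\<delta> C. \<delta> > 0 \<and> C \<ge> 0 \<and> (\<forall>s\<in>{0..1}. \<forall>t\<in>{0..1}. \<bar>g s t\<bar> \<le> C * t powr \<delta>)"
  using assms
proof induction
  case zero
  then show ?case by (intro exI[of _ 1] exI[of _ 0]) simp
next
  case (plus_monomial g a c k)
  then obtain \<delta> C where G: "\<delta> > 0" "C \<ge> 0"
    "\<And>s t. s \<in> {0..1} \<Longrightarrow> t \<in> {0..1} \<Longrightarrow> \<bar>g s t\<bar> \<le> C * t powr \<delta>" by blast
  have "\<bar>c * s ^ k * t powr a + g s t\<bar> \<le> (\<bar>c\<bar> + C) * t powr (min a \<delta>)"
    if st: "s \<in> {0..1}" "t \<in> {0..1}" for s t :: real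
  proof -
    have p: "t powr a \<le> t powr (min a \<delta>)" "t powr \<delta> \<le> t powr (min a \<delta>)"
      using st by (cases "t = 0"; auto intro: powr_mono')+
    have "\<bar>s ^ k\<bar> \<le> 1" using st by (simp add: power_le_one)
    then have "\<bar>c\<bar> * \<bar>s ^ k\<bar> * t powr a \<le> \<bar>c\<bar> * 1 * t powr (min a \<delta>)"
      using p by (intro mult_mono) auto
    moreover have "\<bar>g s t\<bar> \<le> C * t powr (min a \<delta>)"
      using G(3)[OF st] mult_left_mono[OF p(2) G(2)] by linarith
    ultimately show ?thesis
      using abs_triangle_ineq[of "c * s ^ k * t powr a" "g s t"]
      by (simp add: abs_mult algebra_simps)
  qed
  with G plus_monomial.hyps show ?case
    by (intro exI[of _ "min a \<delta>"] exI[of _ "\<bar>c\<bar> + C"]) auto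
qed

lemma powsum_finite_sum:
  assumes "powsum g"
  shows "\<exists>(k::nat) c a. (\<forall>i\<in>{1..k}. a i > 0) \<and> (\<forall>t. g 1 t = (\<Sum>i=1..k. c i * t powr a i))"
  using assms
proof induction
  case zero
  then show ?case by (intro exI[of _ 0]) auto
next
  case (plus_monomial g b d l)
  then obtain k :: nat and c a where "\<And>i. i \<in> {1..k} \<Longrightarrow> a i > 0"
    "\<And>t. g 1 t = (\<Sum>i=1..k. c i * t powr a i)" by blast
  with plus_monomial.hyps show ?case
    by (intro exI[of _ "Suc k"] exI[of _ "c(Suc k := d)"] exI[of _ "a(Suc k := b)"]) auto
qed

text \<open>The one-dimensional form of a little-oh polynomial.\<close>

definition expandable :: "(real \<Rightarrow> real) \<Rightarrow> bool" where
  "expandable h \<longleftrightarrow> (\<exists>g. powsum g \<and> (\<lambda>t. h t - h 0 - g 1 t) \<in> smallo_id)"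

text \<open>Different coordinates may use different exponents. They are merged into a single list by letting the
  coefficient vectors be multiples of the unit vectors.\<close>

lemma lop_iff_expandable:
  assumes U: "U \<subseteq> Rn n"
  shows "lop n U x \<longleftrightarrow>
    (\<exists>\<epsilon>>0. \<forall>t\<in>{0..<\<epsilon>}. x t \<in> U) \<and> (\<forall>j<n. expandable (\<lambda>t. x t j))" (is "?L \<longleftrightarrow> ?R")
proof
  assume ?L
  then obtain k :: nat and \<alpha> a where ka: "\<And>i. i \<in> {1..k} \<Longrightarrow> a i > 0"
    and lo: "little_o n (\<lambda>t j. x t j - x 0 j - (\<Sum>i=1..k. \<alpha> i j * t powr a i))"
    and ex: "\<exists>\<epsilon>>0. \<forall>t\<in>{0..<\<epsilon>}. x t \<in> U"
    unfolding little_oh_poly_alt by blast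
  have "expandable (\<lambda>t. x t j)" if j: "j < n" for j
    unfolding expandable_def
  proof (intro exI conjI)
    show "powsum (\<lambda>s t. \<Sum>i=1..k. \<alpha> i j * s ^ 0 * t powr a i)"
      by (intro powsum_sum powsum_monomial ka)
    show "(\<lambda>t. x t j - x 0 j - (\<Sum>i=1..k. \<alpha> i j * 1 ^ 0 * t powr a i)) \<in> smallo_id"
      using lo j by (simp add: little_o_iff)
  qed
  with ex show ?R by blast
next
  assume R: ?R
  then obtain \<epsilon> where \<epsilon>: "\<epsilon> > 0" "\<And>t. t \<in> {0..<\<epsilon>} \<Longrightarrow> x t \<in> U" by blast
  define E where "E j k c a \<longleftrightarrow> (\<forall>i\<in>{1..k}. a i > 0) \<and>
      (\<lambda>t. x t j - x 0 j - (\<Sum>i=1..k. c i * t powr a i)) \<in> smallo_id"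
    for j and k :: nat and c a :: "nat \<Rightarrow> real"
  have "\<exists>k c a. E j k c a" if j: "j < n" for j
  proof -
    from R j obtain g where g: "powsum g" "(\<lambda>t. x t j - x 0 j - g 1 t) \<in> smallo_id"
      by (auto simp: expandable_def)
    moreover obtain k :: nat and c a where "\<forall>i\<in>{1..k}. a i > 0"
      "\<And>t. g 1 t = (\<Sum>i=1..k. c i * t powr a i)"
      using powsum_finite_sum[OF g(1)] by blast
    ultimately show ?thesis unfolding E_def by (intro exI[of _ k] exI[of _ c] exI[of _ a]) simp
  qed
  then obtain k :: "nat \<Rightarrow> nat" and c a where E: "\<And>j. j < n \<Longrightarrow> E j (k j) (c j) (a j)"
    by metis
  then have a: "\<And>j i. j < n \<Longrightarrow> i \<in> {1..k j} \<Longrightarrow> a j i > 0" and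
    lo: "\<And>j. j < n \<Longrightarrow> (\<lambda>t. x t j - x 0 j - (\<Sum>i=1..k j. c j i * t powr a j i)) \<in> smallo_id"
    unfolding E_def by blast+
  \<comment> \<open>One index for each coordinate and each term of its expansion.\<close>
  define I where "I = (SIGMA j:{..<n}. {1..k j})"
  obtain h where h: "bij_betw h {1..card I} I"
    using ex_bij_betw_nat_finite_1[of I] by (auto simp: I_def)
  have hI: "h i \<in> I" if "i \<in> {1..card I}" for i using h that by (rule bij_betw_apply)
  define \<alpha> where "\<alpha> i = (\<lambda>j. if j = fst (h i) then c (fst (h i)) (snd (h i)) else 0)" for i
  define b where "b i = a (fst (h i)) (snd (h i))" for i
  have "\<alpha> i \<in> Rn n \<and> b i > 0" if "i \<in> {1..card I}" for i
    using hI[OF that] a by (auto simp: \<alpha>_def b_def I_def Rn_iff)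
  moreover have "little_o n (\<lambda>t j. x t j - x 0 j - (\<Sum>i=1..card I. \<alpha> i j * t powr b i))"
    unfolding little_o_iff
  proof (intro allI impI)
    fix j assume j: "j < n"
    have "(\<Sum>i=1..card I. \<alpha> i j * t powr b i) = (\<Sum>i=1..k j. c j i * t powr a j i)" for t
    proof -
      have "(\<Sum>i=1..card I. \<alpha> i j * t powr b i) =
          (\<Sum>i=1..card I. (\<lambda>(l, i). (if j = l then c l i else 0) * t powr a l i) (h i))"
        by (simp add: \<alpha>_def b_def case_prod_beta)
      also have "\<dots> = (\<Sum>(l, i)\<in>I. (if j = l then c l i else 0) * t powr a l i)"
        by (rule sum.reindex_bij_betw[OF h])
      also have "\<dots> = (\<Sum>l<n. \<Sum>i=1..k l. (if j = l then c l i else 0) * t powr a l i)"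
        by (simp add: I_def sum.Sigma)
      also have "\<dots> = (\<Sum>l<n. if j = l then (\<Sum>i=1..k l. c l i * t powr a l i) else 0)"
        by (intro sum.cong) auto
      finally show ?thesis using j by simp
    qed
    with lo[OF j] show "(\<lambda>t. x t j - x 0 j - (\<Sum>i=1..card I. \<alpha> i j * t powr b i)) \<in> smallo_id"
      by simp
  qed
  ultimately have "\<exists>(k::nat) \<alpha> a. (\<forall>i\<in>{1..k}. \<alpha> i \<in> Rn n \<and> a i > 0) \<and>
        little_o n (\<lambda>t j. x t j - x 0 j - (\<Sum>i=1..k. \<alpha> i j * t powr a i))"
    by blast
  with \<epsilon> show ?L unfolding little_oh_poly_alt by auto
qed

lemma powr_in_smallo_id: "b > 1 \<Longrightarrow> (\<lambda>t::real. t powr b) \<in> smallo_id"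
proof (rule smalloI_tendsto)
  assume b: "b > 1"
  have "((\<lambda>t::real. t powr (b - 1)) \<longlongrightarrow> 0 powr (b - 1)) (at_right 0)"
    using b eventually_at_right_less[of "0::real"]
    by (intro tendsto_powr2 tendsto_ident_at tendsto_const) (auto elim: eventually_mono)
  then have "((\<lambda>t::real. t powr (b - 1)) \<longlongrightarrow> 0) (at_right 0)" by simp
  moreover have "\<forall>\<^sub>F t in at_right (0::real). t powr (b - 1) = t powr b / t"
    using eventually_at_right_less[of "0::real"] by eventually_elim (simp add: powr_diff)
  ultimately show "((\<lambda>t::real. t powr b / t) \<longlongrightarrow> 0) (at_right 0)"
    using tendsto_cong by fast
qed (use eventually_at_right_less[of "0::real"] in \<open>auto elim: eventually_mono\<close>)

text \<open>Let \<open>x t - r\<close> be a sum of positive powers of \<open>t\<close> up to \<open>o(t)\<close>. By induction on \<open>N\<close>, a \<open>C\<^sup>N\<close> function on the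
  segment from \<open>r\<close> to \<open>x t\<close> is a \<open>powsum\<close> up to \<open>O(t\<^bsup>N \<delta>\<^esup>) + o(t)\<close>, uniformly in the position \<open>s\<close>: the
  derivative in \<open>s\<close> is the sum of the \<open>(x t j - r j) \<partial>\<^sub>j f\<close>, where the induction hypothesis expands the
  partial derivatives of \<open>f\<close> and the factors \<open>x t j - r j = O(t\<^sup>\<delta>)\<close> improve the error, and integration
  in \<open>s\<close> preserves both the class of sums and the error bound.\<close>

lemma Taylor_along_powsum:
  assumes U: "open_Rn n U" and r: "r \<in> U"
    and xR: "\<forall>\<^sub>F t in at_right 0. x t \<in> Rn n"
    and g: "\<And>j. j < n \<Longrightarrow> powsum (g j)"
    and lo: "\<And>j. j < n \<Longrightarrow> (\<lambda>t. x t j - r j - g j 1 t) \<in> smallo_id"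
    and \<delta>: "\<delta> > 0" and C: "C \<ge> 0"
    and bound: "\<And>j. j < n \<Longrightarrow> \<forall>\<^sub>F t in at_right 0. \<bar>x t j - r j\<bar> \<le> C * t powr \<delta>"
    and f: "Ck N n U f"
  shows "\<exists>G K h. powsum G \<and> K \<ge> 0 \<and> h \<in> smallo_id \<and> (\<forall>\<^sub>F t in at_right 0. \<forall>s\<in>{0..1}.
    \<bar>f (\<lambda>j. r j + s * (x t j - r j)) - f r - G s t\<bar> \<le> K * t powr (real N * \<delta>) + \<bar>h t\<bar>)"
  using f
proof (induction N arbitrary: f)
  define z where "z s t = (\<lambda>j. r j + s * (x t j - r j))" for s t
  note UR = openin_le_Rn[OF U]
  have rR: "r \<in> Rn n" using r UR by blast
  have allb: "\<forall>\<^sub>F t in at_right 0. \<forall>j\<in>{..<n}. \<bar>x t j - r j\<bar> \<le> C * t powr \<delta>"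
    using bound by (intro eventually_ball_finite) auto
  \<comment> \<open>The range of \<open>s\<close> exceeds \<open>[0, 1]\<close>, so that two-sided derivatives exist at the end points.\<close>
  have near: "\<forall>\<^sub>F t in at_right 0. \<forall>s. \<bar>s\<bar> < 2 \<longrightarrow> z s t \<in> cube n r d" if d: "d > 0" for d
  proof -
    have "((\<lambda>t::real. C * t powr \<delta>) \<longlongrightarrow> C * 0 powr \<delta>) (at_right 0)"
      using \<delta> eventually_at_right_less[of "0::real"]
      by (intro tendsto_mult tendsto_powr2 tendsto_ident_at tendsto_const) (auto elim: eventually_mono)
    then have "\<forall>\<^sub>F t in at_right 0. C * t powr \<delta> < d / 2"
      using d by (intro order_tendstoD(2)) auto
    then show ?thesis using allb xR
    proof eventually_elim
      case (elim t)
      show ?case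
      proof (intro allI impI)
        fix s :: real assume s: "\<bar>s\<bar> < 2"
        have "\<bar>z s t j - r j\<bar> < d" if "j < n" for j
        proof -
          have "\<bar>s\<bar> * \<bar>x t j - r j\<bar> \<le> 2 * \<bar>x t j - r j\<bar>" using s by (intro mult_right_mono) auto
          also have "\<dots> < d" using elim that by force
          finally show ?thesis by (simp add: z_def abs_mult)
        qed
        with elim rR show "z s t \<in> cube n r d" by (simp add: cube_def Rn_iff z_def)
      qed
    qed
  qed
  obtain d0 where d0: "d0 > 0" "cube n r d0 \<subseteq> U" using openin_contains_cube[OF U r] .
  {
    case (0 f)
    then have fc: "continuous_on U f" by (simp add: Ck_0[OF UR])
    obtain d where
      d: "d > 0" "cube n r d \<subseteq> U" "\<And>y. y \<in> cube n r d \<Longrightarrow> \<bar>f y - f r\<bar> < 1"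
      by (rule continuous_on_cube[OF U fc r zero_less_one]) (rule that)
    have "\<forall>\<^sub>F t in at_right 0. \<forall>s\<in>{0..1}. \<bar>f (z s t) - f r - 0\<bar> \<le> 1 * t powr (real 0 * \<delta>) + \<bar>0\<bar>"
      using near[OF d(1)] eventually_at_right_less[of "0::real"]
    proof eventually_elim
      case (elim t)
      show ?case
      proof
        fix s :: real assume "s \<in> {0..1}"
        then have "z s t \<in> cube n r d" using elim by simp
        from d(3)[OF this] elim show "\<bar>f (z s t) - f r - 0\<bar> \<le> 1 * t powr (real 0 * \<delta>) + \<bar>0\<bar>" by simp
      qed
    qed
    then show ?case unfolding z_def
      by (intro exI[of _ "\<lambda>_ _. 0"] exI[of _ 1] exI[of _ "\<lambda>_. 0"] conjI powsum.zero) auto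
  next
    case (Suc N f)
    then obtain f' where f': "partials n U f f'" "\<And>j. j < n \<Longrightarrow> Ck N n U (f' j)"
      by (auto simp: Ck_Suc[OF UR])
    have f'c: "\<And>j. j < n \<Longrightarrow> continuous_on U (f' j)" using f'(2) Ck_continuous[OF UR] by blast
    define E where "E j G K h \<longleftrightarrow> powsum G \<and> K \<ge> 0 \<and> h \<in> smallo_id \<and> (\<forall>\<^sub>F t in at_right 0. \<forall>s\<in>{0..1}.
        \<bar>f' j (z s t) - f' j r - G s t\<bar> \<le> K * t powr (real N * \<delta>) + \<bar>h t\<bar>)" for j G K h
    have "\<exists>G K h. E j G K h" if "j < n" for j
      unfolding E_def z_def by (rule Suc.IH[OF f'(2)[OF that]])
    then obtain G K h where E: "\<And>j. j < n \<Longrightarrow> E j (G j) (K j) (h j)"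
      by metis
    then have G: "\<And>j. j < n \<Longrightarrow> powsum (G j)" and K: "\<And>j. j < n \<Longrightarrow> K j \<ge> 0"
      and h: "\<And>j. j < n \<Longrightarrow> h j \<in> smallo_id"
      and IH: "\<And>j. j < n \<Longrightarrow> \<forall>\<^sub>F t in at_right 0. \<forall>s\<in>{0..1}.
        \<bar>f' j (z s t) - f' j r - G j s t\<bar> \<le> K j * t powr (real N * \<delta>) + \<bar>h j t\<bar>"
      unfolding E_def by blast+
    have "\<exists>M. M \<ge> 0 \<and> (\<forall>s\<in>{0..1}. \<forall>t\<in>{0..1}. \<bar>G j s t\<bar> \<le> M)" if j: "j < n" for j
    proof -
      obtain \<delta>' C' where *: "\<delta>' > 0" "C' \<ge> 0"
        "\<And>s t. s \<in> {0..1} \<Longrightarrow> t \<in> {0..1} \<Longrightarrow> \<bar>G j s t\<bar> \<le> C' * t powr \<delta>'"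
        using powsum_bound[OF G[OF j]] by blast
      have "\<bar>G j s t\<bar> \<le> C'" if "s \<in> {0..1}" "t \<in> {0..1}" for s t
      proof -
        have "t powr \<delta>' \<le> 1" using that *(1) by (intro powr_le1) auto
        then have "C' * t powr \<delta>' \<le> C' * 1" using *(2) by (intro mult_left_mono)
        with *(3)[OF that] show ?thesis by simp
      qed
      with *(2) show ?thesis by blast
    qed
    then obtain M where M: "\<And>j. j < n \<Longrightarrow> M j \<ge> 0"
      "\<And>j s t. j < n \<Longrightarrow> s \<in> {0..1} \<Longrightarrow> t \<in> {0..1} \<Longrightarrow> \<bar>G j s t\<bar> \<le> M j"
      by metis
    define e where "e j t = x t j - r j - g j 1 t" for j t
    \<comment> \<open>The expansion of the derivative along the segment, and \<open>Q\<close> its integral.\<close>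
    define P where "P s t = (\<Sum>j<n. f' j r * g j 1 t + g j 1 t * G j s t)" for s t
    have "powsum P" unfolding P_def
      by (intro powsum_sum powsum_add powsum_cmult powsum_mult powsum_at_1 g G) auto
    from powsum_primitive[OF this] obtain Q where Q: "powsum Q" "\<And>t. Q 0 t = 0"
      "\<And>s t. ((\<lambda>u. Q u t) has_real_derivative P s t) (at s)" by blast
    define K' where "K' = (\<Sum>j<n. K j * C)"
    define H where "H t = (\<Sum>j<n. C * \<bar>h j t\<bar> + (\<bar>f' j r\<bar> + M j) * \<bar>e j t\<bar>)" for t
    have Hlo: "H \<in> smallo_id" unfolding H_def
      using h lo unfolding e_def
      by (intro big_sum_in_smallo sum_in_smallo smallo_id_cmult) simp_all
    have K'0: "K' \<ge> 0" unfolding K'_def using K C by (intro sum_nonneg mult_nonneg_nonneg) auto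
    have H0: "H t \<ge> 0" for t unfolding H_def using M C by (intro sum_nonneg) auto
    have "\<forall>\<^sub>F t in at_right 0. \<forall>j\<in>{..<n}. \<forall>s\<in>{0..1}.
        \<bar>f' j (z s t) - f' j r - G j s t\<bar> \<le> K j * t powr (real N * \<delta>) + \<bar>h j t\<bar>"
      using IH by (intro eventually_ball_finite) auto
    moreover have "\<forall>\<^sub>F t in at_right 0. t < (1::real)"
      by (rule eventually_at_rightI[of 0 1]) auto
    ultimately have "\<forall>\<^sub>F t in at_right 0. \<forall>s\<in>{0..1}.
        \<bar>f (z s t) - f r - Q s t\<bar> \<le> K' * t powr (real (Suc N) * \<delta>) + \<bar>H t\<bar>"
      using near[OF d0(1)] allb eventually_at_right_less[of "0::real"]
    proof eventually_elim
      case (elim t)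
      have t: "t \<in> {0..1}" "t > 0" using elim by auto
      have zU: "z s t \<in> U" if "\<bar>s\<bar> < 2" for s using that elim(3) d0 by blast
      define B where "B = K' * t powr (real (Suc N) * \<delta>) + H t"
      have t\<delta>: "t powr \<delta> \<le> 1" using t \<delta> by (intro powr_le1) auto
      define \<phi> where "\<phi> s = f (z s t) - f r - Q s t" for s
      have der: "(\<phi> has_real_derivative (\<Sum>j<n. f' j (z s t) * (x t j - r j)) - P s t) (at s)"
        if s: "s \<in> {0..1}" for s
      proof -
        have "((\<lambda>s. f (z s t)) has_real_derivative (\<Sum>j<n. f' j (z s t) * (x t j - r j))) (at s)"
        proof (rule DERIV_along_curve[OF U f'(1)])
          show "\<And>i. i < n \<Longrightarrow> continuous_on U (f' i)" by (rule f'c)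
          have "\<forall>\<^sub>F s in nhds s. s \<in> {-2<..<2::real}"
            using s by (intro eventually_nhds_in_open) auto
          then show "\<forall>\<^sub>F s in nhds s. z s t \<in> U"
            by eventually_elim (auto intro: zU)
          show "((\<lambda>s. z s t j) has_real_derivative x t j - r j) (at s)" for j
            unfolding z_def by (auto intro!: derivative_eq_intros)
        qed
        with Q(3) show ?thesis unfolding \<phi>_def by (auto intro!: derivative_eq_intros)
      qed
      have le: "\<bar>(\<Sum>j<n. f' j (z s t) * (x t j - r j)) - P s t\<bar> \<le> B" if s: "s \<in> {0..1}" for s
      proof -
        have "\<bar>f' j (z s t) * (x t j - r j) - (f' j r * g j 1 t + g j 1 t * G j s t)\<bar> \<le>
            K j * C * t powr (real (Suc N) * \<delta>) + (C * \<bar>h j t\<bar> + (\<bar>f' j r\<bar> + M j) * \<bar>e j t\<bar>)"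
          if j: "j < n" for j
        proof -
          have "\<bar>f' j (z s t) - f' j r - G j s t\<bar> * \<bar>x t j - r j\<bar>
              \<le> (K j * t powr (real N * \<delta>) + \<bar>h j t\<bar>) * (C * t powr \<delta>)"
            using elim j s K[OF j] by (intro mult_mono) auto
          also have "\<dots> = K j * C * t powr (real (Suc N) * \<delta>) + C * \<bar>h j t\<bar> * t powr \<delta>"
            by (simp add: algebra_simps powr_add)
          also have "C * \<bar>h j t\<bar> * t powr \<delta> \<le> C * \<bar>h j t\<bar> * 1"
            using t\<delta> C by (intro mult_left_mono) auto
          finally have 1: "\<bar>(f' j (z s t) - f' j r - G j s t) * (x t j - r j)\<bar> \<le>
              K j * C * t powr (real (Suc N) * \<delta>) + C * \<bar>h j t\<bar>" by (simp add: abs_mult)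
          have "\<bar>f' j r + G j s t\<bar> * \<bar>e j t\<bar> \<le> (\<bar>f' j r\<bar> + M j) * \<bar>e j t\<bar>"
            using M(2)[OF j s t(1)] by (intro mult_right_mono) auto
          then have 2: "\<bar>(f' j r + G j s t) * e j t\<bar> \<le> (\<bar>f' j r\<bar> + M j) * \<bar>e j t\<bar>"
            by (simp add: abs_mult)
          have "f' j (z s t) * (x t j - r j) - (f' j r * g j 1 t + g j 1 t * G j s t) =
              (f' j (z s t) - f' j r - G j s t) * (x t j - r j) + (f' j r + G j s t) * e j t"
            by (simp add: e_def algebra_simps)
          with 1 2 show ?thesis by linarith
        qed
        then have "(\<Sum>j<n. \<bar>f' j (z s t) * (x t j - r j) - (f' j r * g j 1 t + g j 1 t * G j s t)\<bar>)
            \<le> (\<Sum>j<n. K j * C * t powr (real (Suc N) * \<delta>) + (C * \<bar>h j t\<bar> + (\<bar>f' j r\<bar> + M j) * \<bar>e j t\<bar>))"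
          by (intro sum_mono) auto
        also have "\<dots> = B" by (simp only: B_def K'_def H_def sum.distrib sum_distrib_right)
        finally show ?thesis unfolding P_def
          using sum_abs[of "\<lambda>j. f' j (z s t) * (x t j - r j) - (f' j r * g j 1 t + g j 1 t * G j s t)" "{..<n}"]
          by (simp only: sum_subtractf)
      qed
      have "z 0 t = r" by (simp add: z_def)
      then have \<phi>0: "\<phi> 0 = 0" by (simp add: \<phi>_def Q(2))
      show ?case
      proof
        fix s :: real assume s: "s \<in> {0..1}"
        have "norm (\<phi> s - \<phi> 0) \<le> B * norm (s - 0)"
        proof (rule field_differentiable_bound)
          show "convex {0..1::real}" by (rule convex_real_interval)
          show "\<And>s. s \<in> {0..1} \<Longrightarrow> (\<phi> has_field_derivative (\<Sum>j<n. f' j (z s t) * (x t j - r j)) - P s t) (at s within {0..1})"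
            using der has_field_derivative_at_within by blast
          show "\<And>s. s \<in> {0..1} \<Longrightarrow> norm ((\<Sum>j<n. f' j (z s t) * (x t j - r j)) - P s t) \<le> B"
            using le by simp
        qed (use s in auto)
        also have "\<dots> \<le> B * 1"
          using s K'0 H0 unfolding B_def by (intro mult_left_mono) auto
        finally show "\<bar>f (z s t) - f r - Q s t\<bar> \<le> K' * t powr (real (Suc N) * \<delta>) + \<bar>H t\<bar>"
          using H0[of t] by (simp add: \<phi>0 B_def) (simp add: \<phi>_def)
      qed
    qed
    with Q(1) K'0 Hlo show ?case unfolding z_def by blast
  }
qed

text \<open>The expansion to an order \<open>N\<close> with \<open>N \<delta> > 1\<close> has error \<open>o(t)\<close>.\<close>

lemma smooth_expandable:
  assumes U: "open_Rn n U" and x: "lop n U x"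
    and f: "\<And>k. Ck k n U f"
  shows "expandable (\<lambda>t. f (x t))"
proof -
  note UR = openin_le_Rn[OF U]
  obtain \<epsilon> where \<epsilon>: "\<epsilon> > 0" "\<And>t. t \<in> {0..<\<epsilon>} \<Longrightarrow> x t \<in> U"
    and ex: "\<And>j. j < n \<Longrightarrow> expandable (\<lambda>t. x t j)"
    using x unfolding lop_iff_expandable[OF UR] by blast
  have r: "x 0 \<in> U" using \<epsilon> by simp
  have "\<exists>g. powsum g \<and> (\<lambda>t. x t j - x 0 j - g 1 t) \<in> smallo_id" if "j < n" for j
    using ex[OF that] by (simp add: expandable_def)
  then obtain g where g: "\<And>j. j < n \<Longrightarrow> powsum (g j)"
    and lo: "\<And>j. j < n \<Longrightarrow> (\<lambda>t. x t j - x 0 j - g j 1 t) \<in> smallo_id" by metis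
  have "\<exists>\<delta> C. \<delta> > 0 \<and> C \<ge> 0 \<and> (\<forall>s\<in>{0..1}. \<forall>t\<in>{0..1}. \<bar>g j s t\<bar> \<le> C * t powr \<delta>)" if "j < n" for j
    using powsum_bound[OF g[OF that]] .
  then obtain \<Delta> D where D: "\<And>j. j < n \<Longrightarrow> \<Delta> j > 0" "\<And>j. j < n \<Longrightarrow> D j \<ge> 0"
    "\<And>j s t. j < n \<Longrightarrow> s \<in> {0..1} \<Longrightarrow> t \<in> {0..1} \<Longrightarrow> \<bar>g j s t\<bar> \<le> D j * t powr \<Delta> j"
    by metis
  \<comment> \<open>The bound \<open>\<delta> \<le> 1\<close> lets \<open>t\<^sup>\<delta>\<close> absorb the error \<open>o(t)\<close> of the curve; this accounts for the \<open>1\<close> in \<open>C\<close>.\<close>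
  define \<delta> where "\<delta> = Min (insert 1 (\<Delta> ` {..<n}))"
  define C where "C = (\<Sum>j<n. D j) + 1"
  have \<delta>: "\<delta> > 0" "\<delta> \<le> 1" "\<And>j. j < n \<Longrightarrow> \<delta> \<le> \<Delta> j" using D by (auto simp: \<delta>_def)
  have C: "C \<ge> 0" using D by (auto simp: C_def intro!: add_nonneg_nonneg sum_nonneg)
  have t1: "\<forall>\<^sub>F t in at_right 0. t < (1::real)"
    by (rule eventually_at_rightI[of 0 1]) auto
  have bound: "\<forall>\<^sub>F t in at_right 0. \<bar>x t j - x 0 j\<bar> \<le> C * t powr \<delta>" if j: "j < n" for j
    using landau_o.smallD[OF lo[OF j] zero_less_one] t1 eventually_at_right_less[of "0::real"]
  proof eventually_elim
    case (elim t)
    have t: "t \<in> {0..1}" "0 < t" using elim by auto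
    have "\<bar>x t j - x 0 j - g j 1 t\<bar> \<le> t powr 1" using elim by simp
    also have "t powr 1 \<le> t powr \<delta>" using t \<delta> by (intro powr_mono') auto
    finally have 1: "\<bar>x t j - x 0 j - g j 1 t\<bar> \<le> t powr \<delta>" .
    have "\<bar>g j 1 t\<bar> \<le> D j * t powr \<Delta> j" using D(3)[OF j _ t(1)] by simp
    also have "\<dots> \<le> (\<Sum>j<n. D j) * t powr \<delta>"
      using j t \<delta> D(1,2) by (intro mult_mono member_le_sum powr_mono' sum_nonneg) auto
    finally have "\<bar>g j 1 t\<bar> \<le> (\<Sum>j<n. D j) * t powr \<delta>" .
    with 1 show ?case by (simp add: C_def distrib_right)
  qed
  have xR: "\<forall>\<^sub>F t in at_right 0. x t \<in> Rn n"
    using \<epsilon> UR by (intro eventually_at_rightI[of 0 \<epsilon>]) auto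
  obtain N :: nat where N: "real N * \<delta> > 1"
    using reals_Archimedean3[OF \<delta>(1)] by blast
  obtain G K h where G: "powsum G" "K \<ge> 0" "h \<in> smallo_id"
    "\<forall>\<^sub>F t in at_right 0. \<forall>s\<in>{0..1}. \<bar>f (\<lambda>j. x 0 j + s * (x t j - x 0 j)) - f (x 0) - G s t\<bar>
      \<le> K * t powr (real N * \<delta>) + \<bar>h t\<bar>"
    using Taylor_along_powsum[OF U r xR g lo \<delta>(1) C bound f[of N]] by blast
  have "(\<lambda>t. f (x t) - f (x 0) - G 1 t) \<in> O[at_right 0](\<lambda>t. K * t powr (real N * \<delta>) + \<bar>h t\<bar>)"
  proof (intro landau_o.bigI[of 1])
    show "\<forall>\<^sub>F t in at_right 0. norm (f (x t) - f (x 0) - G 1 t) \<le> 1 * norm (K * t powr (real N * \<delta>) + \<bar>h t\<bar>)"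
      using G(4)
    proof eventually_elim
      case (elim t)
      from bspec[OF this, of 1] G(2) show ?case by simp
    qed
  qed simp
  moreover have "(\<lambda>t. K * t powr (real N * \<delta>) + \<bar>h t\<bar>) \<in> smallo_id"
    using powr_in_smallo_id[OF N] G(3) by (intro sum_in_smallo smallo_id_cmult) simp_all
  ultimately have "(\<lambda>t. f (x t) - f (x 0) - G 1 t) \<in> smallo_id"
    by (rule landau_o.big_small_trans)
  with G(1) show ?thesis unfolding expandable_def by blast
qed

text \<open>The local Lipschitz bound for \<open>f\<close>; it makes \<open>\<^sup>\<bullet>f\<close> well defined on classes.\<close>

lemma smooth_smallo_diff:
  assumes U: "open_Rn n U" and f: "Ck 1 n U f"
    and x: "lop n U x" and y: "lop n U y" and xy: "x 0 = y 0"
    and lo: "\<And>j. j < n \<Longrightarrow> (\<lambda>t. x t j - y t j) \<in> smallo_id"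
  shows "(\<lambda>t. f (x t) - f (y t)) \<in> smallo_id"
proof -
  note UR = openin_le_Rn[OF U]
  obtain g where g: "partials n U f g" "\<And>i. i < n \<Longrightarrow> continuous_on U (g i)"
    using f by (auto simp: Ck_Suc[OF UR] Ck_0[OF UR])
  have r: "x 0 \<in> U" using x by (auto simp: little_oh_poly_alt)
  obtain d where d: "d > 0" "cube n (x 0) d \<subseteq> U"
    "\<And>y z. y \<in> cube n (x 0) d \<Longrightarrow> z \<in> cube n (x 0) d \<Longrightarrow>
        \<bar>f y - f z - (\<Sum>i<n. g i (x 0) * (y i - z i))\<bar> \<le> 1 * (\<Sum>i<n. \<bar>y i - z i\<bar>)"
  proof (rule strictly_differentiable[OF U g(1) _ r zero_less_one])
    show "\<And>i. i < n \<Longrightarrow> continuous_on U (g i)" by (rule g(2))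
  qed (rule that)
  have near: "\<forall>\<^sub>F t in at_right 0. w t \<in> cube n (x 0) d"
    if w: "lop n U w" "w 0 = x 0" for w
  proof -
    have "w 0 \<in> cube n (x 0) d" using w(2) r openin_le_Rn[OF U] d(1) by (auto intro: center_in_cube)
    then have "lop n (cube n (x 0) d) w"
      using w(1) little_oh_poly_open_iff[OF U] little_oh_poly_open_iff[OF openin_cube] by blast
    then obtain \<epsilon> where "\<epsilon> > 0" "\<And>t. t \<in> {0..<\<epsilon>} \<Longrightarrow> w t \<in> cube n (x 0) d"
      unfolding little_oh_poly_alt by blast
    then show ?thesis by (intro eventually_at_rightI[of 0 \<epsilon>]) auto
  qed
  have "\<forall>\<^sub>F t in at_right 0. \<bar>f (x t) - f (y t)\<bar> \<le> (\<Sum>i<n. (\<bar>g i (x 0)\<bar> + 1) * \<bar>x t i - y t i\<bar>)"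
    using near[OF x refl] near[OF y xy[symmetric]]
  proof eventually_elim
    case (elim t)
    have "\<bar>\<Sum>i<n. g i (x 0) * (x t i - y t i)\<bar> \<le> (\<Sum>i<n. \<bar>g i (x 0)\<bar> * \<bar>x t i - y t i\<bar>)"
      by (rule order_trans[OF sum_abs]) (simp add: abs_mult)
    with d(3)[OF elim] show ?case by (simp add: distrib_right sum.distrib)
  qed
  then have "(\<lambda>t. f (x t) - f (y t)) \<in> O[at_right 0](\<lambda>t. \<Sum>i<n. (\<bar>g i (x 0)\<bar> + 1) * \<bar>x t i - y t i\<bar>)"
    by (intro landau_o.bigI[of 1]) (auto elim!: eventually_mono)
  moreover have "(\<lambda>t. \<Sum>i<n. (\<bar>g i (x 0)\<bar> + 1) * \<bar>x t i - y t i\<bar>) \<in> smallo_id"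
    using lo by (intro big_sum_in_smallo smallo_id_cmult) simp_all
  ultimately show ?thesis by (rule landau_o.big_small_trans)
qed

section \<open>Smooth maps of open sets\<close>

text \<open>With \<open>snd_part\<close>, the inverse of the concatenation \<open>cat\<close>.\<close>

definition fst_part :: "nat \<Rightarrow> pt \<Rightarrow> pt" where
  "fst_part k z = (\<lambda>i. if i < k then z i else 0)"

definition snd_part :: "nat \<Rightarrow> pt \<Rightarrow> pt" where
  "snd_part k z = (\<lambda>i. z (i + k))"

lemma cat_parts [simp]: "cat k (fst_part k z) (snd_part k z) = z"
  by (auto simp: cat_def fst_part_def snd_part_def)

lemma fst_part_cat: "p \<in> Rn k \<Longrightarrow> fst_part k (cat k p x) = p"
  by (auto simp: cat_def fst_part_def Rn_iff)

lemma snd_part_cat [simp]: "snd_part k (cat k p x) = x"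
  by (auto simp: cat_def snd_part_def)

lemma cat_assoc: "cat (l + k) (cat l q p) x = cat l q (cat k p x)"
  by (auto simp: cat_def fun_eq_iff)

lemma cat_in_Rn: "x \<in> Rn n \<Longrightarrow> cat k p x \<in> Rn (k + n)"
  by (auto simp: cat_def Rn_iff)

lemma cat_in_pt_prod_iff:
  assumes "P \<subseteq> Rn k" and "p \<in> Rn k"
  shows "cat k p x \<in> pt_prod k P U \<longleftrightarrow> p \<in> P \<and> x \<in> U"
proof
  assume "cat k p x \<in> pt_prod k P U"
  then obtain p' x' where *: "p' \<in> P" "x' \<in> U" "cat k p x = cat k p' x'"
    by (auto simp: pt_prod_def)
  have p': "p' \<in> Rn k" using assms *(1) by blast
  have "p = p'" using arg_cong[OF *(3), of "fst_part k"] fst_part_cat[OF assms(2)] fst_part_cat[OF p'] by simp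
  moreover have "x = x'" using arg_cong[OF *(3), of "snd_part k"] by simp
  ultimately show "p \<in> P \<and> x \<in> U" using * by simp
qed (auto simp: pt_prod_def)

lemma cat_in_pt_prod: "p \<in> P \<Longrightarrow> x \<in> U \<Longrightarrow> cat k p x \<in> pt_prod k P U"
  by (auto simp: pt_prod_def)

lemma pt_prod_assoc: "pt_prod (l + k) (pt_prod l Q P) U = pt_prod l Q (pt_prod k P U)"
  by (auto simp: pt_prod_def cat_assoc image_iff) (metis cat_assoc)+

lemma cube_subset_pt_prod:
  assumes "p \<in> Rn k" "cube k p d \<subseteq> P" "cube n x d \<subseteq> U"
  shows "cube (k + n) (cat k p x) d \<subseteq> pt_prod k P U"
proof
  fix z assume z: "z \<in> cube (k + n) (cat k p x) d"
  have 1: "\<bar>z i - cat k p x i\<bar> < d" if "i < k + n" for i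
    using z that by (simp add: cube_def)
  have "fst_part k z \<in> cube k p d"
    unfolding cube_def mem_Collect_eq
  proof (intro conjI allI impI)
    show "\<bar>fst_part k z j - p j\<bar> < d" if "j < k" for j
      using 1[of j] that by (simp add: fst_part_def cat_def)
  qed (simp add: Rn_iff fst_part_def)
  moreover have "snd_part k z \<in> cube n x d"
    unfolding cube_def mem_Collect_eq
  proof (intro conjI allI impI)
    show "\<bar>snd_part k z j - x j\<bar> < d" if "j < n" for j
      using 1[of "j + k"] that by (simp add: snd_part_def cat_def)
  qed (use z in \<open>simp add: Rn_iff snd_part_def cube_def\<close>)
  ultimately have "cat k (fst_part k z) (snd_part k z) \<in> pt_prod k P U"
    using assms by (intro cat_in_pt_prod) auto
  then show "z \<in> pt_prod k P U" by simp
qed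

lemma pt_prod_cube_subset: "x \<in> Rn n \<Longrightarrow> pt_prod k (cube k p d) (cube n x d) \<subseteq> cube (k + n) (cat k p x) d"
  by (auto simp: pt_prod_def cube_def cat_def Rn_iff)

lemma openin_pt_prod:
  assumes P: "open_Rn k P" and U: "open_Rn n U"
  shows "open_Rn (k + n) (pt_prod k P U)"
proof (rule openin_Euclidean_cubeI)
  fix z assume "z \<in> pt_prod k P U"
  then obtain p x where z: "p \<in> P" "x \<in> U" "z = cat k p x" by (auto simp: pt_prod_def)
  obtain d where d: "d > 0" "cube k p d \<subseteq> P" using openin_contains_cube[OF P z(1)] .
  obtain e where e: "e > 0" "cube n x e \<subseteq> U" using openin_contains_cube[OF U z(2)] .
  have "cube k p (min d e) \<subseteq> P" "cube n x (min d e) \<subseteq> U"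
    using d e cube_mono[of "min d e"] by (meson min.cobounded1 min.cobounded2 order_trans)+
  then have "cube (k + n) z (min d e) \<subseteq> pt_prod k P U"
    unfolding z(3) using z(1) openin_le_Rn[OF P] by (intro cube_subset_pt_prod) auto
  moreover have "z \<in> Rn (k + n)" using z openin_le_Rn[OF U] by (auto intro: cat_in_Rn)
  moreover have "min d e > 0" using d e by simp
  ultimately show "z \<in> Rn (k + n) \<and> (\<exists>d>0. cube (k + n) z d \<subseteq> pt_prod k P U)"
    by blast
qed

text \<open>The parameter representation of a quasi-standard smooth map needs a domain that is a product, so
  neighbourhoods obtained from continuity have to be shrunk to products.\<close>

lemma openin_pt_prod_box:
  assumes W: "open_Rn (k + n) W" and px: "cat k p x \<in> W" "p \<in> Rn k" "x \<in> Rn n"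
  obtains P U where "open_Rn k P" "open_Rn n U"
    "p \<in> P" "x \<in> U" "pt_prod k P U \<subseteq> W"
proof -
  obtain d where d: "d > 0" "cube (k + n) (cat k p x) d \<subseteq> W"
    using openin_contains_cube[OF W px(1)] .
  show ?thesis
    using d px pt_prod_cube_subset[OF px(3), of k p d]
    by (intro that[of "cube k p d" "cube n x d"]) (auto intro: openin_cube center_in_cube)
qed

lemma smooth_CkD: "smooth n U m V f \<Longrightarrow> j < m \<Longrightarrow> Ck k n U (\<lambda>x. f x j)"
  by (simp add: smooth_def)

lemma smooth_in: "smooth n U m V f \<Longrightarrow> x \<in> U \<Longrightarrow> f x \<in> V"
  by (auto simp: smooth_def)

lemma smooth_compose:
  assumes U: "open_Rn n U" and V: "open_Rn m V"
    and f: "smooth n U m V f" and g: "smooth m V l W g"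
  shows "smooth n U l W (\<lambda>x. g (f x))"
  unfolding smooth_def
proof (intro conjI allI impI)
  show "(\<lambda>x. g (f x)) \<in> U \<rightarrow> W" using f g by (auto simp: smooth_def)
  fix j k assume "j < l"
  with f g show "Ck k n U (\<lambda>x. g (f x) j)"
    using Ck_compose[OF U V, of f k "\<lambda>y. g y j"] by (simp add: smooth_def)
qed

lemma smooth_subset:
  "U \<subseteq> Rn n \<Longrightarrow> smooth n U m V f \<Longrightarrow> U' \<subseteq> U \<Longrightarrow> f ` U' \<subseteq> V' \<Longrightarrow> smooth n U' m V' f"
  unfolding smooth_def using Ck_subset by blast

lemma smooth_cong:
  assumes U: "open_Rn n U" and f: "smooth n U m V f"
    and eq: "\<And>x. x \<in> U \<Longrightarrow> f x = f' x"
  shows "smooth n U m V f'"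
  unfolding smooth_def
proof (intro conjI allI impI)
  show "f' \<in> U \<rightarrow> V" using smooth_in[OF f] eq by force
  fix j k assume "j < m"
  then show "Ck k n U (\<lambda>x. f' x j)"
    using Ck_cong[OF U _ smooth_CkD[OF f], of j "\<lambda>x. f' x j"] eq by simp
qed

lemma smooth_const: "U \<subseteq> Rn n \<Longrightarrow> c \<in> V \<Longrightarrow> smooth n U m V (\<lambda>_. c)"
  by (simp add: smooth_def Ck_const)

lemma smooth_id: "U \<subseteq> Rn n \<Longrightarrow> U \<subseteq> V \<Longrightarrow> smooth n U n V (\<lambda>x. x)"
  by (auto simp: smooth_def Ck_coord)

lemma smooth_cat:
  "smooth n U k P f \<Longrightarrow> smooth n U m V g \<Longrightarrow>
    smooth n U (k + m) (pt_prod k P V) (\<lambda>x. cat k (f x) (g x))"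
  unfolding smooth_def
proof (intro conjI allI impI)
  assume *: "f \<in> U \<rightarrow> P \<and> (\<forall>j<k. \<forall>i. Ck i n U (\<lambda>x. f x j))"
    "g \<in> U \<rightarrow> V \<and> (\<forall>j<m. \<forall>i. Ck i n U (\<lambda>x. g x j))"
  then show "(\<lambda>x. cat k (f x) (g x)) \<in> U \<rightarrow> pt_prod k P V" by (auto intro!: cat_in_pt_prod)
  fix j i assume "j < k + m"
  with * show "Ck i n U (\<lambda>x. cat k (f x) (g x) j)" by (cases "j < k") (simp_all add: cat_def)
qed

lemma smooth_fst_part:
  assumes "U \<subseteq> Rn n" shows "smooth (k + n) (pt_prod k (Rn k) U) k (Rn k) (fst_part k)"
proof -
  have "pt_prod k (Rn k) U \<subseteq> Rn (k + n)"
    using assms by (auto simp: pt_prod_def intro!: cat_in_Rn)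
  then show ?thesis by (auto simp: smooth_def fst_part_def Rn_iff intro: Ck_coord)
qed

lemma smooth_snd_part:
  assumes "U \<subseteq> Rn n" shows "smooth (k + n) (pt_prod k P U) n U (snd_part k)"
proof -
  have "pt_prod k P U \<subseteq> Rn (k + n)"
    using assms by (auto simp: pt_prod_def intro!: cat_in_Rn)
  then show ?thesis
    by (auto simp: smooth_def pt_prod_def) (auto simp: snd_part_def intro: Ck_coord)
qed

lemma openin_smooth_preimage:
  assumes U: "open_Rn n U" and f: "smooth n U m (Rn m) f"
    and V: "open_Rn m V"
  shows "open_Rn n {x \<in> U. f x \<in> V}"
proof -
  obtain W where W: "open W" "V = Rn m \<inter> W" using V unfolding openin_Euclidean_iff by blast
  have "continuous_on U f"
    using smooth_in[OF f] Ck_continuous[OF openin_le_Rn[OF U] smooth_CkD[OF f]]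
    by (intro continuous_on_into_Rn[of f U m]) auto
  moreover have "{x \<in> U. f x \<in> V} = U \<inter> f -` W" using W(2) smooth_in[OF f] by blast
  ultimately show ?thesis using openin_continuous_preimage[OF U _ W(1)] by simp
qed

section \<open>Points of Fermat extensions\<close>

text \<open>The class of \<open>x\<close> in \<open>\<^sup>\<bullet>\<real>\<^sup>n\<close>. For open \<open>U\<close> it is also the class in \<open>\<^sup>\<bullet>U\<close>, which is how the
  identification \<open>\<^sup>\<bullet>U \<subseteq> \<^sup>\<bullet>\<real>\<^sup>n\<close> enters all computations with representatives.\<close>

definition germ :: "nat \<Rightarrow> (real \<Rightarrow> pt) \<Rightarrow> fpt" where
  "germ n x = fermat_rel n (Rn n) `` {x}"

lemma openin_Rn: "open_Rn n (Rn n)"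
  by (rule openin_topspace)

lemma lop_in: "lop n U x \<Longrightarrow> x 0 \<in> U"
  by (simp add: little_oh_poly_alt)

lemma lop_Rn: "open_Rn n U \<Longrightarrow> lop n U x \<Longrightarrow> lop n (Rn n) x"
  using little_oh_poly_open_iff by blast

lemma lopI: "open_Rn n U \<Longrightarrow> lop n (Rn n) x \<Longrightarrow> x 0 \<in> U \<Longrightarrow> lop n U x"
  using little_oh_poly_open_iff by blast

lemma fermat_rel_iff:
  "(x, y) \<in> fermat_rel n U \<longleftrightarrow> lop n U x \<and> lop n U y \<and> x 0 = y 0 \<and>
    (\<forall>j<n. (\<lambda>t. x t j - y t j) \<in> smallo_id)"
  by (simp add: fermat_rel_def little_o_iff)

lemma equiv_fermat_rel: "equiv {x. lop n U x} (fermat_rel n U)"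
proof (rule equivI)
  show "fermat_rel n U \<subseteq> {x. lop n U x} \<times> {x. lop n U x}" by (auto simp: fermat_rel_iff)
  show "refl_on {x. lop n U x} (fermat_rel n U)" by (auto simp: refl_on_def fermat_rel_iff)
  show "sym (fermat_rel n U)"
  proof (rule symI)
    fix x y assume xy: "(x, y) \<in> fermat_rel n U"
    have "(\<lambda>t. y t j - x t j) \<in> smallo_id" if "j < n" for j
    proof -
      have "(\<lambda>t. - (x t j - y t j)) \<in> smallo_id"
        using xy that by (subst landau_o.small.uminus_in_iff) (simp add: fermat_rel_iff)
      then show ?thesis by simp
    qed
    with xy show "(y, x) \<in> fermat_rel n U" by (simp add: fermat_rel_iff)
  qed
  show "trans (fermat_rel n U)"
  proof (rule transI)
    fix x y z assume xyz: "(x, y) \<in> fermat_rel n U" "(y, z) \<in> fermat_rel n U"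
    have "(\<lambda>t. x t j - z t j) \<in> smallo_id" if "j < n" for j
    proof -
      have "(\<lambda>t. (x t j - y t j) + (y t j - z t j)) \<in> smallo_id"
        using xyz that by (intro sum_in_smallo(1)) (simp_all add: fermat_rel_iff)
      then show ?thesis by simp
    qed
    with xyz show "(x, z) \<in> fermat_rel n U" by (simp add: fermat_rel_iff)
  qed
qed

lemma germ_eq_iff:
  "lop n (Rn n) x \<Longrightarrow> lop n (Rn n) y \<Longrightarrow> germ n x = germ n y \<longleftrightarrow> (x, y) \<in> fermat_rel n (Rn n)"
  unfolding germ_def using eq_equiv_class_iff[OF equiv_fermat_rel, of x n "Rn n" y] by simp

lemma germ_eqI:
  assumes "lop n (Rn n) x" "lop n (Rn n) y" "x 0 = y 0" "\<forall>\<^sub>F t in at_right 0. x t = y t"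
  shows "germ n x = germ n y"
proof -
  have "(\<lambda>t. x t j - y t j) \<in> smallo_id" for j
  proof -
    have "\<forall>\<^sub>F t in at_right 0. x t j - y t j = 0" using assms(4) by eventually_elim simp
    then show ?thesis using landau_o.small.in_cong[of "\<lambda>t. x t j - y t j" "\<lambda>_. 0"] by simp
  qed
  with assms show ?thesis by (simp add: germ_eq_iff fermat_rel_iff)
qed

text \<open>A curve equivalent to one that starts in the open set \<open>U\<close> starts in \<open>U\<close> as well and stays there
  for small \<open>t\<close>.\<close>

lemma fermat_rel_class:
  assumes U: "open_Rn n U" and x: "lop n U x"
  shows "fermat_rel n U `` {x} = germ n x"
  using x unfolding germ_def Image_singleton
  by (auto simp: fermat_rel_iff little_oh_poly_open_iff[OF U])

lemma fermat_open: "open_Rn n U \<Longrightarrow> fermat n U = germ n ` {x. lop n U x}"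
  unfolding fermat_def quotient_def using fermat_rel_class by auto

lemma fermatE:
  assumes "c \<in> fermat n U" "open_Rn n U"
  obtains x where "lop n U x" "c = germ n x"
  using assms by (auto simp: fermat_open)

lemma germ_in_fermat: "open_Rn n U \<Longrightarrow> lop n U x \<Longrightarrow> germ n x \<in> fermat n U"
  by (auto simp: fermat_open)

lemma std_germ: "lop n (Rn n) x \<Longrightarrow> std (germ n x) = x 0"
  unfolding germ_def by (rule std_fermat_rel)

lemma fermat_subset_Rn: "open_Rn n U \<Longrightarrow> fermat n U \<subseteq> fermat n (Rn n)"
  using fermat_eq_std by blast

lemma std_in: "open_Rn n U \<Longrightarrow> c \<in> fermat n U \<Longrightarrow> std c \<in> U"
  using fermat_eq_std by blast

lemma lop_const: "u \<in> U \<Longrightarrow> lop n U (\<lambda>_. u)"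
  unfolding little_oh_poly_alt
  by (intro conjI exI[of _ 1] exI[of _ "0::nat"]) (auto simp: little_o_iff intro!: exI[of _ "0::nat"])

lemma const_pt_germ: "open_Rn n U \<Longrightarrow> u \<in> U \<Longrightarrow> const_pt n U u = germ n (\<lambda>_. u)"
  unfolding const_pt_def by (intro fermat_rel_class lop_const)

lemma lop_smooth:
  assumes U: "open_Rn n U" and f: "smooth n U m V f" and V: "V \<subseteq> Rn m"
    and x: "lop n U x"
  shows "lop m V (\<lambda>t. f (x t))"
proof -
  obtain \<epsilon> where "\<epsilon> > 0" "\<And>t. t \<in> {0..<\<epsilon>} \<Longrightarrow> x t \<in> U" using x unfolding little_oh_poly_alt by blast
  then have "\<exists>\<epsilon>>0. \<forall>t\<in>{0..<\<epsilon>}. f (x t) \<in> V" using smooth_in[OF f] by blast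
  with V show ?thesis
    using smooth_expandable[OF U x smooth_CkD[OF f]] by (simp add: lop_iff_expandable)
qed

lemma fermat_map_germ:
  assumes U: "open_Rn n U" and V: "open_Rn m V"
    and f: "smooth n U m V f" and x: "lop n U x"
  shows "fermat_map n U m V f (germ n x) = germ m (\<lambda>t. f (x t))"
proof -
  note VR = openin_le_Rn[OF V]
  have "(\<lambda>x. fermat_rel m V `` {f \<circ> x}) respects fermat_rel n U"
  proof (rule congruentI)
    fix y z assume yz: "(y, z) \<in> fermat_rel n U"
    then have l: "lop n U y" "lop n U z" "y 0 = z 0"
      "\<And>j. j < n \<Longrightarrow> (\<lambda>t. y t j - z t j) \<in> smallo_id"
      by (auto simp: fermat_rel_iff)
    have "(\<lambda>t. f (y t) j - f (z t) j) \<in> smallo_id" if "j < m" for j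
      by (rule smooth_smallo_diff[OF U smooth_CkD[OF f that] l])
    then have "(f \<circ> y, f \<circ> z) \<in> fermat_rel m V"
      using lop_smooth[OF U f VR] l(1-3) by (simp add: fermat_rel_iff o_def)
    then show "fermat_rel m V `` {f \<circ> y} = fermat_rel m V `` {f \<circ> z}"
      using equiv_class_eq[OF equiv_fermat_rel] by blast
  qed
  from UN_equiv_class[OF equiv_fermat_rel this, of x] x
  have "(\<Union>y\<in>fermat_rel n U `` {x}. fermat_rel m V `` {f \<circ> y}) = fermat_rel m V `` {f \<circ> x}" by simp
  then show ?thesis
    using fermat_rel_class[OF U x] fermat_rel_class[OF V lop_smooth[OF U f VR x]] germ_in_fermat[OF U x]
    by (simp add: fermat_map_def o_def)
qed

lemma lop_cat:
  assumes P: "open_Rn k P" and U: "open_Rn n U"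
    and p: "lop k P p" and x: "lop n U x"
  shows "lop (k + n) (pt_prod k P U) (\<lambda>t. cat k (p t) (x t))"
proof -
  note iff = lop_iff_expandable
  note PU = openin_le_Rn[OF P] openin_le_Rn[OF U]
  obtain \<epsilon> where \<epsilon>: "\<epsilon> > 0" "\<And>t. t \<in> {0..<\<epsilon>} \<Longrightarrow> p t \<in> P" using p unfolding little_oh_poly_alt by blast
  obtain \<epsilon>' where \<epsilon>': "\<epsilon>' > 0" "\<And>t. t \<in> {0..<\<epsilon>'} \<Longrightarrow> x t \<in> U" using x unfolding little_oh_poly_alt by blast
  have "\<exists>\<epsilon>>0. \<forall>t\<in>{0..<\<epsilon>}. cat k (p t) (x t) \<in> pt_prod k P U"
    using \<epsilon> \<epsilon>' by (intro exI[of _ "min \<epsilon> \<epsilon>'"]) (auto intro!: cat_in_pt_prod)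
  moreover have "expandable (\<lambda>t. cat k (p t) (x t) j)" if "j < k + n" for j
    using p x that PU by (cases "j < k") (auto simp: iff cat_def)
  ultimately show ?thesis
    using openin_le_Rn[OF openin_pt_prod[OF P U]] by (simp add: iff)
qed

lemma fermat_pair_germ:
  assumes P: "open_Rn k P" and U: "open_Rn n U"
    and p: "lop k P p" and x: "lop n U x"
  shows "fermat_pair k P n U (germ k p) (germ n x) = germ (k + n) (\<lambda>t. cat k (p t) (x t))"
proof -
  let ?R = "fermat_rel (k + n) (pt_prod k P U)"
  have "congruent2 (fermat_rel k P) (fermat_rel n U) (\<lambda>p x. ?R `` {\<lambda>t. cat k (p t) (x t)})"
  proof (rule congruent2I')
    fix p p' x x' assume *: "(p, p') \<in> fermat_rel k P" "(x, x') \<in> fermat_rel n U"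
    have "(\<lambda>t. cat k (p t) (x t) j - cat k (p' t) (x' t) j) \<in> smallo_id" if "j < k + n" for j
      using * that by (cases "j < k") (auto simp: cat_def fermat_rel_iff)
    then have "(\<lambda>t. cat k (p t) (x t), \<lambda>t. cat k (p' t) (x' t)) \<in> ?R"
      using * by (auto simp: fermat_rel_iff intro!: lop_cat P U)
    then show "?R `` {\<lambda>t. cat k (p t) (x t)} = ?R `` {\<lambda>t. cat k (p' t) (x' t)}"
      using equiv_class_eq[OF equiv_fermat_rel] by blast
  qed
  from UN_equiv_class2[OF equiv_fermat_rel equiv_fermat_rel this, of p x] p x
  show ?thesis
    unfolding fermat_pair_def
    using fermat_rel_class[OF P p] fermat_rel_class[OF U x]
      fermat_rel_class[OF openin_pt_prod[OF P U] lop_cat[OF P U p x]] by simp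
qed

section \<open>Quasi-standard smooth maps\<close>

lemma fermat_map_pair_germ:
  assumes P: "open_Rn k P" and U: "open_Rn n U"
    and \<alpha>: "smooth (k + n) (pt_prod k P U) m (Rn m) \<alpha>" and p: "lop k P p" and x: "lop n U x"
  shows "fermat_map (k + n) (pt_prod k P U) m (Rn m) \<alpha> (fermat_pair k P n U (germ k p) (germ n x)) =
    germ m (\<lambda>t. \<alpha> (cat k (p t) (x t)))"
  by (simp add: fermat_pair_germ[OF P U p x]
      fermat_map_germ[OF openin_pt_prod[OF P U] openin_Rn \<alpha> lop_cat[OF P U p x]])

text \<open>Quasi-standard smoothness near a point in terms of representatives: \<open>f\<close> is \<open>[x] \<mapsto> [\<alpha> (p, x)]\<close>
  on \<open>A \<inter> \<^sup>\<bullet>U\<close>, where the parameter is given by a curve \<open>p\<close> instead of its class.\<close>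

definition local_model ::
  "nat \<Rightarrow> fpt set \<Rightarrow> nat \<Rightarrow> (fpt \<Rightarrow> fpt) \<Rightarrow> pt set \<Rightarrow> nat \<Rightarrow> pt set \<Rightarrow> (pt \<Rightarrow> pt) \<Rightarrow> (real \<Rightarrow> pt) \<Rightarrow> bool" where
  "local_model n A m f U k P \<alpha> p \<longleftrightarrow> open_Rn n U \<and>
     open_Rn k P \<and> lop k P p \<and> smooth (k + n) (pt_prod k P U) m (Rn m) \<alpha> \<and>
     (\<forall>x. lop n U x \<longrightarrow> germ n x \<in> A \<longrightarrow> f (germ n x) = germ m (\<lambda>t. \<alpha> (cat k (p t) (x t))))"

lemma local_modelD:
  assumes "local_model n A m f U k P \<alpha> p"
  shows "open_Rn n U" "open_Rn k P" "lop k P p"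
    "smooth (k + n) (pt_prod k P U) m (Rn m) \<alpha>"
    "\<And>x. lop n U x \<Longrightarrow> germ n x \<in> A \<Longrightarrow> f (germ n x) = germ m (\<lambda>t. \<alpha> (cat k (p t) (x t)))"
  using assms by (simp_all add: local_model_def)

lemma qss_iff_local_model:
  "qss n A m B f \<longleftrightarrow>
    f \<in> A \<rightarrow> B \<and> (\<forall>a\<in>A. \<exists>U k P \<alpha> p. std a \<in> U \<and> local_model n A m f U k P \<alpha> p)"
proof -
  have "(\<exists>p\<in>fermat k P. open_Rn n U \<and> std a \<in> U \<and> open_Rn k P \<and>
        smooth (k + n) (pt_prod k P U) m (Rn m) \<alpha> \<and>
        (\<forall>x\<in>A \<inter> fermat n U.
           f x = fermat_map (k + n) (pt_prod k P U) m (Rn m) \<alpha> (fermat_pair k P n U p x))) \<longleftrightarrow>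
      (\<exists>p. std a \<in> U \<and> local_model n A m f U k P \<alpha> p)" for a U k P \<alpha>
  proof (cases "open_Rn n U \<and> open_Rn k P \<and>
      smooth (k + n) (pt_prod k P U) m (Rn m) \<alpha>")
    case True
    then have U: "open_Rn n U" and P: "open_Rn k P"
      and \<alpha>: "smooth (k + n) (pt_prod k P U) m (Rn m) \<alpha>" by auto
    have "(\<forall>x\<in>A \<inter> fermat n U.
           f x = fermat_map (k + n) (pt_prod k P U) m (Rn m) \<alpha> (fermat_pair k P n U (germ k p) x)) \<longleftrightarrow>
        (\<forall>x. lop n U x \<longrightarrow> germ n x \<in> A \<longrightarrow> f (germ n x) = germ m (\<lambda>t. \<alpha> (cat k (p t) (x t))))"
      if "lop k P p" for p
      using fermat_map_pair_germ[OF P U \<alpha> that] unfolding fermat_open[OF U] by auto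
    with True show ?thesis unfolding local_model_def fermat_open[OF P] by auto
  qed (auto simp: local_model_def)
  then show ?thesis unfolding quasi_standard_smooth_def by simp
qed

lemma qssI:
  assumes "f \<in> A \<rightarrow> B"
    and "\<And>a. a \<in> A \<Longrightarrow> \<exists>U k P \<alpha> p. std a \<in> U \<and> local_model n A m f U k P \<alpha> p"
  shows "qss n A m B f"
  using assms by (simp add: qss_iff_local_model)

lemma qssE:
  assumes "qss n A m B f" and "a \<in> A"
  obtains U k P \<alpha> p where "std a \<in> U" "local_model n A m f U k P \<alpha> p"
  using assms unfolding qss_iff_local_model by blast

lemma qss_in: "qss n A m B f \<Longrightarrow> a \<in> A \<Longrightarrow> f a \<in> B"
  by (auto simp: quasi_standard_smooth_def)

lemma lop_pair_smooth:
  assumes "open_Rn k P" "open_Rn n U"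
    and "smooth (k + n) (pt_prod k P U) m V \<alpha>" and "V \<subseteq> Rn m" and "lop k P p" "lop n U x"
  shows "lop m V (\<lambda>t. \<alpha> (cat k (p t) (x t)))"
  using lop_smooth[OF openin_pt_prod[OF assms(1,2)] assms(3,4) lop_cat[OF assms(1,2,5,6)]] .

text \<open>In a local model the standard part of \<open>f a\<close> is \<open>\<alpha> (\<^sup>\<circ>p, \<^sup>\<circ>a)\<close>, which sees only \<open>\<^sup>\<circ>a\<close>.\<close>

lemma qss_std_const:
  assumes f: "qss n A m B f" and A: "A \<subseteq> fermat n (Rn n)"
    and a: "a \<in> A" and c: "germ n (\<lambda>_. std a) \<in> A"
  shows "std (f (germ n (\<lambda>_. std a))) = std (f a)"
proof -
  obtain U k P \<alpha> p where aU: "std a \<in> U" and "local_model n A m f U k P \<alpha> p"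
    using qssE[OF f a] .
  note * = local_modelD[OF this(2)]
  obtain x where x: "lop n (Rn n) x" "a = germ n x" using fermatE[OF _ openin_Rn] a A by blast
  have xU: "lop n U x" using x aU by (intro lopI[OF *(1)]) (simp_all add: std_germ)
  have sa: "std a = x 0" using x by (simp add: std_germ)
  have cU: "lop n U (\<lambda>_. std a)" using aU by (rule lop_const)
  have "std (germ m (\<lambda>t. \<alpha> (cat k (p t) (y t)))) = \<alpha> (cat k (p 0) (y 0))" if "lop n U y" for y
    by (rule std_germ[OF lop_pair_smooth[OF *(2,1,4) order_refl *(3) that]])
  with *(5)[OF xU] *(5)[OF cU] a c xU cU sa x(2) show ?thesis by simp
qed

lemma qss_subset:
  assumes "qss n A m B f" "A' \<subseteq> A" "f ` A' \<subseteq> B'"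
    "\<And>x. x \<in> A' \<Longrightarrow> f x = f' x"
  shows "qss n A' m B' f'"
proof (rule qssI)
  show "f' \<in> A' \<rightarrow> B'" using assms by force
  fix a assume "a \<in> A'"
  then obtain U k P \<alpha> p where aU: "std a \<in> U" and "local_model n A m f U k P \<alpha> p"
    using qssE[OF assms(1)] assms(2) by blast
  then have "local_model n A' m f' U k P \<alpha> p"
    using assms(2,4) unfolding local_model_def by auto
  with aU show "\<exists>U k P \<alpha> p. std a \<in> U \<and> local_model n A' m f' U k P \<alpha> p" by blast
qed

text \<open>The constant value itself is the parameter.\<close>

lemma qss_const:
  assumes A: "A \<subseteq> fermat n (Rn n)" and b: "b \<in> B" "B \<subseteq> fermat m (Rn m)"
  shows "qss n A m B (\<lambda>_. b)"
proof (rule qssI)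
  obtain p where p: "lop m (Rn m) p" "b = germ m p" using fermatE[OF _ openin_Rn] b by blast
  fix a assume a: "a \<in> A"
  let ?\<alpha> = "fst_part m"
  have sm: "smooth (m + n) (pt_prod m (Rn m) (Rn n)) m (Rn m) ?\<alpha>"
    by (rule smooth_fst_part) simp
  have "b = germ m (\<lambda>t. ?\<alpha> (cat m (p t) (x t)))" if x: "lop n (Rn n) x" for x
    unfolding p(2)
  proof (rule germ_eqI[OF p(1)])
    show "lop m (Rn m) (\<lambda>t. ?\<alpha> (cat m (p t) (x t)))"
      by (rule lop_pair_smooth[OF openin_Rn openin_Rn sm order_refl p(1) x])
    show "p 0 = ?\<alpha> (cat m (p 0) (x 0))" using lop_in[OF p(1)] by (simp add: fst_part_cat)
    obtain \<epsilon> where "\<epsilon> > 0" "\<And>t. t \<in> {0..<\<epsilon>} \<Longrightarrow> p t \<in> Rn m"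
      using p(1) unfolding little_oh_poly_alt by blast
    then show "\<forall>\<^sub>F t in at_right 0. p t = ?\<alpha> (cat m (p t) (x t))"
      by (intro eventually_at_rightI[of 0 \<epsilon>]) (simp_all add: fst_part_cat)
  qed
  then have "local_model n A m (\<lambda>_. b) (Rn n) m (Rn m) ?\<alpha> p"
    unfolding local_model_def using sm p(1) openin_Rn by blast
  moreover have "std a \<in> Rn n" using std_in[OF openin_Rn] A a by blast
  ultimately show "\<exists>U k P \<alpha> p. std a \<in> U \<and> local_model n A m (\<lambda>_. b) U k P \<alpha> p" by blast
qed (use b in auto)

lemma fermat_map_in:
  assumes U: "open_Rn n U" and V: "open_Rn m V"
    and f: "smooth n U m V f"
  shows "fermat_map n U m V f \<in> fermat n U \<rightarrow>\<^sub>E fermat m V"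
proof (rule PiE_I)
  fix c assume "c \<in> fermat n U"
  then obtain x where x: "lop n U x" "c = germ n x" using fermatE[OF _ U] by blast
  then show "fermat_map n U m V f c \<in> fermat m V"
    using germ_in_fermat[OF V lop_smooth[OF U f openin_le_Rn[OF V] x(1)]]
    by (simp add: fermat_map_germ[OF U V f x(1)])
qed (simp add: fermat_map_def)

text \<open>A standard map needs no parameter, that is, a parameter in \<open>\<^sup>\<bullet>\<real>\<^sup>0\<close>.\<close>

lemma qss_fermat_map:
  assumes U: "open_Rn n U" and V: "open_Rn m V"
    and f: "smooth n U m V f"
  shows "qss n (fermat n U) m (fermat m V) (fermat_map n U m V f)"
proof (rule qssI)
  show "fermat_map n U m V f \<in> fermat n U \<rightarrow> fermat m V" using fermat_map_in[OF U V f] by auto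
  fix a assume a: "a \<in> fermat n U"
  let ?\<alpha> = "\<lambda>z. f (snd_part 0 z)" and ?P = "Rn 0"
  have fR: "smooth n U m (Rn m) f"
    using smooth_subset[OF openin_le_Rn[OF U] f order_refl] smooth_in[OF f] openin_le_Rn[OF V] by blast
  have sm: "smooth (0 + n) (pt_prod 0 ?P U) m (Rn m) ?\<alpha>"
    using smooth_compose[OF openin_pt_prod[OF openin_Rn U] U smooth_snd_part[OF openin_le_Rn[OF U]] fR] .
  have p: "lop 0 ?P (\<lambda>_ _. 0)" by (rule lop_const) (simp add: Rn_iff)
  have "local_model n (fermat n U) m (fermat_map n U m V f) U 0 ?P ?\<alpha> (\<lambda>_ _. 0)"
    unfolding local_model_def using U openin_Rn p sm fermat_map_germ[OF U V f] by simp
  with std_in[OF U a]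
  show "\<exists>U' k P \<alpha> p. std a \<in> U' \<and> local_model n (fermat n U) m (fermat_map n U m V f) U' k P \<alpha> p"
    by blast
qed

text \<open>If \<open>f x = \<^sup>\<bullet>\<alpha> (p, x)\<close> and \<open>g y = \<^sup>\<bullet>\<beta> (q, y)\<close> locally, then \<open>g (f x) = \<^sup>\<bullet>\<gamma> ((q, p), x)\<close> with
  \<open>\<gamma> ((q, p), x) = \<beta> (q, \<alpha> (p, x))\<close>. The domain of \<open>\<alpha>\<close> is first cut down to a product around the standard
  parts of \<open>p\<close> and \<open>a\<close> that \<open>\<alpha>\<close> maps into the domain of \<open>\<beta>\<close>.\<close>

lemma qss_compose:
  assumes A: "A \<subseteq> fermat n (Rn n)" and B: "B \<subseteq> fermat m (Rn m)"
    and f: "qss n A m B f" and g: "qss m B l C g"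
  shows "qss n A l C (\<lambda>x. g (f x))"
proof (rule qssI)
  show "(\<lambda>x. g (f x)) \<in> A \<rightarrow> C"
    using f g by (auto simp: quasi_standard_smooth_def)
  fix a assume a: "a \<in> A"
  have fa: "f a \<in> B" using f a by (auto simp: quasi_standard_smooth_def)
  obtain U k P \<alpha> p where aU: "std a \<in> U" and "local_model n A m f U k P \<alpha> p"
    using qssE[OF f a] .
  note F = local_modelD[OF this(2)]
  obtain V h Q \<beta> q where faV: "std (f a) \<in> V" and "local_model m B l g V h Q \<beta> q"
    using qssE[OF g fa] .
  note G = local_modelD[OF this(2)]
  obtain x0 where x0: "lop n (Rn n) x0" "a = germ n x0" using fermatE[OF _ openin_Rn] a A by blast
  have x0U: "lop n U x0" using x0 aU by (intro lopI[OF F(1)]) (simp_all add: std_germ)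
  note PU = openin_pt_prod[OF F(2,1)]
  have "std (f a) = \<alpha> (cat k (p 0) (x0 0))"
    using F(5)[OF x0U] a x0(2) std_germ[OF lop_pair_smooth[OF F(2,1,4) order_refl F(3) x0U]] by simp
  then have inW: "cat k (p 0) (x0 0) \<in> {z \<in> pt_prod k P U. \<alpha> z \<in> V}"
    using faV cat_in_pt_prod[OF lop_in[OF F(3)] lop_in[OF x0U]] by simp
  have p0: "p 0 \<in> Rn k" using lop_in[OF lop_Rn[OF F(2,3)]] .
  obtain P' U' where P': "open_Rn k P'" "open_Rn n U'"
    "p 0 \<in> P'" "x0 0 \<in> U'" "pt_prod k P' U' \<subseteq> {z \<in> pt_prod k P U. \<alpha> z \<in> V}"
    using openin_pt_prod_box[OF openin_smooth_preimage[OF PU F(4) G(1)] inW p0 lop_in[OF x0(1)]] .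
  have U'U: "U' \<subseteq> U"
  proof
    fix x assume "x \<in> U'"
    then have "cat k (p 0) x \<in> pt_prod k P U" using P' cat_in_pt_prod by blast
    with p0 show "x \<in> U" by (simp add: cat_in_pt_prod_iff[OF openin_le_Rn[OF F(2)]])
  qed
  have pP': "lop k P' p" by (rule lopI[OF P'(1) lop_Rn[OF F(2,3)] P'(3)])
  have \<alpha>': "smooth (k + n) (pt_prod k P' U') m V \<alpha>"
    using P'(5) by (intro smooth_subset[OF openin_le_Rn[OF PU] F(4)]) auto
  let ?P = "pt_prod h Q P'" and ?p = "\<lambda>t. cat h (q t) (p t)"
  \<comment> \<open>Here \<open>z\<close> is read as \<open>(q, (p, x))\<close>, which is the same point of \<open>\<real>\<^bsup>h + k + n\<^esup>\<close> as \<open>((q, p), x)\<close>.\<close>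
  let ?\<gamma> = "\<lambda>z. \<beta> (cat h (fst_part h z) (\<alpha> (snd_part h z)))"
  note PU' = openin_pt_prod[OF P'(1,2)]
  note PU'R = openin_le_Rn[OF PU']
  note opQ = openin_pt_prod[OF G(2) PU']
  have fstQ: "smooth (h + (k + n)) (pt_prod h Q (pt_prod k P' U')) h Q (fst_part h)"
  proof (rule smooth_subset[OF _ smooth_fst_part[OF PU'R]])
    show "pt_prod h (Rn h) (pt_prod k P' U') \<subseteq> Rn (h + (k + n))"
      using openin_le_Rn[OF openin_pt_prod[OF openin_Rn PU']] .
  qed (use openin_le_Rn[OF G(2)] in \<open>auto simp: pt_prod_def fst_part_cat subset_iff\<close>)
  have "smooth (h + (k + n)) (pt_prod h Q (pt_prod k P' U')) l (Rn l) ?\<gamma>"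
    by (rule smooth_compose[OF opQ openin_pt_prod[OF G(2,1)] _ G(4)])
      (intro smooth_cat fstQ smooth_compose[OF opQ PU' smooth_snd_part[OF PU'R] \<alpha>'])
  then have \<gamma>: "smooth ((h + k) + n) (pt_prod (h + k) ?P U') l (Rn l) ?\<gamma>"
    by (simp add: pt_prod_assoc add.assoc)
  have eq: "g (f (germ n x)) = germ l (\<lambda>t. ?\<gamma> (cat (h + k) (?p t) (x t)))"
    if x: "lop n U' x" "germ n x \<in> A" for x
  proof -
    have xU: "lop n U x" using x U'U by (intro lopI[OF F(1) lop_Rn[OF P'(2)]]) (auto dest: lop_in)
    have y: "lop m V (\<lambda>t. \<alpha> (cat k (p t) (x t)))"
      by (rule lop_pair_smooth[OF P'(1,2) \<alpha>' openin_le_Rn[OF G(1)] pP' x(1)])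
    have fx: "f (germ n x) = germ m (\<lambda>t. \<alpha> (cat k (p t) (x t)))" using F(5)[OF xU x(2)] .
    then have "germ m (\<lambda>t. \<alpha> (cat k (p t) (x t))) \<in> B"
      using qss_in[OF f x(2)] by simp
    from G(5)[OF y this] have "g (f (germ n x)) = germ l (\<lambda>t. \<beta> (cat h (q t) (\<alpha> (cat k (p t) (x t)))))"
      using fx by simp
    moreover have "cat h (fst_part h (cat h (q t) y)) w = cat h (q t) w" for t y w
      by (auto simp: cat_def fst_part_def)
    ultimately show ?thesis by (simp add: cat_assoc)
  qed
  have "local_model n A l (\<lambda>x. g (f x)) U' (h + k) ?P ?\<gamma> ?p"
    unfolding local_model_def
    using P'(2) openin_pt_prod[OF G(2) P'(1)] lop_cat[OF G(2) P'(1) G(3) pP'] \<gamma> eq by blast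
  moreover have "std a \<in> U'" using P'(4) x0 by (simp add: std_germ)
  ultimately show "\<exists>U k P \<alpha> p. std a \<in> U \<and> local_model n A l (\<lambda>x. g (f x)) U k P \<alpha> p" by blast
qed

text \<open>Fermat-open sets are given by conditions on standard parts, and near \<open>a\<close> the standard part of \<open>f x\<close> is
  the continuous function \<open>\<alpha> (\<^sup>\<circ>p, \<^sup>\<circ>x)\<close> of the standard part of \<open>x\<close>.\<close>

lemma qss_continuous:
  assumes A: "A \<subseteq> fermat n (Rn n)" and f: "qss n A m B f"
    and V: "open_Rn m V" and a: "a \<in> A" "std (f a) \<in> V"
  obtains U where "open_Rn n U" "std a \<in> U"
    "\<And>x. x \<in> A \<inter> fermat n U \<Longrightarrow> std (f x) \<in> V"
proof -
  obtain U k P \<alpha> p where aU: "std a \<in> U" and "local_model n A m f U k P \<alpha> p"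
    using qssE[OF f a(1)] .
  note F = local_modelD[OF this(2)]
  have std: "std (f (germ n x)) = \<alpha> (cat k (p 0) (x 0))" if "lop n U x" "germ n x \<in> A" for x
    using F(5)[OF that] std_germ[OF lop_pair_smooth[OF F(2,1,4) order_refl F(3) that(1)]] by simp
  let ?s = "\<lambda>u. \<alpha> (cat k (p 0) u)"
  have "smooth n U (k + n) (pt_prod k P U) (\<lambda>u. cat k (p 0) u)"
    using openin_le_Rn[OF F(1)] lop_in[OF F(3)] by (intro smooth_cat smooth_const smooth_id) auto
  then have s: "smooth n U m (Rn m) ?s"
    using smooth_compose[OF F(1) openin_pt_prod[OF F(2,1)] _ F(4)] by blast
  obtain x0 where x0: "lop n (Rn n) x0" "a = germ n x0" using fermatE[OF _ openin_Rn] a A by blast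
  have x0U: "lop n U x0" using x0 aU by (intro lopI[OF F(1)]) (simp_all add: std_germ)
  let ?W = "{u \<in> U. ?s u \<in> V}"
  show ?thesis
  proof (rule that[of ?W])
    show W: "open_Rn n ?W" by (rule openin_smooth_preimage[OF F(1) s V])
    show "std a \<in> ?W" using aU std[OF x0U] a x0 std_germ by simp
    fix x assume x: "x \<in> A \<inter> fermat n ?W"
    then obtain y where y: "lop n ?W y" "x = germ n y" using fermatE[OF _ W] by blast
    then have "lop n U y" using lopI[OF F(1) lop_Rn[OF W]] lop_in by blast
    with std x y lop_in[OF y(1)] show "std (f x) \<in> V" by simp
  qed
qed

text \<open>On standard points the standard part of \<open>f\<close> is \<open>u \<mapsto> \<alpha> (\<^sup>\<circ>p, u)\<close> for a local model of \<open>f\<close>.\<close>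

lemma qss_std_smooth:
  assumes A: "open_Rn n A" and f: "qss n (fermat n A) m (fermat m B) f"
    and B: "open_Rn m B" and u: "u \<in> A"
  obtains W where "open_Rn n W" "u \<in> W" "W \<subseteq> A"
    "smooth n W m B (\<lambda>u. std (f (germ n (\<lambda>_. u))))"
proof -
  have inA: "germ n (\<lambda>_. v) \<in> fermat n A" if "v \<in> A" for v
    by (rule germ_in_fermat[OF A lop_const[OF that]])
  have stdc: "std (germ n (\<lambda>_. v)) = v" if "v \<in> A" for v
    using std_germ[OF lop_Rn[OF A lop_const[OF that]]] .
  obtain U k P \<alpha> p where aU: "std (germ n (\<lambda>_. u)) \<in> U"
    and "local_model n (fermat n A) m f U k P \<alpha> p"
    using qssE[OF f inA[OF u]] .
  note F = local_modelD[OF this(2)]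
  let ?W = "U \<inter> A" and ?s = "\<lambda>u. \<alpha> (cat k (p 0) u)"
  have W: "open_Rn n ?W" using F(1) A by blast
  have eq: "?s v = std (f (germ n (\<lambda>_. v)))" if "v \<in> ?W" for v
  proof -
    have v: "lop n U (\<lambda>_. v)" using that by (intro lop_const) blast
    show ?thesis
      using F(5)[OF v] inA[of v] that std_germ[OF lop_pair_smooth[OF F(2,1,4) order_refl F(3) v]] by simp
  qed
  have "smooth n U (k + n) (pt_prod k P U) (\<lambda>u. cat k (p 0) u)"
    using openin_le_Rn[OF F(1)] lop_in[OF F(3)] by (intro smooth_cat smooth_const smooth_id) auto
  then have s: "smooth n U m (Rn m) ?s"
    using smooth_compose[OF F(1) openin_pt_prod[OF F(2,1)] _ F(4)] by blast
  have "f (germ n (\<lambda>_. v)) \<in> fermat m B" if "v \<in> A" for v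
    using f inA[OF that] by (auto simp: quasi_standard_smooth_def)
  then have "?s ` ?W \<subseteq> B" using eq std_in[OF B] by auto
  then have "smooth n ?W m B ?s" using openin_le_Rn[OF F(1)] by (intro smooth_subset[OF _ s]) auto
  then have "smooth n ?W m B (\<lambda>u. std (f (germ n (\<lambda>_. u))))" using eq by (rule smooth_cong[OF W])
  with W u aU stdc show ?thesis by (intro that[of ?W]) auto
qed

section \<open>Colimits of concrete presheaves\<close>

text \<open>The diagrams of interest consist of representables. For their colimit to be a sheaf it is enough that
  they satisfy the first three conditions on a concrete sheaf, because the sections of a colimit are
  defined locally in any case.\<close>

definition concrete_presheaf :: "'p site \<Rightarrow> ('p, 'a) csheaf \<Rightarrow> bool" where
  "concrete_presheaf \<A> X \<longleftrightarrow>
     (\<forall>A\<in>Obj \<A>. sections X A \<subseteq> snd A \<rightarrow>\<^sub>E points X) \<and>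
     (\<forall>A\<in>Obj \<A>. \<forall>c\<in>points X. (\<lambda>_\<in>snd A. c) \<in> sections X A) \<and>
     (\<forall>A\<in>Obj \<A>. \<forall>B\<in>Obj \<A>. \<forall>f\<in>Hom \<A> A B. \<forall>s\<in>sections X B. compose (snd A) s f \<in> sections X A)"

lemma concrete_presheafD:
  assumes "concrete_presheaf \<A> X" "A \<in> Obj \<A>"
  shows "s \<in> sections X A \<Longrightarrow> s \<in> snd A \<rightarrow>\<^sub>E points X"
    and "c \<in> points X \<Longrightarrow> (\<lambda>_\<in>snd A. c) \<in> sections X A"
    and "B \<in> Obj \<A> \<Longrightarrow> f \<in> Hom \<A> A B \<Longrightarrow> s \<in> sections X B \<Longrightarrow> compose (snd A) s f \<in> sections X A"
proof -
  have *: "\<forall>A\<in>Obj \<A>. sections X A \<subseteq> snd A \<rightarrow>\<^sub>E points X"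
    "\<forall>A\<in>Obj \<A>. \<forall>c\<in>points X. (\<lambda>_\<in>snd A. c) \<in> sections X A"
    "\<forall>A\<in>Obj \<A>. \<forall>B\<in>Obj \<A>. \<forall>f\<in>Hom \<A> A B. \<forall>s\<in>sections X B. compose (snd A) s f \<in> sections X A"
    using assms(1) unfolding concrete_presheaf_def by - (elim conjE; assumption)+
  show "s \<in> snd A \<rightarrow>\<^sub>E points X" if "s \<in> sections X A"
    using bspec[OF *(1) assms(2)] that by (rule subsetD)
  show "(\<lambda>_\<in>snd A. c) \<in> sections X A" if "c \<in> points X"
    using bspec[OF *(2) assms(2)] that by (rule bspec)
  show "compose (snd A) s f \<in> sections X A"
    if "B \<in> Obj \<A>" "f \<in> Hom \<A> A B" "s \<in> sections X B"
    using bspec[OF bspec[OF bspec[OF *(3) assms(2)] that(1)] that(2)] that(3) by (rule bspec)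
qed

lemma concrete_sheaf_presheaf: "concrete_sheaf \<A> X \<Longrightarrow> concrete_presheaf \<A> X"
  unfolding concrete_sheaf_def concrete_presheaf_def by (elim conjE, intro conjI)

lemma concrete_sheaf_glue:
  assumes "concrete_sheaf \<A> X" "A \<in> Obj \<A>" "s \<in> snd A \<rightarrow>\<^sub>E points X" "\<W> \<in> Cov \<A> A"
    "\<And>W. W \<in> \<W> \<Longrightarrow> restrict s W \<in> sections X (fst A, W)"
  shows "s \<in> sections X A"
proof -
  have "\<forall>A\<in>Obj \<A>. \<forall>s\<in>snd A \<rightarrow>\<^sub>E points X. \<forall>\<W>\<in>Cov \<A> A.
      (\<forall>W\<in>\<W>. restrict s W \<in> sections X (fst A, W)) \<longrightarrow> s \<in> sections X A"
    using assms(1) unfolding concrete_sheaf_def by (elim conjE)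
  from bspec[OF bspec[OF bspec[OF this assms(2)] assms(3)] assms(4)] assms(5) show ?thesis by blast
qed

text \<open>What the construction of colimits uses of a site: constant maps make constants factor through a vertex,
  pullbacks of covers make sections stable under precomposition, and composites of covers make them
  local.\<close>

locale concrete_site =
  fixes \<A> :: "'p site"
  assumes Hom_fun: "A \<in> Obj \<A> \<Longrightarrow> B \<in> Obj \<A> \<Longrightarrow> f \<in> Hom \<A> A B \<Longrightarrow> f \<in> snd A \<rightarrow>\<^sub>E snd B"
    and Hom_compose: "A \<in> Obj \<A> \<Longrightarrow> B \<in> Obj \<A> \<Longrightarrow> C \<in> Obj \<A> \<Longrightarrow> f \<in> Hom \<A> A B \<Longrightarrow>
      g \<in> Hom \<A> B C \<Longrightarrow> compose (snd A) g f \<in> Hom \<A> A C"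
    and Hom_const: "A \<in> Obj \<A> \<Longrightarrow> B \<in> Obj \<A> \<Longrightarrow> b \<in> snd B \<Longrightarrow> (\<lambda>_\<in>snd A. b) \<in> Hom \<A> A B"
    and Cov_Obj: "A \<in> Obj \<A> \<Longrightarrow> \<W> \<in> Cov \<A> A \<Longrightarrow> W \<in> \<W> \<Longrightarrow> (fst A, W) \<in> Obj \<A>"
    and Cov_Union: "A \<in> Obj \<A> \<Longrightarrow> \<W> \<in> Cov \<A> A \<Longrightarrow> \<Union>\<W> = snd A"
    and Cov_trivial: "A \<in> Obj \<A> \<Longrightarrow> {snd A} \<in> Cov \<A> A"
    and Cov_trans: "A \<in> Obj \<A> \<Longrightarrow> \<W> \<in> Cov \<A> A \<Longrightarrow> (\<And>W. W \<in> \<W> \<Longrightarrow> \<V> W \<in> Cov \<A> (fst A, W)) \<Longrightarrow>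
      (\<Union>W\<in>\<W>. \<V> W) \<in> Cov \<A> A"
    and Cov_pullback: "A \<in> Obj \<A> \<Longrightarrow> B \<in> Obj \<A> \<Longrightarrow> f \<in> Hom \<A> A B \<Longrightarrow> \<W> \<in> Cov \<A> B \<Longrightarrow>
      \<exists>\<V>\<in>Cov \<A> A. \<forall>V\<in>\<V>. \<exists>W\<in>\<W>. restrict f V \<in> Hom \<A> (fst A, V) (fst B, W)"
begin

lemma concrete_presheaf_representable:
  assumes B: "B \<in> Obj \<A>"
  shows "concrete_presheaf \<A> (representable \<A> B)"
proof -
  have "Hom \<A> A B \<subseteq> snd A \<rightarrow>\<^sub>E snd B" if "A \<in> Obj \<A>" for A
    using Hom_fun[OF that B] by (rule subsetI)
  moreover have "(\<lambda>_\<in>snd A. b) \<in> Hom \<A> A B" if "A \<in> Obj \<A>" "b \<in> snd B" for A b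
    using that(1) B that(2) by (rule Hom_const)
  moreover have "compose (snd A) s f \<in> Hom \<A> A B"
    if "A \<in> Obj \<A>" "C \<in> Obj \<A>" "f \<in> Hom \<A> A C" "s \<in> Hom \<A> C B" for A C f s
    using that(1,2) B that(3,4) by (rule Hom_compose)
  ultimately show ?thesis
    unfolding concrete_presheaf_def representable_def by simp
qed

end

definition colim_class ::
  "'i set \<Rightarrow> ('i \<Rightarrow> ('p, 'b) csheaf) \<Rightarrow> ('i \<Rightarrow> 'i \<Rightarrow> ('b \<Rightarrow> 'b) set) \<Rightarrow> 'i \<Rightarrow> 'b \<Rightarrow> ('i \<times> 'b) set" where
  "colim_class I D M i x = colim_rel I D M `` {(i, x)}"

lemma equiv_colim_rel: "equiv (SIGMA i:I. points (D i)) (colim_rel I D M)"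
proof (rule equivI)
  show "colim_rel I D M \<subseteq> (SIGMA i:I. points (D i)) \<times> (SIGMA i:I. points (D i))"
    by (auto simp: colim_rel_def)
  show "refl_on (SIGMA i:I. points (D i)) (colim_rel I D M)"
    by (auto simp: refl_on_def colim_rel_def)
  show "sym (colim_rel I D M)"
    by (auto simp: sym_def colim_rel_def intro: equivclp_sym)
  show "trans (colim_rel I D M)"
    by (auto simp: trans_def colim_rel_def intro: equivclp_trans)
qed

lemma points_colimit: "points (colimit \<A> I D M) = (SIGMA i:I. points (D i)) // colim_rel I D M"
  by (simp add: colimit_def)

lemma colim_class_in_points:
  "i \<in> I \<Longrightarrow> x \<in> points (D i) \<Longrightarrow> colim_class I D M i x \<in> points (colimit \<A> I D M)"
  by (auto simp: points_colimit colim_class_def intro!: quotientI)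

lemma points_colimitE:
  assumes "c \<in> points (colimit \<A> I D M)"
  obtains i x where "i \<in> I" "x \<in> points (D i)" "c = colim_class I D M i x"
  using assms unfolding points_colimit colim_class_def by (auto elim!: quotientE)

text \<open>The only source of identifications in a colimit.\<close>

lemma colim_class_transition:
  assumes "i \<in> I" "j \<in> I" "x \<in> points (D i)" "f \<in> M i j" "f x \<in> points (D j)"
  shows "colim_class I D M i x = colim_class I D M j (f x)"
proof -
  have "((i, x), (j, f x)) \<in> colim_rel I D M"
    using assms by (auto simp: colim_rel_def intro!: r_into_equivclp)
  then show ?thesis unfolding colim_class_def by (rule equiv_class_eq[OF equiv_colim_rel])
qed

lemma colim_rel_invariant:
  assumes inv: "\<And>i j x f. i \<in> I \<Longrightarrow> j \<in> I \<Longrightarrow> x \<in> points (D i) \<Longrightarrow> f \<in> M i j \<Longrightarrow> \<phi> i x = \<phi> j (f x)"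
    and ab: "(a, b) \<in> colim_rel I D M"
  shows "case_prod \<phi> a = case_prod \<phi> b"
proof -
  have "equivclp (\<lambda>(i, x) (j, y). i \<in> I \<and> j \<in> I \<and> x \<in> points (D i) \<and> (\<exists>f\<in>M i j. y = f x)) a b"
    using ab by (simp add: colim_rel_def)
  then show ?thesis
  proof (induction rule: equivclp_induct)
    case (step y z)
    from step(2) have "case_prod \<phi> y = case_prod \<phi> z"
      by (cases y; cases z) (auto dest: inv)
    with step show ?case by simp
  qed simp
qed

text \<open>A function that is compatible with the transition maps is constant on classes; maps out of a colimit
  are obtained in this way.\<close>

lemma image_colim_class:
  assumes inv: "\<And>i j x f. i \<in> I \<Longrightarrow> j \<in> I \<Longrightarrow> x \<in> points (D i) \<Longrightarrow> f \<in> M i j \<Longrightarrow> \<phi> i x = \<phi> j (f x)"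
    and i: "i \<in> I" "x \<in> points (D i)"
  shows "case_prod \<phi> ` colim_class I D M i x = {\<phi> i x}"
proof -
  have "(i, x) \<in> colim_class I D M i x"
    unfolding colim_class_def by (rule equiv_class_self[OF equiv_colim_rel]) (use i in simp)
  moreover have "case_prod \<phi> a = \<phi> i x" if "a \<in> colim_class I D M i x" for a
  proof -
    have "((i, x), a) \<in> colim_rel I D M" using that by (simp add: colim_class_def)
    then have "case_prod \<phi> (i, x) = case_prod \<phi> a"
      by (rule colim_rel_invariant[where \<phi> = \<phi>, rotated]) (rule inv)
    then show ?thesis by simp
  qed
  ultimately show ?thesis by (intro equalityI subsetI) (auto intro: rev_image_eqI)
qed

text \<open>Over \<open>B\<close>, the function \<open>s\<close> is a section of one of the vertices; sections of the colimit do so locally.\<close>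

definition factors ::
  "'i set \<Rightarrow> ('i \<Rightarrow> ('p, 'b) csheaf) \<Rightarrow> ('i \<Rightarrow> 'i \<Rightarrow> ('b \<Rightarrow> 'b) set) \<Rightarrow> 'p obj \<Rightarrow> ('p \<Rightarrow> ('i \<times> 'b) set) \<Rightarrow> bool"
  where "factors I D M B s \<longleftrightarrow>
    (\<exists>i\<in>I. \<exists>\<sigma>\<in>sections (D i) B. \<forall>w\<in>snd B. s w = colim_class I D M i (\<sigma> w))"

lemma factorsI:
  "i \<in> I \<Longrightarrow> \<sigma> \<in> sections (D i) (m, W) \<Longrightarrow> (\<And>w. w \<in> W \<Longrightarrow> s w = colim_class I D M i (\<sigma> w)) \<Longrightarrow>
    factors I D M (m, W) s"
  unfolding factors_def snd_conv by blast

lemma factorsE: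
  assumes "factors I D M (m, W) s"
  obtains i \<sigma> where "i \<in> I" "\<sigma> \<in> sections (D i) (m, W)"
    "\<And>w. w \<in> W \<Longrightarrow> s w = colim_class I D M i (\<sigma> w)"
  using assms unfolding factors_def snd_conv by blast

context concrete_site
begin

lemma sections_colimitI:
  assumes "\<And>w. w \<in> snd A \<Longrightarrow> s w \<in> points (colimit \<A> I D M)" "s \<in> extensional (snd A)"
    "\<W> \<in> Cov \<A> A"
    "\<And>W. W \<in> \<W> \<Longrightarrow> factors I D M (fst A, W) s"
  shows "s \<in> sections (colimit \<A> I D M) A"
proof -
  have "s \<in> snd A \<rightarrow>\<^sub>E points (colimit \<A> I D M)" using assms(1,2) by (auto simp: PiE_def)
  then have *: "s \<in> snd A \<rightarrow>\<^sub>E (SIGMA i:I. points (D i)) // colim_rel I D M"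
    unfolding points_colimit .
  show ?thesis
    unfolding colimit_def csheaf.simps
    using assms(3,4) unfolding factors_def snd_conv colim_class_def
    by (intro CollectI conjI * bexI[of _ \<W>] ballI)
qed

lemma sections_colimitE:
  assumes "s \<in> sections (colimit \<A> I D M) A"
  obtains \<W> where "\<W> \<in> Cov \<A> A"
    "\<And>W. W \<in> \<W> \<Longrightarrow> factors I D M (fst A, W) s"
  using assms unfolding colimit_def factors_def colim_class_def by auto

lemma sections_colimit_fun:
  "s \<in> sections (colimit \<A> I D M) A \<Longrightarrow> s \<in> snd A \<rightarrow>\<^sub>E points (colimit \<A> I D M)"
  by (simp add: colimit_def)

lemma colim_inclusion_section:
  assumes A: "A \<in> Obj \<A>" and D: "concrete_presheaf \<A> (D i)" and i: "i \<in> I" and \<sigma>: "\<sigma> \<in> sections (D i) A"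
  shows "(\<lambda>w\<in>snd A. colim_class I D M i (\<sigma> w)) \<in> sections (colimit \<A> I D M) A"
  using concrete_presheafD(1)[OF D A \<sigma>] \<sigma> i
  by (intro sections_colimitI[OF _ _ Cov_trivial[OF A]]) (auto intro!: colim_class_in_points simp: factors_def)

theorem concrete_sheaf_colimit:
  assumes D: "\<And>i. i \<in> I \<Longrightarrow> concrete_presheaf \<A> (D i)"
  shows "concrete_sheaf \<A> (colimit \<A> I D M)"
  unfolding concrete_sheaf_def
proof (intro conjI ballI impI)
  let ?X = "colimit \<A> I D M"
  fix A assume A: "A \<in> Obj \<A>"
  show "sections ?X A \<subseteq> snd A \<rightarrow>\<^sub>E points ?X" using sections_colimit_fun by blast
  show "(\<lambda>_\<in>snd A. c) \<in> sections ?X A" if c: "c \<in> points ?X" for c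
  proof -
    obtain i x where ix: "i \<in> I" "x \<in> points (D i)" "c = colim_class I D M i x"
      using points_colimitE[OF c] .
    have "(\<lambda>w\<in>snd A. colim_class I D M i ((\<lambda>_\<in>snd A. x) w)) \<in> sections ?X A"
      by (intro colim_inclusion_section A D ix concrete_presheafD(2)[OF D[OF ix(1)] A])
    also have "(\<lambda>w\<in>snd A. colim_class I D M i ((\<lambda>_\<in>snd A. x) w)) = (\<lambda>_\<in>snd A. c)"
      unfolding ix(3) by (rule restrict_ext) simp
    finally show ?thesis .
  qed
  {
    fix B f s assume B: "B \<in> Obj \<A>" and f: "f \<in> Hom \<A> A B" and s: "s \<in> sections ?X B"
    obtain \<W> where \<W>: "\<W> \<in> Cov \<A> B"
      "\<And>W. W \<in> \<W> \<Longrightarrow> factors I D M (fst B, W) s"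
      by (rule sections_colimitE[OF s]) (rule that)
    obtain \<V> where \<V>: "\<V> \<in> Cov \<A> A"
      "\<And>V. V \<in> \<V> \<Longrightarrow> \<exists>W\<in>\<W>. restrict f V \<in> Hom \<A> (fst A, V) (fst B, W)"
      using Cov_pullback[OF A B f \<W>(1)] by blast
    show "compose (snd A) s f \<in> sections ?X A"
    proof (rule sections_colimitI[OF _ _ \<V>(1)])
      show "compose (snd A) s f w \<in> points ?X" if "w \<in> snd A" for w
        using sections_colimit_fun[OF s] Hom_fun[OF A B f] that by (auto simp: compose_def)
      show "compose (snd A) s f \<in> extensional (snd A)" by simp
      fix V assume V: "V \<in> \<V>"
      then obtain W where W: "W \<in> \<W>" "restrict f V \<in> Hom \<A> (fst A, V) (fst B, W)" using \<V>(2) by blast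
      obtain i \<sigma> where i: "i \<in> I" and \<sigma>: "\<sigma> \<in> sections (D i) (fst B, W)"
        "\<And>w. w \<in> W \<Longrightarrow> s w = colim_class I D M i (\<sigma> w)"
        by (rule factorsE[OF \<W>(2)[OF W(1)]]) (rule that)
      note VO = Cov_Obj[OF A \<V>(1) V] and WO = Cov_Obj[OF B \<W>(1) W(1)]
      have "compose V \<sigma> (restrict f V) \<in> sections (D i) (fst A, V)"
        using concrete_presheafD(3)[OF D[OF i] VO WO W(2) \<sigma>(1)] by simp
      moreover have "compose (snd A) s f w = colim_class I D M i (compose V \<sigma> (restrict f V) w)"
        if w: "w \<in> V" for w
      proof -
        have "w \<in> snd A" using Cov_Union[OF A \<V>(1)] V w by blast
        moreover have "f w \<in> W" using Hom_fun[OF VO WO W(2)] w by (auto simp: PiE_def Pi_def)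
        ultimately show ?thesis using w \<sigma>(2) by (simp add: compose_def)
      qed
      ultimately show "factors I D M (fst A, V) (compose (snd A) s f)"
        by (rule factorsI[OF i])
    qed
  next
    fix s \<W> assume s: "s \<in> snd A \<rightarrow>\<^sub>E points ?X" and \<W>: "\<W> \<in> Cov \<A> A"
      and loc: "\<forall>W\<in>\<W>. restrict s W \<in> sections ?X (fst A, W)"
    have "\<exists>\<V>. \<V> \<in> Cov \<A> (fst A, W) \<and> (\<forall>V\<in>\<V>. factors I D M (fst A, V) s)" if W: "W \<in> \<W>" for W
    proof -
      have "restrict s W \<in> sections ?X (fst A, W)" using loc W by blast
      then obtain \<V> where \<V>: "\<V> \<in> Cov \<A> (fst A, W)"
        "\<And>V. V \<in> \<V> \<Longrightarrow> factors I D M (fst (fst A, W), V) (restrict s W)"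
        by (rule sections_colimitE) (rule that)
      have "V \<subseteq> W" if "V \<in> \<V>" for V
        using Cov_Union[OF Cov_Obj[OF A \<W> W] \<V>(1)] that by auto
      then have "factors I D M (fst A, V) s" if "V \<in> \<V>" for V
        using \<V>(2)[OF that] that unfolding factors_def by (simp add: restrict_def subset_iff)
      with \<V>(1) show ?thesis by blast
    qed
    then obtain \<V> where \<V>: "\<And>W. W \<in> \<W> \<Longrightarrow> \<V> W \<in> Cov \<A> (fst A, W)"
      "\<And>W. W \<in> \<W> \<Longrightarrow> \<forall>V\<in>\<V> W. factors I D M (fst A, V) s" by metis
    show "s \<in> sections ?X A"
      by (rule sections_colimitI[OF _ _ Cov_trans[OF A \<W> \<V>(1)]]) (use s \<V>(2) in \<open>auto simp: PiE_iff\<close>)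
  }
qed

end

text \<open>A morphism of diagrams that is the identity on vertices and sends every transition map to itself. A
  smooth map \<open>g : X \<rightarrow> Y\<close> induces one by \<open>p \<mapsto> g \<circ> p\<close>, because a morphism over \<open>X\<close> is also one over \<open>Y\<close>.\<close>

definition reindexing ::
  "'i set \<Rightarrow> ('i \<Rightarrow> ('p, 'b) csheaf) \<Rightarrow> ('i \<Rightarrow> 'i \<Rightarrow> ('b \<Rightarrow> 'b) set) \<Rightarrow>
   'j set \<Rightarrow> ('j \<Rightarrow> ('p, 'b) csheaf) \<Rightarrow> ('j \<Rightarrow> 'j \<Rightarrow> ('b \<Rightarrow> 'b) set) \<Rightarrow> ('i \<Rightarrow> 'j) \<Rightarrow> bool" where
  "reindexing I D M J E N R \<longleftrightarrow>
     (\<forall>i\<in>I. R i \<in> J \<and> E (R i) = D i) \<and>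
     (\<forall>i\<in>I. \<forall>j\<in>I. \<forall>f\<in>M i j. f \<in> N (R i) (R j) \<and> f ` points (D i) \<subseteq> points (D j))"

definition colim_map ::
  "'i set \<Rightarrow> ('i \<Rightarrow> ('p, 'b) csheaf) \<Rightarrow> ('i \<Rightarrow> 'i \<Rightarrow> ('b \<Rightarrow> 'b) set) \<Rightarrow>
   'j set \<Rightarrow> ('j \<Rightarrow> ('p, 'b) csheaf) \<Rightarrow> ('j \<Rightarrow> 'j \<Rightarrow> ('b \<Rightarrow> 'b) set) \<Rightarrow> ('i \<Rightarrow> 'j) \<Rightarrow>
   ('i \<times> 'b) set \<Rightarrow> ('j \<times> 'b) set" where
  "colim_map I D M J E N R =
     (\<lambda>c\<in>(SIGMA i:I. points (D i)) // colim_rel I D M. \<Union>(i, x)\<in>c. colim_class J E N (R i) x)"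

lemma colim_map_class:
  assumes R: "reindexing I D M J E N R" and i: "i \<in> I" "x \<in> points (D i)"
  shows "colim_map I D M J E N R (colim_class I D M i x) = colim_class J E N (R i) x"
proof -
  let ?\<phi> = "\<lambda>i x. colim_class J E N (R i) x"
  have "case_prod ?\<phi> ` colim_class I D M i x = {?\<phi> i x}"
  proof (rule image_colim_class[where \<phi> = ?\<phi> and I = I and D = D and M = M, OF _ i])
    fix i j x f assume *: "i \<in> I" "j \<in> I" "x \<in> points (D i)" "f \<in> M i j"
    then have "R i \<in> J" "R j \<in> J" "E (R i) = D i" "E (R j) = D j" "f \<in> N (R i) (R j)" "f x \<in> points (D j)"
      using R unfolding reindexing_def by blast+
    with *(3) show "?\<phi> i x = ?\<phi> j (f x)" by (intro colim_class_transition) simp_all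
  qed
  moreover have "colim_class I D M i x \<in> (SIGMA i:I. points (D i)) // colim_rel I D M"
    using colim_class_in_points[of i I x D M] i unfolding points_colimit by blast
  ultimately show ?thesis by (simp add: colim_map_def)
qed

lemma (in concrete_site) colim_map_sheaf_map:
  assumes D: "\<And>i. i \<in> I \<Longrightarrow> concrete_presheaf \<A> (D i)" and R: "reindexing I D M J E N R"
  shows "colim_map I D M J E N R \<in> sheaf_maps \<A> (colimit \<A> I D M) (colimit \<A> J E N)"
proof -
  let ?G = "colim_map I D M J E N R" and ?X = "colimit \<A> I D M" and ?Y = "colimit \<A> J E N"
  have RJ: "R i \<in> J" "E (R i) = D i" if "i \<in> I" for i using R that by (auto simp: reindexing_def)
  have mem: "?G c \<in> points ?Y" if c: "c \<in> points ?X" for c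
  proof -
    obtain i x where ix: "i \<in> I" "x \<in> points (D i)" "c = colim_class I D M i x"
      using points_colimitE[OF c] .
    with RJ show ?thesis by (auto simp: colim_map_class[OF R] intro!: colim_class_in_points)
  qed
  have "?G \<in> points ?X \<rightarrow>\<^sub>E points ?Y"
    using mem by (auto simp: colim_map_def points_colimit[of \<A> I])
  moreover have "compose (snd A) ?G s \<in> sections ?Y A"
    if A: "A \<in> Obj \<A>" and s: "s \<in> sections ?X A" for A s
  proof -
    obtain \<W> where \<W>: "\<W> \<in> Cov \<A> A"
      "\<And>W. W \<in> \<W> \<Longrightarrow> factors I D M (fst A, W) s"
      by (rule sections_colimitE[OF s]) (rule that)
    show ?thesis
    proof (rule sections_colimitI[OF _ _ \<W>(1)])
      show "compose (snd A) ?G s w \<in> points ?Y" if "w \<in> snd A" for w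
        using sections_colimit_fun[OF s] that mem by (auto simp: compose_def)
      fix W assume W: "W \<in> \<W>"
      obtain i \<sigma> where i: "i \<in> I" and \<sigma>: "\<sigma> \<in> sections (D i) (fst A, W)"
        "\<And>w. w \<in> W \<Longrightarrow> s w = colim_class I D M i (\<sigma> w)"
        by (rule factorsE[OF \<W>(2)[OF W]]) (rule that)
      have eq: "compose (snd A) ?G s w = colim_class J E N (R i) (\<sigma> w)" if w: "w \<in> W" for w
      proof -
        have "\<sigma> w \<in> points (D i)"
          using concrete_presheafD(1)[OF D[OF i] Cov_Obj[OF A \<W>(1) W] \<sigma>(1)] w by auto
        moreover have "w \<in> snd A" using Cov_Union[OF A \<W>(1)] W w by blast
        ultimately show ?thesis using \<sigma>(2)[OF w] by (simp add: compose_def colim_map_class[OF R i])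
      qed
      have "\<sigma> \<in> sections (E (R i)) (fst A, W)" using RJ[OF i] \<sigma>(1) by simp
      then show "factors J E N (fst A, W) (compose (snd A) ?G s)" using eq by (rule factorsI[OF RJ(1)[OF i]])
    qed simp
  qed
  ultimately show ?thesis by (simp add: sheaf_maps_def)
qed

section \<open>The two sites are concrete sites\<close>

lemma S_site_simps [simp]:
  "(n, U) \<in> Obj S_site \<longleftrightarrow> open_Rn n U"
  "f \<in> Hom S_site (n, U) (m, V) \<longleftrightarrow> f \<in> U \<rightarrow>\<^sub>E V \<and> smooth n U m V f"
  "\<W> \<in> Cov S_site (n, U) \<longleftrightarrow> (\<forall>W\<in>\<W>. open_Rn n W) \<and> \<Union>\<W> = U"
  by (auto simp: S_site_def)

lemma F_site_simps [simp]:
  "(n, A) \<in> Obj F_site \<longleftrightarrow> A \<subseteq> fermat n (Rn n)"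
  "f \<in> Hom F_site (n, A) (m, B) \<longleftrightarrow> f \<in> A \<rightarrow>\<^sub>E B \<and> qss n A m B f"
  "\<W> \<in> Cov F_site (n, A) \<longleftrightarrow>
    (\<forall>W\<in>\<W>. openin (subtopology (fermat_topology n) A) W) \<and> \<Union>\<W> = A"
  by (auto simp: F_site_def)

lemma Hom_S_compose:
  assumes U: "open_Rn n U" and V: "open_Rn m V"
    and f: "f \<in> Hom S_site (n, U) (m, V)" and g: "g \<in> Hom S_site (m, V) (l, W)"
  shows "compose U g f \<in> Hom S_site (n, U) (l, W)"
proof -
  have "smooth n U l W (\<lambda>x. g (f x))" using smooth_compose[OF U V] f g by simp
  then have "smooth n U l W (compose U g f)" by (rule smooth_cong[OF U]) (simp add: compose_def)
  with f g show ?thesis by (auto simp: compose_def)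
qed

lemma Hom_S_restrict:
  assumes U: "open_Rn n U" and U': "open_Rn n U'" "U' \<subseteq> U"
    and f: "smooth n U m V f" and "f ` U' \<subseteq> V'"
  shows "restrict f U' \<in> Hom S_site (n, U') (m, V')"
proof -
  have "smooth n U' m V' (restrict f U')"
    using smooth_subset[OF openin_le_Rn[OF U] f U'(2) assms(5)] by (rule smooth_cong[OF U'(1)]) simp
  with assms(5) show ?thesis by auto
qed

lemma Hom_S_id: "open_Rn n U \<Longrightarrow> id_on U \<in> Hom S_site (n, U) (n, U)"
  using Hom_S_restrict[of n U U n U "\<lambda>x. x" U] smooth_id[of U n U] openin_le_Rn[of n U] by auto

interpretation S: concrete_site S_site
proof
  fix A B C :: "pt obj"
  assume A: "A \<in> Obj S_site"
  obtain n U where AU: "A = (n, U)" by (cases A)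
  have U: "open_Rn n U" using A AU by simp
  obtain m V where BV: "B = (m, V)" by (cases B)
  obtain l W where CW: "C = (l, W)" by (cases C)
  show "{snd A} \<in> Cov S_site A" using U AU by simp
  {
    fix \<W> W assume "\<W> \<in> Cov S_site A" "W \<in> \<W>"
    then show "(fst A, W) \<in> Obj S_site" using AU by simp
  }
  {
    fix \<W> assume "\<W> \<in> Cov S_site A"
    then show "\<Union>\<W> = snd A" using AU by simp
  }
  {
    fix \<W> :: "pt set set" and \<V>
    assume \<W>: "\<W> \<in> Cov S_site A" and \<V>: "\<And>W. W \<in> \<W> \<Longrightarrow> \<V> W \<in> Cov S_site (fst A, W)"
    have "open_Rn n V" if "W \<in> \<W>" "V \<in> \<V> W" for V W
      using \<V>[OF that(1)] that(2) AU by simp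
    moreover have "\<Union>(\<V> W) = W" if "W \<in> \<W>" for W using \<V>[OF that] AU by simp
    then have "(\<Union>W\<in>\<W>. \<Union>(\<V> W)) = \<Union>\<W>" by simp
    moreover have "\<Union>(\<Union>W\<in>\<W>. \<V> W) = (\<Union>W\<in>\<W>. \<Union>(\<V> W))" by blast
    ultimately show "(\<Union>W\<in>\<W>. \<V> W) \<in> Cov S_site A" using \<W> AU by simp
  }
  assume B: "B \<in> Obj S_site"
  have V: "open_Rn m V" using B BV by simp
  {
    fix b assume "b \<in> snd B"
    then show "(\<lambda>_\<in>snd A. b) \<in> Hom S_site A B"
      using Hom_S_restrict[OF U U order_refl smooth_const[OF openin_le_Rn[OF U]], of b V V m] AU BV
      by auto
  }
  fix f assume f: "f \<in> Hom S_site A B"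
  show "f \<in> snd A \<rightarrow>\<^sub>E snd B" using f AU BV by simp
  {
    fix g assume g: "g \<in> Hom S_site B C"
    from Hom_S_compose[OF U V f[unfolded AU BV] g[unfolded BV CW]]
    show "compose (snd A) g f \<in> Hom S_site A C" unfolding AU CW snd_conv .
  }
  fix \<W> assume \<W>: "\<W> \<in> Cov S_site B"
  have f': "smooth n U m V f" using f AU BV by simp
  have fR: "smooth n U m (Rn m) f"
    using smooth_subset[OF openin_le_Rn[OF U] f' order_refl] smooth_in[OF f'] openin_le_Rn[OF V] by blast
  let ?\<V> = "(\<lambda>W. {x \<in> U. f x \<in> W}) ` \<W>"
  have op: "open_Rn n {x \<in> U. f x \<in> W}" if "W \<in> \<W>" for W
    using openin_smooth_preimage[OF U fR] \<W> that BV by simp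
  have "restrict f {x \<in> U. f x \<in> W} \<in> Hom S_site (n, {x \<in> U. f x \<in> W}) (m, W)" if "W \<in> \<W>" for W
    by (rule Hom_S_restrict[OF U op[OF that] _ f']) auto
  moreover have "?\<V> \<in> Cov S_site A"
    using op \<W> smooth_in[OF f'] AU BV by auto
  ultimately show "\<exists>\<V>\<in>Cov S_site A. \<forall>V\<in>\<V>. \<exists>W\<in>\<W>. restrict f V \<in> Hom S_site (fst A, V) (fst B, W)"
    using AU BV by (intro bexI[of _ ?\<V>]) auto
qed

text \<open>Traces of the sets \<open>\<^sup>\<bullet>U\<close> are the Fermat-open sets of \<open>A\<close>, so covers can be handled through open
  sets of standard points.\<close>

lemma openin_subtopology_fermat:
  "openin (subtopology (fermat_topology n) A) W \<longleftrightarrow>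
    (\<exists>U. open_Rn n U \<and> W = fermat n U \<inter> A)"
  by (auto simp: openin_subtopology openin_fermat_topology)

lemma Hom_F_restrict:
  assumes f: "qss n A m B f" and "A' \<subseteq> A" "f ` A' \<subseteq> B'"
  shows "restrict f A' \<in> Hom F_site (n, A') (m, B')"
  using qss_subset[OF assms, of "restrict f A'"] assms(3) by auto

interpretation F: concrete_site F_site
proof
  fix A B C :: "fpt obj"
  assume A: "A \<in> Obj F_site"
  obtain n A' where AU: "A = (n, A')" by (cases A)
  have U': "A' \<subseteq> fermat n (Rn n)" using A AU by simp
  obtain m B' where BV: "B = (m, B')" by (cases B)
  obtain l C' where CW: "C = (l, C')" by (cases C)
  have "A' = fermat n (Rn n) \<inter> A'" using U' by blast
  then show "{snd A} \<in> Cov F_site A" using openin_Rn AU by (auto simp: openin_subtopology_fermat)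
  {
    fix \<W> W assume "\<W> \<in> Cov F_site A" "W \<in> \<W>"
    then have "W \<subseteq> A'" using AU by auto
    with U' show "(fst A, W) \<in> Obj F_site" using AU by auto
  }
  {
    fix \<W> assume "\<W> \<in> Cov F_site A"
    then show "\<Union>\<W> = snd A" using AU by simp
  }
  {
    fix \<W> :: "fpt set set" and \<V>
    assume \<W>: "\<W> \<in> Cov F_site A" and \<V>: "\<And>W. W \<in> \<W> \<Longrightarrow> \<V> W \<in> Cov F_site (fst A, W)"
    have "openin (subtopology (fermat_topology n) A') V" if "W \<in> \<W>" "V \<in> \<V> W" for V W
    proof -
      have "openin (subtopology (fermat_topology n) A') W"
        "openin (subtopology (fermat_topology n) W) V"
        using that \<W> \<V>[OF that(1)] AU by simp_all
      then obtain T T' where "openin (fermat_topology n) T" "W = T \<inter> A'"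
        "openin (fermat_topology n) T'" "V = T' \<inter> W"
        unfolding openin_subtopology by blast
      then have "openin (fermat_topology n) (T' \<inter> T)" "V = (T' \<inter> T) \<inter> A'" by auto
      then show ?thesis unfolding openin_subtopology by blast
    qed
    moreover have "\<Union>(\<V> W) = W" if "W \<in> \<W>" for W using \<V>[OF that] AU by simp
    then have "(\<Union>W\<in>\<W>. \<Union>(\<V> W)) = \<Union>\<W>" by simp
    moreover have "\<Union>(\<Union>W\<in>\<W>. \<V> W) = (\<Union>W\<in>\<W>. \<Union>(\<V> W))" by blast
    ultimately show "(\<Union>W\<in>\<W>. \<V> W) \<in> Cov F_site A" using \<W> AU by simp
  }
  assume B: "B \<in> Obj F_site"
  have V: "B' \<subseteq> fermat m (Rn m)" using B BV by simp
  {
    fix b assume "b \<in> snd B"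
    then show "(\<lambda>_\<in>snd A. b) \<in> Hom F_site A B"
      using Hom_F_restrict[OF qss_const[OF U' _ V] order_refl, of b B'] AU BV by auto
  }
  fix f assume f: "f \<in> Hom F_site A B"
  show "f \<in> snd A \<rightarrow>\<^sub>E snd B" using f AU BV by simp
  {
    fix g assume g: "g \<in> Hom F_site B C"
    have "qss n A' l C' (\<lambda>x. g (f x))"
      using qss_compose[OF U' V] f g AU BV CW by simp
    from Hom_F_restrict[OF this order_refl, of C'] f g
    show "compose (snd A) g f \<in> Hom F_site A C"
      using AU BV CW by (auto simp: compose_def)
  }
  fix \<W> assume \<W>: "\<W> \<in> Cov F_site B"
  have f': "qss n A' m B' f" using f AU BV by simp
  \<comment> \<open>All open sets that \<open>f\<close> maps into a member of the cover; continuity makes them cover \<open>A\<close>.\<close>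
  let ?\<V> = "{V. openin (subtopology (fermat_topology n) A') V \<and> (\<exists>W\<in>\<W>. f ` V \<subseteq> W)}"
  have "a \<in> \<Union>?\<V>" if a: "a \<in> A'" for a
  proof -
    have "f a \<in> B'" using qss_in[OF f' a] .
    then obtain W where W: "W \<in> \<W>" "f a \<in> W" using \<W> BV by auto
    then have "openin (subtopology (fermat_topology m) B') W" using \<W> BV by simp
    then obtain W' where W': "open_Rn m W'" "W = fermat m W' \<inter> B'"
      unfolding openin_subtopology_fermat by blast
    have "std (f a) \<in> W'" using W W' std_in by blast
    then obtain U where *: "open_Rn n U" "std a \<in> U"
      "\<And>x. x \<in> A' \<inter> fermat n U \<Longrightarrow> std (f x) \<in> W'"
      by (rule qss_continuous[OF U' f' W'(1) a]) (rule that)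
    have fU: "f ` (fermat n U \<inter> A') \<subseteq> W"
    proof (rule image_subsetI)
      fix x assume x: "x \<in> fermat n U \<inter> A'"
      then have "f x \<in> B'" "std (f x) \<in> W'" using *(3)[of x] qss_in[OF f'] by simp_all
      with V show "f x \<in> W" unfolding W'(2) fermat_eq_std[OF W'(1)] by blast
    qed
    have "a \<in> fermat n U" unfolding fermat_eq_std[OF *(1)] using *(2) a U' by blast
    moreover have "openin (subtopology (fermat_topology n) A') (fermat n U \<inter> A')"
      unfolding openin_subtopology_fermat using *(1) by blast
    then have "fermat n U \<inter> A' \<in> ?\<V>" using fU W(1) by blast
    ultimately show ?thesis using a by blast
  qed
  moreover have sub: "V \<subseteq> A'" if "V \<in> ?\<V>" for V
    using that unfolding openin_subtopology_fermat by blast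
  ultimately have "\<Union>?\<V> = A'" by (meson Sup_least equalityI subsetI)
  then have "?\<V> \<in> Cov F_site A" using AU by simp
  moreover have "\<exists>W\<in>\<W>. restrict f V \<in> Hom F_site (n, V) (m, W)" if V: "V \<in> ?\<V>" for V
  proof -
    obtain W where "W \<in> \<W>" "f ` V \<subseteq> W" "V \<subseteq> A'"
      using V sub[OF V] by blast
    then show ?thesis using Hom_F_restrict[OF f'] by blast
  qed
  ultimately show "\<exists>\<V>\<in>Cov F_site A. \<forall>V\<in>\<V>. \<exists>W\<in>\<W>. restrict f V \<in> Hom F_site (fst A, V) (fst B, W)"
    using AU BV by (intro bexI[of _ ?\<V>]) auto
qed

lemma Obj_S_iff: "A \<in> Obj S_site \<longleftrightarrow> open_Rn (fst A) (snd A)"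
  by (cases A) simp

lemma Hom_S_iff:
  "f \<in> Hom S_site A B \<longleftrightarrow> f \<in> snd A \<rightarrow>\<^sub>E snd B \<and> smooth (fst A) (snd A) (fst B) (snd B) f"
  by (cases A; cases B) simp

lemma fermat_obj_Obj: "A \<in> Obj S_site \<Longrightarrow> fermat_obj A \<in> Obj F_site"
  using fermat_subset_Rn by (simp add: Obj_S_iff)

lemma const_pt_in: "A \<in> Obj S_site \<Longrightarrow> u \<in> snd A \<Longrightarrow> const_of A u \<in> fermat_of A"
  by (simp add: Obj_S_iff const_pt_germ germ_in_fermat lop_const)

lemma std_const_pt: "A \<in> Obj S_site \<Longrightarrow> u \<in> snd A \<Longrightarrow> std (const_of A u) = u"
  by (simp add: Obj_S_iff const_pt_germ std_germ[OF lop_Rn[OF _ lop_const]])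

text \<open>Inclusions are Fermat extensions of smooth inclusions.\<close>

lemma Hom_F_inclusion:
  assumes U: "open_Rn n U" and V: "open_Rn n V" "V \<subseteq> U"
  shows "id_on (fermat n V) \<in> Hom F_site (n, fermat n V) (n, fermat n U)"
proof -
  have sm: "smooth n V n U (\<lambda>x. x)" using smooth_id[OF openin_le_Rn[OF V(1)] V(2)] .
  have eq: "fermat_map n V n U (\<lambda>x. x) c = c" if "c \<in> fermat n V" for c
    using fermatE[OF that V(1)] fermat_map_germ[OF V(1) U sm] by metis
  have "fermat_map n V n U (\<lambda>x. x) = id_on (fermat n V)"
    using eq by (auto simp: fun_eq_iff fermat_map_def)
  then show ?thesis
    using qss_fermat_map[OF V(1) U sm] fermat_map_in[OF V(1) U sm] by simp
qed

text \<open>The square formed by \<open>\<^sup>\<bullet>f\<close>, \<open>f\<close> and the standard parts commutes since \<open>(f \<circ> x) 0 = f (x 0)\<close>.\<close>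

lemma std_fermat_map:
  assumes U: "open_Rn n U" and V: "open_Rn m V"
    and f: "smooth n U m V f" and c: "c \<in> fermat n U"
  shows "std (fermat_map n U m V f c) = f (std c)"
proof -
  obtain x where x: "lop n U x" "c = germ n x" using fermatE[OF c U] .
  then show ?thesis
    using std_germ[OF lop_Rn[OF V lop_smooth[OF U f openin_le_Rn[OF V] x(1)]]] std_germ[OF lop_Rn[OF U x(1)]]
    by (simp add: fermat_map_germ[OF U V f])
qed

section \<open>Morphisms of concrete sheaves\<close>

lemma compose_compose:
  "p \<in> S \<rightarrow> T \<Longrightarrow> compose S (compose T h g) p = compose S h (compose S g p)"
  by (auto simp: compose_def fun_eq_iff)

lemma compose_id_on: "f \<in> A \<rightarrow>\<^sub>E B \<Longrightarrow> compose A (id_on B) f = f"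
  by (rule Id_compose) (simp_all add: PiE_def)

lemma sheaf_maps_compose:
  assumes X: "concrete_presheaf \<A> X" and g: "g \<in> sheaf_maps \<A> X Y" and h: "h \<in> sheaf_maps \<A> Y Z"
  shows "compose (points X) h g \<in> sheaf_maps \<A> X Z"
proof -
  have "compose (snd A) (compose (points X) h g) s \<in> sections Z A"
    if A: "A \<in> Obj \<A>" and s: "s \<in> sections X A" for A s
  proof -
    have "compose (snd A) g s \<in> sections Y A" using g A s by (auto simp: sheaf_maps_def)
    then have "compose (snd A) h (compose (snd A) g s) \<in> sections Z A"
      using h A by (auto simp: sheaf_maps_def)
    then show ?thesis
      using concrete_presheafD(1)[OF X A s] by (subst compose_compose) auto
  qed
  moreover have "compose (points X) h g \<in> points X \<rightarrow>\<^sub>E points Z"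
    using g h by (auto simp: sheaf_maps_def compose_def PiE_iff)
  ultimately show ?thesis by (simp add: sheaf_maps_def)
qed

lemma sheaf_maps_fun: "g \<in> sheaf_maps \<A> X Y \<Longrightarrow> g \<in> points X \<rightarrow>\<^sub>E points Y"
  by (simp add: sheaf_maps_def)

lemma sheaf_maps_section:
  "g \<in> sheaf_maps \<A> X Y \<Longrightarrow> A \<in> Obj \<A> \<Longrightarrow> s \<in> sections X A \<Longrightarrow> compose (snd A) g s \<in> sections Y A"
  by (simp add: sheaf_maps_def)

lemma id_sheaf_map: "concrete_presheaf \<A> X \<Longrightarrow> id_on (points X) \<in> sheaf_maps \<A> X X"
proof -
  assume X: "concrete_presheaf \<A> X"
  have "compose (snd A) (id_on (points X)) s = s" if "A \<in> Obj \<A>" "s \<in> sections X A" for A s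
    by (rule compose_id_on) (rule concrete_presheafD(1)[OF X that])
  then show ?thesis by (simp add: sheaf_maps_def)
qed

section \<open>Adding infinitesimals\<close>

definition add_vertex :: "'a plot \<Rightarrow> (fpt, fpt) csheaf" where
  "add_vertex = (\<lambda>(A, p). representable F_site (fermat_obj A))"

definition add_transition :: "'a plot \<Rightarrow> 'a plot \<Rightarrow> (fpt \<Rightarrow> fpt) set" where
  "add_transition = (\<lambda>(A, p) (B, q). fermat_map_of A B ` plot_homs (A, p) (B, q))"

definition add_class :: "(pt, 'a) csheaf \<Rightarrow> 'a plot \<Rightarrow> fpt \<Rightarrow> ('a plot \<times> fpt) set" where
  "add_class X i x = add_rel X `` {(i, x)}"

lemma add_inf_colimit: "add_inf X = colimit F_site (plots X) add_vertex add_transition"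
  unfolding add_inf_def add_vertex_def add_transition_def ..

lemma add_class_colim: "add_class X = colim_class (plots X) add_vertex add_transition"
  unfolding add_class_def add_rel_def colim_class_def add_vertex_def add_transition_def by (intro ext) simp

lemma points_add_vertex: "points (add_vertex (A, p)) = fermat_of A"
  by (simp add: add_vertex_def representable_def)

lemma sections_add_vertex: "sections (add_vertex (A, p)) B = Hom F_site B (fermat_obj A)"
  by (simp add: add_vertex_def representable_def)

lemma plots_iff: "(A, p) \<in> plots X \<longleftrightarrow> A \<in> Obj S_site \<and> p \<in> sections X A"
  by (simp add: plots_def)

lemma add_vertex_presheaf: "i \<in> plots X \<Longrightarrow> concrete_presheaf F_site (add_vertex i)"
  by (cases i) (auto simp: add_vertex_def plots_iff intro!: F.concrete_presheaf_representable fermat_obj_Obj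
      simp del: F_site_simps)

lemma fermat_space_add_inf: "fermat_space (add_inf X)"
  unfolding add_inf_colimit by (rule F.concrete_sheaf_colimit) (rule add_vertex_presheaf)

lemma plot_homs_iff:
  "f \<in> plot_homs (A, p) (B, q) \<longleftrightarrow> f \<in> Hom S_site A B \<and> compose (snd A) q f = p"
  by (simp add: plot_homs_def)

lemma add_transitionE:
  assumes "F \<in> add_transition (A, p) (B, q)"
  obtains f where "f \<in> Hom S_site A B" "compose (snd A) q f = p"
    "F = fermat_map_of A B f"
  using assms by (auto simp: add_transition_def plot_homs_iff)

lemma fermat_map_Hom:
  assumes "A \<in> Obj S_site" "B \<in> Obj S_site" "f \<in> Hom S_site A B"
  shows "fermat_map_of A B f \<in> Hom F_site (fermat_obj A) (fermat_obj B)"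
  using assms qss_fermat_map fermat_map_in by (simp add: Obj_S_iff Hom_S_iff)

lemma add_class_transition:
  assumes p: "(A, p) \<in> plots X" and q: "(B, q) \<in> plots X" and f: "f \<in> Hom S_site A B"
    and eq: "compose (snd A) q f = p" and x: "x \<in> fermat_of A"
  shows "add_class X (A, p) x = add_class X (B, q) (fermat_map_of A B f x)"
  unfolding add_class_colim
proof (rule colim_class_transition[OF p q])
  show "fermat_map_of A B f \<in> add_transition (A, p) (B, q)"
    using f eq by (auto simp: add_transition_def plot_homs_iff)
  show "fermat_map_of A B f x \<in> points (add_vertex (B, q))"
    using p q f x fermat_map_in by (fastforce simp: points_add_vertex plots_iff Obj_S_iff Hom_S_iff)
qed (use x in \<open>simp add: points_add_vertex\<close>)

lemma add_class_in_points:
  "(A, p) \<in> plots X \<Longrightarrow> x \<in> fermat_of A \<Longrightarrow> add_class X (A, p) x \<in> points (add_inf X)"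
  unfolding add_class_colim add_inf_colimit by (rule colim_class_in_points) (simp_all add: points_add_vertex)

lemma points_add_infE:
  assumes "c \<in> points (add_inf X)"
  obtains A p x where "(A, p) \<in> plots X" "x \<in> fermat_of A" "c = add_class X (A, p) x"
proof -
  obtain i x where "i \<in> plots X" "x \<in> points (add_vertex i)" "c = add_class X i x"
    using assms unfolding add_inf_colimit add_class_colim by (rule points_colimitE)
  then show ?thesis using that by (cases i) (auto simp: points_add_vertex)
qed

lemma plot_in: "diffeological_space X \<Longrightarrow> (A, p) \<in> plots X \<Longrightarrow> p \<in> snd A \<rightarrow>\<^sub>E points X"
  unfolding plots_iff by (elim conjE) (rule concrete_presheafD(1)[OF concrete_sheaf_presheaf])

text \<open>The map \<open>\<^sup>\<bullet>X \<rightarrow> X\<close>, \<open>[q, v] \<mapsto> q (\<^sup>\<circ>v)\<close>. The choice of a representative is harmless by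
  \<open>std_point_class\<close>.\<close>

definition std_point :: "('a plot \<times> fpt) set \<Rightarrow> 'a" where
  "std_point c = the_elem ((\<lambda>((A, p), x). p (std x)) ` c)"

text \<open>If \<open>f\<close> is a morphism from \<open>p\<close> to \<open>q\<close>, then \<open>q (\<^sup>\<circ>(\<^sup>\<bullet>f x)) = q (f (\<^sup>\<circ>x)) = p (\<^sup>\<circ>x)\<close>.\<close>

lemma std_point_class:
  fixes X :: "(pt, 'a) csheaf"
  assumes p: "(A, p) \<in> plots X" and x: "x \<in> fermat_of A"
  shows "std_point (add_class X (A, p) x) = p (std x)"
proof -
  let ?\<phi> = "\<lambda>(i :: 'a plot) x. snd i (std x)"
  have "case_prod ?\<phi> ` colim_class (plots X) add_vertex add_transition (A, p) x = {?\<phi> (A, p) x}"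
  proof (rule image_colim_class[where \<phi> = ?\<phi> and I = "plots X" and D = add_vertex and M = add_transition, OF _ p])
    fix i j :: "'a plot" and x F
    assume *: "i \<in> plots X" "j \<in> plots X" "x \<in> points (add_vertex i)" "F \<in> add_transition i j"
    obtain A p B q where ij: "i = (A, p)" "j = (B, q)" by (cases i; cases j)
    obtain f where f: "f \<in> Hom S_site A B" "compose (snd A) q f = p"
      "F = fermat_map_of A B f"
      using *(4) unfolding ij by (rule add_transitionE)
    have A: "open_Rn (fst A) (snd A)" and B: "open_Rn (fst B) (snd B)"
      using *(1,2) by (simp_all add: ij plots_iff Obj_S_iff)
    have x: "x \<in> fermat_of A" using *(3) by (simp add: ij points_add_vertex)
    have "std (F x) = f (std x)"
      unfolding f(3) using f(1) by (intro std_fermat_map[OF A B _ x]) (simp add: Hom_S_iff)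
    then show "?\<phi> i x = ?\<phi> j (F x)"
      using std_in[OF A x] by (simp add: ij f(2)[symmetric] compose_def)
  qed (simp add: points_add_vertex x)
  moreover have "(\<lambda>((A, p), x). p (std x)) = case_prod ?\<phi>" by auto
  ultimately show ?thesis unfolding std_point_def add_class_colim by (simp only: the_elem_eq snd_conv)
qed

lemma add_incl_eq: "add_incl X (A, p) = (\<lambda>x\<in>fermat_of A. add_class X (A, p) x)"
  by (simp add: add_incl_def add_class_def)

lemma add_incl_section:
  assumes p: "(A, p) \<in> plots X"
  shows "add_incl X (A, p) \<in> sections (add_inf X) (fermat_obj A)"
proof -
  have A: "open_Rn (fst A) (snd A)" using p by (simp add: plots_iff Obj_S_iff)
  let ?\<iota> = "id_on (fermat_of A)"
  have "(\<lambda>w\<in>snd (fermat_obj A). colim_class (plots X) add_vertex add_transition (A, p) (?\<iota> w)) \<in>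
      sections (colimit F_site (plots X) add_vertex add_transition) (fermat_obj A)"
  proof (rule F.colim_inclusion_section[where i = "(A, p)" and D = add_vertex, OF _ add_vertex_presheaf[OF p] p])
    show "fermat_obj A \<in> Obj F_site" using p by (intro fermat_obj_Obj) (simp add: plots_iff)
    show "?\<iota> \<in> sections (add_vertex (A, p)) (fermat_obj A)"
      unfolding sections_add_vertex by (rule Hom_F_inclusion[OF A A order_refl])
  qed
  moreover have "(\<lambda>w\<in>snd (fermat_obj A). colim_class (plots X) add_vertex add_transition (A, p) (?\<iota> w)) = add_incl X (A, p)"
    unfolding add_incl_eq add_class_colim snd_conv by (rule restrict_ext) simp
  ultimately show ?thesis unfolding add_inf_colimit by simp
qed

lemma fplots_iff: "(A, P) \<in> fplots Y \<longleftrightarrow> A \<in> Obj S_site \<and> P \<in> sections Y (fermat_obj A)"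
  by (simp add: fplots_def)

lemma add_incl_fplot: "(A, p) \<in> plots X \<Longrightarrow> (A, add_incl X (A, p)) \<in> fplots (add_inf X)"
  using add_incl_section by (simp add: fplots_iff plots_iff)

text \<open>Sections of the colimit \<open>\<^sup>\<bullet>X\<close> factor through a vertex on the members of a cover, and the member
  containing the standard point \<open>u\<close> is of the form \<open>\<^sup>\<bullet>V\<close>.\<close>

lemma add_section_local:
  assumes A: "A \<in> Obj S_site" and P: "P \<in> sections (add_inf X) (fermat_obj A)"
    and u: "u \<in> snd A"
  obtains V B q \<sigma> where "open_Rn (fst A) V" "V \<subseteq> snd A" "u \<in> V" "(B, q) \<in> plots X"
    "\<sigma> \<in> Hom F_site (fst A, fermat (fst A) V) (fermat_obj B)"
    "\<And>v. v \<in> fermat (fst A) V \<Longrightarrow> P v = add_class X (B, q) (\<sigma> v)"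
proof -
  have AO: "open_Rn (fst A) (snd A)" using A by (simp add: Obj_S_iff)
  obtain \<W> where \<W>: "\<W> \<in> Cov F_site (fermat_obj A)"
    "\<And>W. W \<in> \<W> \<Longrightarrow> factors (plots X) add_vertex add_transition (fst (fermat_obj A), W) P"
    using P unfolding add_inf_colimit by (rule F.sections_colimitE) (rule that)
  have "const_of A u \<in> fermat_of A" by (rule const_pt_in[OF A u])
  then obtain W where W: "W \<in> \<W>" "const_of A u \<in> W" using \<W>(1) by auto
  have "openin (subtopology (fermat_topology (fst A)) (fermat_of A)) W"
    using \<W>(1) W(1) by simp
  then obtain V0 where V0: "open_Rn (fst A) V0"
    "W = fermat (fst A) V0 \<inter> fermat_of A"
    unfolding openin_subtopology_fermat by blast
  let ?V = "V0 \<inter> snd A"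
  have V: "open_Rn (fst A) ?V" using V0 AO by blast
  have WV: "W = fermat (fst A) ?V"
    unfolding V0(2) fermat_eq_std[OF V] fermat_eq_std[OF AO] fermat_eq_std[OF V0(1)] by blast
  have uV: "u \<in> ?V" using W(2) std_in[OF V, of "const_of A u"] std_const_pt[OF A u] WV by simp
  obtain i \<sigma> where i: "i \<in> plots X" and \<sigma>: "\<sigma> \<in> sections (add_vertex i) (fst (fermat_obj A), W)"
    "\<And>w. w \<in> W \<Longrightarrow> P w = colim_class (plots X) add_vertex add_transition i (\<sigma> w)"
    by (rule factorsE[OF \<W>(2)[OF W(1)]]) (rule that)
  obtain B q where iB: "i = (B, q)" by (cases i)
  show ?thesis
  proof (rule that[OF V _ uV])
    show "(B, q) \<in> plots X" using i iB by simp
    show "\<sigma> \<in> Hom F_site (fst A, fermat (fst A) ?V) (fermat_obj B)"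
      using \<sigma>(1) unfolding iB sections_add_vertex WV fst_conv .
    show "P v = add_class X (B, q) (\<sigma> v)" if "v \<in> fermat (fst A) ?V" for v
      using \<sigma>(2) that unfolding WV iB add_class_colim by blast
  qed simp
qed

text \<open>By the local form \<open>P v = [q, \<sigma> v]\<close> and \<open>qss_std_const\<close>. The points \<open>w\<close> and \<open>\<^sup>\<circ>w\<close> lie in
  the same Fermat-open sets, so that a local form near one of them covers both.\<close>

lemma std_point_section:
  assumes A: "A \<in> Obj S_site" and P: "P \<in> sections (add_inf X) (fermat_obj A)"
    and w: "w \<in> fermat_of A"
  shows "std_point (P (const_of A (std w))) = std_point (P w)"
proof -
  have AO: "open_Rn (fst A) (snd A)" using A by (simp add: Obj_S_iff)
  have uA: "std w \<in> snd A" by (rule std_in[OF AO w])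
  obtain V B q \<sigma> where V: "open_Rn (fst A) V" "V \<subseteq> snd A" "std w \<in> V"
    and q: "(B, q) \<in> plots X" and \<sigma>: "\<sigma> \<in> Hom F_site (fst A, fermat (fst A) V) (fermat_obj B)"
    and eq: "\<And>v. v \<in> fermat (fst A) V \<Longrightarrow> P v = add_class X (B, q) (\<sigma> v)"
    by (rule add_section_local[OF A P uA]) (rule that)
  have wV: "w \<in> fermat (fst A) V" using w V(3) unfolding fermat_eq_std[OF V(1)] fermat_eq_std[OF AO] by blast
  have c: "const_of A (std w) = germ (fst A) (\<lambda>_. std w)" by (rule const_pt_germ[OF AO uA])
  have cV: "germ (fst A) (\<lambda>_. std w) \<in> fermat (fst A) V" by (rule germ_in_fermat[OF V(1) lop_const[OF V(3)]])
  have q\<sigma>: "qss (fst A) (fermat (fst A) V) (fst B) (fermat_of B) \<sigma>"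
    using \<sigma> by simp
  have "std (\<sigma> (germ (fst A) (\<lambda>_. std w))) = std (\<sigma> w)"
    by (rule qss_std_const[OF q\<sigma> fermat_subset_Rn[OF V(1)] wV cV])
  then show ?thesis
    using eq[OF wV] eq[OF cV] qss_in[OF q\<sigma> wV] qss_in[OF q\<sigma> cV] by (simp add: c std_point_class[OF q])
qed

lemma add_reindexing:
  assumes g: "g \<in> smooth_maps X Y" and X: "diffeological_space X"
  shows "reindexing (plots X) add_vertex add_transition (plots Y) add_vertex add_transition (\<lambda>(A, p). (A, compose (snd A) g p))"
  unfolding reindexing_def
proof (intro conjI ballI)
  fix i assume i: "i \<in> plots X"
  obtain A p where iA: "i = (A, p)" by (cases i)
  show "(case i of (A, p) \<Rightarrow> (A, compose (snd A) g p)) \<in> plots Y"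
    using i sheaf_maps_section[OF g] by (simp add: iA plots_iff)
  show "add_vertex (case i of (A, p) \<Rightarrow> (A, compose (snd A) g p)) = add_vertex i"
    by (simp add: iA add_vertex_def)
  fix j F assume j: "j \<in> plots X" and F: "F \<in> add_transition i j"
  obtain B q where jB: "j = (B, q)" by (cases j)
  obtain f where f: "f \<in> Hom S_site A B" "compose (snd A) q f = p"
    "F = fermat_map_of A B f"
    using F unfolding iA jB by (rule add_transitionE)
  have "f \<in> snd A \<rightarrow> snd B" using f(1) by (auto simp: Hom_S_iff)
  then have "compose (snd A) (compose (snd B) g q) f = compose (snd A) g p"
    using f(2) by (simp only: compose_compose)
  then show "F \<in> add_transition (case i of (A, p) \<Rightarrow> (A, compose (snd A) g p)) (case j of (A, p) \<Rightarrow> (A, compose (snd A) g p))"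
    using f by (auto simp: iA jB add_transition_def plot_homs_iff)
  have "F \<in> fermat_of A \<rightarrow>\<^sub>E fermat_of B"
    unfolding f(3) using f(1) i j by (intro fermat_map_in) (auto simp: iA jB plots_iff Obj_S_iff Hom_S_iff)
  then show "F ` points (add_vertex i) \<subseteq> points (add_vertex j)" by (auto simp: iA jB points_add_vertex)
qed

lemma add_inf_map_colim:
  "add_inf_map X Y g = colim_map (plots X) add_vertex add_transition (plots Y) add_vertex add_transition (\<lambda>(A, p). (A, compose (snd A) g p))"
proof -
  have "points (add_inf X) = (SIGMA i:plots X. points (add_vertex i)) // colim_rel (plots X) add_vertex add_transition"
    unfolding add_inf_colimit points_colimit ..
  then show ?thesis
    unfolding add_inf_map_def colim_map_def
    by (simp add: case_prod_beta' add_class_colim[symmetric] add_class_def)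
qed

lemma add_inf_map_class:
  assumes X: "diffeological_space X" and g: "g \<in> smooth_maps X Y" and p: "(A, p) \<in> plots X"
    and x: "x \<in> fermat_of A"
  shows "add_inf_map X Y g (add_class X (A, p) x) = add_class Y (A, compose (snd A) g p) x"
  unfolding add_inf_map_colim add_class_colim
  using colim_map_class[OF add_reindexing[OF g X] p, of x] x by (simp add: points_add_vertex)

lemma add_inf_map_fermat_map:
  "diffeological_space X \<Longrightarrow> g \<in> smooth_maps X Y \<Longrightarrow> add_inf_map X Y g \<in> fermat_maps (add_inf X) (add_inf Y)"
  unfolding add_inf_map_colim add_inf_colimit
  by (rule F.colim_map_sheaf_map[OF add_vertex_presheaf add_reindexing])

lemma add_inf_map_id:
  assumes X: "diffeological_space X"
  shows "add_inf_map X X (id_on (points X)) = id_on (points (add_inf X))"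
proof (rule extensionalityI[of _ "points (add_inf X)"])
  fix c assume "c \<in> points (add_inf X)"
  then obtain A p x where c: "(A, p) \<in> plots X" "x \<in> fermat_of A" "c = add_class X (A, p) x"
    by (rule points_add_infE)
  have "compose (snd A) (id_on (points X)) p = p"
    using plot_in[OF X c(1)] by (rule compose_id_on)
  then show "add_inf_map X X (id_on (points X)) c = id_on (points (add_inf X)) c"
    using add_inf_map_class[OF X id_sheaf_map[OF concrete_sheaf_presheaf[OF X]] c(1,2)]
      add_class_in_points[OF c(1,2)] by (simp add: c(3))
qed (simp_all add: add_inf_map_def)

lemma add_inf_map_compose:
  assumes X: "diffeological_space X" and Y: "diffeological_space Y"
    and g: "g \<in> smooth_maps X Y" and h: "h \<in> smooth_maps Y Z"
  shows "add_inf_map X Z (compose (points X) h g) =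
    compose (points (add_inf X)) (add_inf_map Y Z h) (add_inf_map X Y g)"
proof (rule extensionalityI[of _ "points (add_inf X)"])
  fix c assume cX: "c \<in> points (add_inf X)"
  then obtain A p x where c: "(A, p) \<in> plots X" "x \<in> fermat_of A" "c = add_class X (A, p) x"
    by (rule points_add_infE)
  have hg: "compose (points X) h g \<in> smooth_maps X Z"
    by (rule sheaf_maps_compose[OF concrete_sheaf_presheaf[OF X] g h])
  have gp: "(A, compose (snd A) g p) \<in> plots Y" using c(1) sheaf_maps_section[OF g] by (simp add: plots_iff)
  have "compose (snd A) (compose (points X) h g) p = compose (snd A) h (compose (snd A) g p)"
    using plot_in[OF X c(1)] by (intro compose_compose) auto
  then show "add_inf_map X Z (compose (points X) h g) c =
      compose (points (add_inf X)) (add_inf_map Y Z h) (add_inf_map X Y g) c"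
    using cX add_inf_map_class[OF X hg c(1,2)] add_inf_map_class[OF X g c(1,2)]
      add_inf_map_class[OF Y h gp c(2)] by (simp add: c(3) compose_def)
qed (simp_all add: add_inf_map_def)

section \<open>Deleting infinitesimals\<close>

definition del_vertex :: "'a fplot \<Rightarrow> (pt, pt) csheaf" where
  "del_vertex = (\<lambda>(A, p). representable S_site A)"

definition del_transition :: "'a fplot \<Rightarrow> 'a fplot \<Rightarrow> (pt \<Rightarrow> pt) set" where
  "del_transition = (\<lambda>(A, p) (B, q). del_hom A ` fplot_homs (A, p) (B, q))"

definition del_class :: "(fpt, 'a) csheaf \<Rightarrow> 'a fplot \<Rightarrow> pt \<Rightarrow> ('a fplot \<times> pt) set" where
  "del_class Y i u = del_rel Y `` {(i, u)}"

lemma del_inf_colimit: "del_inf Y = colimit S_site (fplots Y) del_vertex del_transition"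
  unfolding del_inf_def del_vertex_def del_transition_def ..

lemma del_class_colim: "del_class Y = colim_class (fplots Y) del_vertex del_transition"
  unfolding del_class_def del_rel_def colim_class_def del_vertex_def del_transition_def by (intro ext) simp

lemma points_del_vertex: "points (del_vertex (A, p)) = snd A"
  by (simp add: del_vertex_def representable_def)

lemma sections_del_vertex: "sections (del_vertex (A, p)) B = Hom S_site B A"
  by (simp add: del_vertex_def representable_def)

lemma del_vertex_presheaf: "i \<in> fplots Y \<Longrightarrow> concrete_presheaf S_site (del_vertex i)"
  by (cases i) (auto simp: del_vertex_def fplots_iff intro!: S.concrete_presheaf_representable
      simp del: S_site_simps)

lemma diffeological_space_del_inf: "diffeological_space (del_inf Y)"
  unfolding del_inf_colimit by (rule S.concrete_sheaf_colimit) (rule del_vertex_presheaf)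

lemma fplot_homs_iff:
  "f \<in> fplot_homs (A, p) (B, q) \<longleftrightarrow>
    f \<in> Hom F_site (fermat_obj A) (fermat_obj B) \<and> compose (fermat_of A) q f = p"
  by (simp add: fplot_homs_def)

lemma del_transitionE:
  assumes "F \<in> del_transition (A, p) (B, q)"
  obtains f where "f \<in> Hom F_site (fermat_obj A) (fermat_obj B)"
    "compose (fermat_of A) q f = p" "F = del_hom A f"
  using assms by (auto simp: del_transition_def fplot_homs_iff simp del: F_site_simps)

lemma Hom_F_in: "f \<in> Hom F_site (n, A) (m, B) \<Longrightarrow> x \<in> A \<Longrightarrow> f x \<in> B"
  by auto

lemma del_hom_in:
  assumes "A \<in> Obj S_site" "B \<in> Obj S_site" "f \<in> Hom F_site (fermat_obj A) (fermat_obj B)" "u \<in> snd A"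
  shows "del_hom A f u \<in> snd B"
  using Hom_F_in[OF assms(3) const_pt_in[OF assms(1,4)]] assms(2,4) std_in
  by (simp add: del_hom_def Obj_S_iff)

text \<open>The form in which transition maps are used: \<open>u\<close> is sent to the standard part of \<open>f u\<close>.\<close>

lemma del_class_transition:
  assumes P: "(A, P) \<in> fplots Y" and Q: "(B, Q) \<in> fplots Y"
    and f: "f \<in> Hom F_site (fermat_obj A) (fermat_obj B)"
    and eq: "compose (fermat_of A) Q f = P" and u: "u \<in> snd A"
  shows "del_class Y (A, P) u = del_class Y (B, Q) (std (f (const_of A u)))"
proof -
  have "del_class Y (A, P) u = del_class Y (B, Q) (del_hom A f u)"
    unfolding del_class_colim
  proof (rule colim_class_transition[OF P Q])
    show "del_hom A f \<in> del_transition (A, P) (B, Q)"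
      unfolding del_transition_def case_prod_conv using f eq by (intro imageI) (simp only: fplot_homs_iff)
    show "del_hom A f u \<in> points (del_vertex (B, Q))"
      unfolding points_del_vertex using P Q f u by (intro del_hom_in) (simp_all only: fplots_iff)
  qed (use u in \<open>simp add: points_del_vertex\<close>)
  then show ?thesis using u by (simp add: del_hom_def)
qed

lemma del_class_in_points:
  "(A, P) \<in> fplots Y \<Longrightarrow> u \<in> snd A \<Longrightarrow> del_class Y (A, P) u \<in> points (del_inf Y)"
  unfolding del_class_colim del_inf_colimit by (rule colim_class_in_points) (simp_all add: points_del_vertex)

lemma points_del_infE:
  assumes "c \<in> points (del_inf Y)"
  obtains A P u where "(A, P) \<in> fplots Y" "u \<in> snd A" "c = del_class Y (A, P) u"
proof -
  obtain i x where "i \<in> fplots Y" "x \<in> points (del_vertex i)" "c = del_class Y i x"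
    using assms unfolding del_inf_colimit del_class_colim by (rule points_colimitE)
  then show ?thesis using that by (cases i) (auto simp: points_del_vertex)
qed

lemma fplot_in: "fermat_space Y \<Longrightarrow> (A, P) \<in> fplots Y \<Longrightarrow> P \<in> fermat_of A \<rightarrow>\<^sub>E points Y"
  using concrete_presheafD(1)[OF concrete_sheaf_presheaf _ , of F_site Y "fermat_obj A" P] fermat_obj_Obj[of A]
  by (simp add: fplots_iff del: F_site_simps)

lemma del_reindexing:
  assumes g: "g \<in> fermat_maps Y Z"
  shows "reindexing (fplots Y) del_vertex del_transition (fplots Z) del_vertex del_transition
    (\<lambda>(A, p). (A, compose (snd (fermat_obj A)) g p))"
  unfolding reindexing_def
proof (intro conjI ballI)
  let ?R = "\<lambda>(A, p). (A, compose (snd (fermat_obj A)) g p)"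
  fix i assume i: "i \<in> fplots Y"
  obtain A p where iA: "i = (A, p)" by (cases i)
  have A: "A \<in> Obj S_site" using i by (simp add: iA fplots_iff)
  show "?R i \<in> fplots Z"
    using i sheaf_maps_section[OF g fermat_obj_Obj[OF A]] by (simp add: iA fplots_iff)
  show "del_vertex (?R i) = del_vertex i"
    by (simp add: iA del_vertex_def)
  fix j F assume j: "j \<in> fplots Y" and F: "F \<in> del_transition i j"
  obtain B q where jB: "j = (B, q)" by (cases j)
  have B: "B \<in> Obj S_site" using j by (simp add: jB fplots_iff)
  obtain f where f: "f \<in> Hom F_site (fermat_obj A) (fermat_obj B)"
    "compose (fermat_of A) q f = p" "F = del_hom A f"
    using F unfolding iA jB by (rule del_transitionE)
  have "f \<in> fermat_of A \<rightarrow> fermat_of B" using f(1) by auto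
  then have "compose (fermat_of A) (compose (fermat_of B) g q) f =
      compose (fermat_of A) g p"
    using f(2) by (simp only: compose_compose)
  then have "f \<in> fplot_homs (?R i) (?R j)"
    unfolding iA jB case_prod_conv snd_conv fplot_homs_iff using f(1) by blast
  then show "F \<in> del_transition (?R i) (?R j)" unfolding f(3) by (simp add: iA jB del_transition_def)
  show "F ` points (del_vertex i) \<subseteq> points (del_vertex j)"
    unfolding f(3) iA jB points_del_vertex using del_hom_in[OF A B f(1)] by blast
qed

lemma del_inf_map_colim:
  "del_inf_map Y Z g = colim_map (fplots Y) del_vertex del_transition (fplots Z) del_vertex del_transition
    (\<lambda>(A, p). (A, compose (snd (fermat_obj A)) g p))"
proof -
  have "points (del_inf Y) = (SIGMA i:fplots Y. points (del_vertex i)) // colim_rel (fplots Y) del_vertex del_transition"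
    unfolding del_inf_colimit points_colimit ..
  then show ?thesis
    unfolding del_inf_map_def colim_map_def
    by (simp add: case_prod_beta' del_class_colim[symmetric] del_class_def)
qed

lemma del_inf_map_class:
  assumes g: "g \<in> fermat_maps Y Z" and P: "(A, P) \<in> fplots Y" and u: "u \<in> snd A"
  shows "del_inf_map Y Z g (del_class Y (A, P) u) = del_class Z (A, compose (fermat_of A) g P) u"
  unfolding del_inf_map_colim del_class_colim
  using colim_map_class[OF del_reindexing[OF g] P, of u] u by (simp add: points_del_vertex)

lemma del_inf_map_smooth_map:
  "g \<in> fermat_maps Y Z \<Longrightarrow> del_inf_map Y Z g \<in> smooth_maps (del_inf Y) (del_inf Z)"
  unfolding del_inf_map_colim del_inf_colimit
  by (rule S.colim_map_sheaf_map[OF del_vertex_presheaf del_reindexing])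

lemma del_inf_map_id:
  assumes Y: "fermat_space Y"
  shows "del_inf_map Y Y (id_on (points Y)) = id_on (points (del_inf Y))"
proof (rule extensionalityI[of _ "points (del_inf Y)"])
  fix c assume "c \<in> points (del_inf Y)"
  then obtain A P u where c: "(A, P) \<in> fplots Y" "u \<in> snd A" "c = del_class Y (A, P) u"
    by (rule points_del_infE)
  have "compose (fermat_of A) (id_on (points Y)) P = P"
    using fplot_in[OF Y c(1)] by (rule compose_id_on)
  then show "del_inf_map Y Y (id_on (points Y)) c = id_on (points (del_inf Y)) c"
    using del_inf_map_class[OF id_sheaf_map[OF concrete_sheaf_presheaf[OF Y]] c(1,2)]
      del_class_in_points[OF c(1,2)] by (simp add: c(3))
qed (simp_all add: del_inf_map_def)

lemma del_inf_map_compose: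
  assumes Y: "fermat_space Y" and g: "g \<in> fermat_maps Y Z" and h: "h \<in> fermat_maps Z W"
  shows "del_inf_map Y W (compose (points Y) h g) =
    compose (points (del_inf Y)) (del_inf_map Z W h) (del_inf_map Y Z g)"
proof (rule extensionalityI[of _ "points (del_inf Y)"])
  fix c assume cY: "c \<in> points (del_inf Y)"
  then obtain A P u where c: "(A, P) \<in> fplots Y" "u \<in> snd A" "c = del_class Y (A, P) u"
    by (rule points_del_infE)
  have hg: "compose (points Y) h g \<in> fermat_maps Y W"
    by (rule sheaf_maps_compose[OF concrete_sheaf_presheaf[OF Y] g h])
  have A: "A \<in> Obj S_site" using c(1) by (simp add: fplots_iff)
  have gP: "(A, compose (fermat_of A) g P) \<in> fplots Z"
    using c(1) sheaf_maps_section[OF g fermat_obj_Obj[OF A]] by (simp add: fplots_iff)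
  have "compose (fermat_of A) (compose (points Y) h g) P =
      compose (fermat_of A) h (compose (fermat_of A) g P)"
    using fplot_in[OF Y c(1)] by (intro compose_compose) auto
  then show "del_inf_map Y W (compose (points Y) h g) c =
      compose (points (del_inf Y)) (del_inf_map Z W h) (del_inf_map Y Z g) c"
    using cY del_inf_map_class[OF hg c(1,2)] del_inf_map_class[OF g c(1,2)]
      del_inf_map_class[OF h gP c(2)] by (simp add: c(3) compose_def)
qed (simp_all add: del_inf_map_def)

section \<open>The canonical isomorphism\<close>

text \<open>The map \<open>[P, u] \<mapsto> \<^sup>\<circ>(P u)\<close>.\<close>

definition canonical_inverse :: "(pt, 'a) csheaf \<Rightarrow> (('a plot \<times> fpt) set fplot \<times> pt) set \<Rightarrow> 'a" where
  "canonical_inverse X = (\<lambda>c\<in>points (del_add X).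
     the_elem ((\<lambda>((A, P), u). std_point (P (const_of A u))) ` c))"

text \<open>For a morphism \<open>f\<close> from \<open>P\<close> to \<open>Q\<close>, the points \<open>P u = Q (f u)\<close> and \<open>Q (\<^sup>\<circ>(f u))\<close> have the same
  standard part by \<open>std_point_section\<close>.\<close>

lemma canonical_inverse_class:
  fixes X :: "(pt, 'a) csheaf"
  assumes P: "(A, P) \<in> fplots (add_inf X)" and u: "u \<in> snd A"
  shows "canonical_inverse X (del_class (add_inf X) (A, P) u) = std_point (P (const_of A u))"
proof -
  let ?Y = "add_inf X"
  let ?\<phi> = "\<lambda>(i :: ('a plot \<times> fpt) set fplot) u. std_point (snd i (const_pt (fst (fst i)) (snd (fst i)) u))"
  have "case_prod ?\<phi> ` colim_class (fplots ?Y) del_vertex del_transition (A, P) u = {?\<phi> (A, P) u}"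
  proof (rule image_colim_class[where \<phi> = ?\<phi> and I = "fplots ?Y" and D = del_vertex and M = del_transition, OF _ P])
    fix i j u F
    assume *: "i \<in> fplots ?Y" "j \<in> fplots ?Y" "u \<in> points (del_vertex i)" "F \<in> del_transition i j"
    obtain A P B Q where ij: "i = (A, P)" "j = (B, Q)" by (cases i; cases j)
    obtain f where f: "f \<in> Hom F_site (fermat_obj A) (fermat_obj B)"
      "compose (fermat_of A) Q f = P" "F = del_hom A f"
      using *(4) unfolding ij by (rule del_transitionE)
    have A: "A \<in> Obj S_site" and B: "B \<in> Obj S_site" and Q: "Q \<in> sections ?Y (fermat_obj B)"
      using *(1,2) by (simp_all add: ij fplots_iff)
    have u: "u \<in> snd A" using *(3) by (simp add: ij points_del_vertex)
    have cu: "const_of A u \<in> fermat_of A" by (rule const_pt_in[OF A u])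
    have "std_point (P (const_of A u)) = std_point (Q (f (const_of A u)))"
      using cu by (simp add: f(2)[symmetric] compose_def)
    also have "\<dots> = std_point (Q (const_of B (std (f (const_of A u)))))"
      using std_point_section[OF B Q Hom_F_in[OF f(1) cu]] by simp
    finally show "?\<phi> i u = ?\<phi> j (F u)" using u by (simp add: ij f(3) del_hom_def)
  qed (simp add: points_del_vertex u)
  moreover have "(\<lambda>((A, P), u). std_point (P (const_of A u))) = case_prod ?\<phi>" by auto
  ultimately show ?thesis
    unfolding canonical_inverse_def using del_class_in_points[OF P u]
    by (simp only: restrict_apply' del_class_colim the_elem_eq fst_conv snd_conv)
qed

lemma canonical_inverse_in:
  assumes X: "diffeological_space X" and c: "c \<in> points (del_add X)"
  shows "canonical_inverse X c \<in> points X"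
proof -
  obtain A P u where P: "(A, P) \<in> fplots (add_inf X)" and u: "u \<in> snd A" and ceq: "c = del_class (add_inf X) (A, P) u"
    using points_del_infE[OF c] .
  have A: "A \<in> Obj S_site" using P by (simp add: fplots_iff)
  have "P (const_of A u) \<in> points (add_inf X)"
    using fplot_in[OF fermat_space_add_inf P] const_pt_in[OF A u] by auto
  then obtain B q x where q: "(B, q) \<in> plots X" "x \<in> fermat_of B"
    "P (const_of A u) = add_class X (B, q) x"
    by (rule points_add_infE)
  have "canonical_inverse X c = q (std x)"
    unfolding ceq canonical_inverse_class[OF P u] q(3) by (rule std_point_class[OF q(1,2)])
  moreover have "std x \<in> snd B" using q(1) std_in[OF _ q(2)] by (simp add: plots_iff Obj_S_iff)
  ultimately show ?thesis using plot_in[OF X q(1)] by auto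
qed

text \<open>Near \<open>u\<close> the function is \<open>v \<mapsto> q (\<^sup>\<circ>(\<sigma> v))\<close>, the composite of a plot with a smooth map.\<close>

lemma std_point_section_plot:
  assumes X: "diffeological_space X" and A: "A \<in> Obj S_site" and P: "P \<in> sections (add_inf X) (fermat_obj A)"
    and u: "u \<in> snd A"
  obtains V where "open_Rn (fst A) V" "u \<in> V" "V \<subseteq> snd A"
    "(\<lambda>v\<in>V. std_point (P (const_of A v))) \<in> sections X (fst A, V)"
proof -
  have AO: "open_Rn (fst A) (snd A)" using A by (simp add: Obj_S_iff)
  obtain V B q \<sigma> where V: "open_Rn (fst A) V" "V \<subseteq> snd A" "u \<in> V"
    and q: "(B, q) \<in> plots X" and \<sigma>: "\<sigma> \<in> Hom F_site (fst A, fermat (fst A) V) (fermat_obj B)"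
    and eq: "\<And>v. v \<in> fermat (fst A) V \<Longrightarrow> P v = add_class X (B, q) (\<sigma> v)"
    by (rule add_section_local[OF A P u]) (rule that)
  have B: "B \<in> Obj S_site" and qB: "q \<in> sections X B" using q by (simp_all add: plots_iff)
  have BO: "open_Rn (fst B) (snd B)" using B by (simp add: Obj_S_iff)
  let ?s = "\<lambda>v. std (\<sigma> (germ (fst A) (\<lambda>_. v)))"
  have q\<sigma>: "qss (fst A) (fermat (fst A) V) (fst B) (fermat_of B) \<sigma>"
    using \<sigma> by simp
  obtain W where W: "open_Rn (fst A) W" "u \<in> W" "W \<subseteq> V"
    "smooth (fst A) W (fst B) (snd B) ?s"
    by (rule qss_std_smooth[OF V(1) q\<sigma> BO V(3)]) (rule that)
  have WO: "(fst A, W) \<in> Obj S_site" using W(1) by simp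
  have "restrict ?s W \<in> Hom S_site (fst A, W) B"
    using Hom_S_restrict[OF W(1) W(1) order_refl W(4), of "snd B"] smooth_in[OF W(4)] by auto
  from concrete_presheafD(3)[OF concrete_sheaf_presheaf[OF X] WO B this qB]
  have "compose W q (restrict ?s W) \<in> sections X (fst A, W)" unfolding snd_conv .
  moreover have "std_point (P (const_of A v)) = q (?s v)" if v: "v \<in> W" for v
  proof -
    have vA: "v \<in> snd A" "v \<in> V" using v W V by auto
    have g: "germ (fst A) (\<lambda>_. v) \<in> fermat (fst A) V" by (rule germ_in_fermat[OF V(1) lop_const[OF vA(2)]])
    show ?thesis unfolding const_pt_germ[OF AO vA(1)] eq[OF g]
      by (rule std_point_class[OF q qss_in[OF q\<sigma> g]])
  qed
  then have "(\<lambda>v\<in>W. std_point (P (const_of A v))) = compose W q (restrict ?s W)"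
    by (auto simp: compose_def fun_eq_iff)
  ultimately show ?thesis using W V by (intro that[of W]) auto
qed

text \<open>A section of the composite is locally \<open>w \<mapsto> [P, \<sigma> w]\<close> with \<open>\<sigma>\<close> smooth, and on smaller open sets its
  image is a composite of \<open>\<sigma>\<close> with a plot of \<open>X\<close>. The sheaf condition of \<open>X\<close> glues these pieces.\<close>

lemma canonical_inverse_smooth_map:
  assumes X: "diffeological_space X"
  shows "canonical_inverse X \<in> smooth_maps (del_add X) X"
proof -
  have "compose (snd A) (canonical_inverse X) s \<in> sections X A"
    if A: "A \<in> Obj S_site" and s: "s \<in> sections (del_add X) A" for A s
  proof -
    note XP = concrete_sheaf_presheaf[OF X]
    have sfun: "s \<in> snd A \<rightarrow>\<^sub>E points (del_add X)"
      using s unfolding del_inf_colimit by (rule S.sections_colimit_fun)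
    obtain \<W> where \<W>: "\<W> \<in> Cov S_site A"
      "\<And>W. W \<in> \<W> \<Longrightarrow> factors (fplots (add_inf X)) del_vertex del_transition (fst A, W) s"
      using s unfolding del_inf_colimit by (rule S.sections_colimitE) (rule that)
    let ?\<theta>s = "compose (snd A) (canonical_inverse X) s"
    let ?\<V> = "{V. open_Rn (fst A) V \<and> V \<subseteq> snd A \<and> restrict ?\<theta>s V \<in> sections X (fst A, V)}"
    have nbhd: "\<exists>V\<in>?\<V>. w \<in> V" if w: "w \<in> snd A" for w
    proof -
      obtain W where W: "W \<in> \<W>" "w \<in> W" using S.Cov_Union[OF A \<W>(1)] w by blast
      have WA: "W \<subseteq> snd A" using S.Cov_Union[OF A \<W>(1)] W by blast
      have WO: "open_Rn (fst A) W"
        using S.Cov_Obj[OF A \<W>(1) W(1)] by simp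
      obtain i \<sigma> where i: "i \<in> fplots (add_inf X)" and \<sigma>: "\<sigma> \<in> sections (del_vertex i) (fst A, W)"
        "\<And>w. w \<in> W \<Longrightarrow> s w = colim_class (fplots (add_inf X)) del_vertex del_transition i (\<sigma> w)"
        by (rule factorsE[OF \<W>(2)[OF W(1)]]) (rule that)
      obtain B P where iB: "i = (B, P)" by (cases i)
      have P: "(B, P) \<in> fplots (add_inf X)" using i iB by simp
      then have B: "B \<in> Obj S_site" and PS: "P \<in> sections (add_inf X) (fermat_obj B)"
        by (simp_all add: fplots_iff)
      have \<sigma>H: "\<sigma> \<in> Hom S_site (fst A, W) B" using \<sigma>(1) unfolding iB sections_del_vertex .
      have \<sigma>B: "\<sigma> v \<in> snd B" if "v \<in> W" for v using \<sigma>H that by (auto simp: Hom_S_iff)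
      obtain V where V: "open_Rn (fst B) V" "\<sigma> w \<in> V" "V \<subseteq> snd B"
        "(\<lambda>v\<in>V. std_point (P (const_of B v))) \<in> sections X (fst B, V)" (is "?q \<in> _")
        by (rule std_point_section_plot[OF X B PS \<sigma>B[OF W(2)]]) (rule that)
      have sm: "smooth (fst A) W (fst B) (snd B) \<sigma>" using \<sigma>H by (simp add: Hom_S_iff)
      have sm': "smooth (fst A) W (fst B) (Rn (fst B)) \<sigma>"
        using smooth_subset[OF openin_le_Rn[OF WO] sm order_refl] smooth_in[OF sm] B
          openin_le_Rn[of "fst B" "snd B"] by (auto simp: Obj_S_iff)
      let ?V = "{v \<in> W. \<sigma> v \<in> V}"
      have VO: "open_Rn (fst A) ?V" by (rule openin_smooth_preimage[OF WO sm' V(1)])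
      have r: "restrict \<sigma> ?V \<in> Hom S_site (fst A, ?V) (fst B, V)"
        by (rule Hom_S_restrict[OF WO VO _ sm]) auto
      have "compose (snd (fst A, ?V)) ?q (restrict \<sigma> ?V) \<in> sections X (fst A, ?V)"
        by (rule concrete_presheafD(3)[OF XP _ _ r V(4)]) (use VO V(1) in simp_all)
      moreover have "restrict ?\<theta>s ?V = compose ?V ?q (restrict \<sigma> ?V)"
      proof
        fix v
        show "restrict ?\<theta>s ?V v = compose ?V ?q (restrict \<sigma> ?V) v"
        proof (cases "v \<in> ?V")
          case True
          then have "s v = del_class (add_inf X) (B, P) (\<sigma> v)" using \<sigma>(2) iB by (simp add: del_class_colim)
          with True WA canonical_inverse_class[OF P \<sigma>B] show ?thesis by (auto simp: compose_def)
        next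
          case False
          then show ?thesis by (auto simp: compose_def)
        qed
      qed
      ultimately have V\<V>: "?V \<in> ?\<V>" using VO WA by auto
      have "w \<in> ?V" using W V by simp
      then show ?thesis using V\<V> by (rule bexI)
    qed
    have "\<Union>?\<V> = snd A"
    proof
      show "\<Union>?\<V> \<subseteq> snd A" by (rule Union_least) simp
      show "snd A \<subseteq> \<Union>?\<V>" by (rule subsetI) (simp only: Union_iff nbhd)
    qed
    then have "?\<V> \<in> Cov S_site A" by (cases A) simp
    moreover have "?\<theta>s \<in> snd A \<rightarrow>\<^sub>E points X"
      using sfun canonical_inverse_in[OF X] by (auto simp: compose_def PiE_iff)
    ultimately show ?thesis by (intro concrete_sheaf_glue[OF X A, of ?\<theta>s ?\<V>]) auto
  qed
  moreover have "canonical_inverse X \<in> points (del_add X) \<rightarrow>\<^sub>E points X"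
    using canonical_inverse_in[OF X] by (auto simp: canonical_inverse_def)
  ultimately show ?thesis by (simp add: sheaf_maps_def)
qed

text \<open>The space \<open>\<real>\<^sup>0\<close> is terminal in smooth maps, hence a plot on it maps to every plot through its value. It
  is a common reference for all plots through \<open>x\<close>.\<close>

definition point_plot :: "'a \<Rightarrow> 'a plot" where
  "point_plot x = ((0, Rn 0), \<lambda>_\<in>Rn 0. x)"

lemma zero_in_Rn: "(\<lambda>_. 0) \<in> Rn n"
  by (simp add: Rn_iff)

lemma point_obj: "(0, Rn 0) \<in> Obj S_site"
  using openin_Rn by simp

lemma point_plot: "diffeological_space X \<Longrightarrow> x \<in> points X \<Longrightarrow> point_plot x \<in> plots X"
  using concrete_presheafD(2)[OF concrete_sheaf_presheaf point_obj, of X x] openin_Rn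
  by (simp add: point_plot_def plots_iff)

text \<open>The smooth map \<open>\<real>\<^sup>0 \<rightarrow> U\<close> with value \<open>u\<close> is a morphism from the point plot at \<open>p u\<close> to \<open>p\<close>, and its
  Fermat extension is a morphism between the Fermat plots belonging to them.\<close>

lemma del_class_point_plot:
  assumes X: "diffeological_space X" and p: "(A, p) \<in> plots X" and u: "u \<in> snd A"
  shows "del_class (add_inf X) (A, add_incl X (A, p)) u =
    del_class (add_inf X) ((0, Rn 0), add_incl X (point_plot (p u))) (\<lambda>_. 0)"
proof -
  let ?O = "(0, Rn 0) :: pt obj" and ?z = "\<lambda>_::nat. 0::real"
  have pu: "p u \<in> points X" using plot_in[OF X p] u by auto
  define c where "c = (\<lambda>_\<in>Rn 0. p u)"
  have pp: "point_plot (p u) = (?O, c)" by (simp add: point_plot_def c_def)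
  have c: "(?O, c) \<in> plots X" using point_plot[OF X pu] pp by simp
  have A: "A \<in> Obj S_site" using p by (simp add: plots_iff)
  let ?f = "\<lambda>_\<in>Rn 0. u"
  have f: "?f \<in> Hom S_site ?O A" using S.Hom_const[OF point_obj A u] by simp
  have pf: "compose (snd ?O) p ?f = c" using u by (auto simp: compose_def c_def fun_eq_iff)
  let ?F = "fermat_map 0 (Rn 0) (fst A) (snd A) ?f"
  have F: "?F \<in> Hom F_site (fermat_obj ?O) (fermat_obj A)"
    using fermat_map_Hom[OF point_obj A f] by (simp only: fst_conv snd_conv)
  have F_in: "?F x \<in> fermat_of A" if "x \<in> fermat 0 (Rn 0)" for x
    using Hom_F_in[OF F] that by simp
  have comp: "compose (fermat_of ?O) (add_incl X (A, p)) ?F = add_incl X (?O, c)"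
  proof
    fix x
    show "compose (fermat_of ?O) (add_incl X (A, p)) ?F x = add_incl X (?O, c) x"
      using add_class_transition[OF c p f pf, of x] F_in[of x]
      by (simp add: compose_def add_incl_eq)
  qed
  have "del_class (add_inf X) (?O, add_incl X (?O, c)) ?z =
      del_class (add_inf X) (A, add_incl X (A, p)) (std (?F (const_of ?O ?z)))"
    by (rule del_class_transition[OF add_incl_fplot[OF c] add_incl_fplot[OF p] F comp])
      (simp add: zero_in_Rn)
  moreover have "std (?F (const_of ?O ?z)) = u"
  proof -
    have "std (?F (const_pt 0 (Rn 0) ?z)) = ?f (std (const_pt 0 (Rn 0) ?z))"
      using A f const_pt_in[OF point_obj, of ?z] zero_in_Rn
      by (intro std_fermat_map openin_Rn) (simp_all add: Obj_S_iff Hom_S_iff)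
    also have "std (const_pt 0 (Rn 0) ?z) = ?z" using std_const_pt[OF point_obj, of ?z] zero_in_Rn by simp
    also have "?f ?z = u" using zero_in_Rn by simp
    finally show ?thesis by (simp only: fst_conv snd_conv)
  qed
  ultimately show ?thesis by (simp add: pp)
qed

text \<open>All members of the union that defines the canonical map coincide, since they all coincide with the one
  that comes from the point plot.\<close>

lemma canonical_map_class:
  assumes X: "diffeological_space X" and p: "(A, p) \<in> plots X" and u: "u \<in> snd A"
  shows "canonical_map X (p u) = del_class (add_inf X) (A, add_incl X (A, p)) u"
proof -
  let ?S = "{((B, q), v). (B, q) \<in> plots X \<and> v \<in> snd B \<and> q v = p u}"
  have pu: "p u \<in> points X" using plot_in[OF X p] u by auto
  have "(\<lambda>((B, q), v). del_class (add_inf X) (B, add_incl X (B, q)) v) z =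
      del_class (add_inf X) (A, add_incl X (A, p)) u" if "z \<in> ?S" for z
    using that del_class_point_plot[OF X] p u by auto
  moreover have "((A, p), u) \<in> ?S" using p u by simp
  ultimately have "(\<Union>z\<in>?S. (\<lambda>((B, q), v). del_class (add_inf X) (B, add_incl X (B, q)) v) z) =
      del_class (add_inf X) (A, add_incl X (A, p)) u" by blast
  then show ?thesis
    using pu by (simp add: canonical_map_def del_class_def case_prod_beta')
qed

lemma canonical_map_point:
  assumes X: "diffeological_space X" and x: "x \<in> points X"
  shows "canonical_map X x = del_class (add_inf X) ((0, Rn 0), add_incl X (point_plot x)) (\<lambda>_. 0)"
  using canonical_map_class[OF X point_plot[OF X x, unfolded point_plot_def], of "\<lambda>_. 0"] zero_in_Rn
  by (simp add: point_plot_def)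

lemma canonical_map_in:
  assumes X: "diffeological_space X" and x: "x \<in> points X"
  shows "canonical_map X x \<in> points (del_add X)"
  unfolding canonical_map_point[OF X x]
  using add_incl_fplot[OF point_plot[OF X x, unfolded point_plot_def]] zero_in_Rn
  by (intro del_class_in_points) (simp_all add: point_plot_def)

text \<open>A plot \<open>s\<close> of \<open>X\<close> followed by the canonical map is the colimit inclusion of the copy of its domain that
  is indexed by the Fermat plot of \<open>s\<close>.\<close>

lemma canonical_map_smooth_map:
  assumes X: "diffeological_space X"
  shows "canonical_map X \<in> smooth_maps X (del_add X)"
proof -
  have "compose (snd A) (canonical_map X) s \<in> sections (del_add X) A"
    if A: "A \<in> Obj S_site" and s: "s \<in> sections X A" for A s
  proof -
    have p: "(A, s) \<in> plots X" using A s by (simp add: plots_iff)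
    let ?i = "(A, add_incl X (A, s))"
    have i: "?i \<in> fplots (add_inf X)" by (rule add_incl_fplot[OF p])
    have "id_on (snd A) \<in> sections (del_vertex ?i) A"
      unfolding sections_del_vertex using Hom_S_id[of "fst A" "snd A"] A by (simp add: Obj_S_iff)
    from S.colim_inclusion_section[where i = ?i and D = del_vertex and M = del_transition, OF A del_vertex_presheaf[OF i] i this]
    have "(\<lambda>w\<in>snd A. del_class (add_inf X) ?i (id_on (snd A) w)) \<in> sections (del_add X) A"
      unfolding del_inf_colimit del_class_colim .
    moreover have "(\<lambda>w\<in>snd A. del_class (add_inf X) ?i (id_on (snd A) w)) = compose (snd A) (canonical_map X) s"
      unfolding compose_def by (rule restrict_ext) (simp add: canonical_map_class[OF X p])
    ultimately show ?thesis by simp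
  qed
  moreover have "canonical_map X \<in> points X \<rightarrow>\<^sub>E points (del_add X)"
    using canonical_map_in[OF X] by (auto simp: canonical_map_def)
  ultimately show ?thesis by (simp add: sheaf_maps_def)
qed

lemma canonical_inverse_canonical_map:
  assumes X: "diffeological_space X" and x: "x \<in> points X"
  shows "canonical_inverse X (canonical_map X x) = x"
proof -
  let ?O = "(0, Rn 0) :: pt obj" and ?z = "\<lambda>_::nat. 0::real"
  define c where "c = (\<lambda>_\<in>Rn 0. x)"
  have pp: "point_plot x = (?O, c)" by (simp add: point_plot_def c_def)
  have c: "(?O, c) \<in> plots X" using point_plot[OF X x] pp by simp
  have z: "?z \<in> snd ?O" using zero_in_Rn by simp
  have cz: "const_pt 0 (Rn 0) ?z \<in> fermat 0 (Rn 0)" using const_pt_in[OF point_obj z] by simp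
  have "canonical_inverse X (canonical_map X x) = std_point (add_incl X (?O, c) (const_pt 0 (Rn 0) ?z))"
    unfolding canonical_map_point[OF X x] pp using canonical_inverse_class[OF add_incl_fplot[OF c] z] by simp
  also have "\<dots> = c (std (const_pt 0 (Rn 0) ?z))"
    using std_point_class[OF c, of "const_pt 0 (Rn 0) ?z"] cz by (simp add: add_incl_eq)
  also have "\<dots> = x" using std_const_pt[OF point_obj z] z by (simp add: c_def)
  finally show ?thesis .
qed

text \<open>The class \<open>[P, u]\<close> does not change when \<open>P\<close> is restricted to a neighbourhood \<open>\<^sup>\<bullet>V\<close> of \<open>u\<close>, because the
  inclusion \<open>\<^sup>\<bullet>V \<rightarrow> \<^sup>\<bullet>U\<close> is a morphism of Fermat plots. If \<open>P v = [q, \<sigma> v]\<close> on \<open>\<^sup>\<bullet>V\<close>, then \<open>\<sigma>\<close> is a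
  morphism from this restriction to the Fermat plot belonging to \<open>q\<close>. Therefore \<open>[P, u]\<close> is the class of
  \<open>\<^sup>\<circ>(\<sigma> u)\<close> in the copy indexed by \<open>q\<close>, which is the canonical image of \<open>q (\<^sup>\<circ>(\<sigma> u)) = \<^sup>\<circ>(P u)\<close>.\<close>

lemma canonical_map_canonical_inverse:
  assumes X: "diffeological_space X" and c: "c \<in> points (del_add X)"
  shows "canonical_map X (canonical_inverse X c) = c"
proof -
  let ?Y = "add_inf X"
  obtain A P u where P: "(A, P) \<in> fplots ?Y" and u: "u \<in> snd A" and ceq: "c = del_class ?Y (A, P) u"
    using points_del_infE[OF c] .
  have A: "A \<in> Obj S_site" and PS: "P \<in> sections ?Y (fermat_obj A)" using P by (simp_all add: fplots_iff)
  have AO: "open_Rn (fst A) (snd A)" using A by (simp add: Obj_S_iff)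
  obtain V B q \<sigma> where V: "open_Rn (fst A) V" "V \<subseteq> snd A" "u \<in> V"
    and q: "(B, q) \<in> plots X" and \<sigma>: "\<sigma> \<in> Hom F_site (fst A, fermat (fst A) V) (fermat_obj B)"
    and eq: "\<And>v. v \<in> fermat (fst A) V \<Longrightarrow> P v = add_class X (B, q) (\<sigma> v)"
    by (rule add_section_local[OF A PS u]) (rule that)
  have BO: "open_Rn (fst B) (snd B)" using q by (simp add: plots_iff Obj_S_iff)
  let ?V = "(fst A, V)" and ?\<iota> = "id_on (fermat (fst A) V)"
  let ?cu = "const_pt (fst A) V u" and ?P = "restrict P (fermat (fst A) V)"
  have VO: "?V \<in> Obj S_site" using V by simp
  have \<iota>: "?\<iota> \<in> Hom F_site (fermat_obj ?V) (fermat_obj A)"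
    using Hom_F_inclusion[OF AO V(1,2)] by (simp only: fst_conv snd_conv)
  have P\<iota>: "compose (fermat_of ?V) P ?\<iota> = ?P" by (auto simp: compose_def fun_eq_iff)
  have "compose (snd (fermat_obj ?V)) P ?\<iota> \<in> sections ?Y (fermat_obj ?V)"
    by (rule concrete_presheafD(3)[OF concrete_sheaf_presheaf[OF fermat_space_add_inf]
          fermat_obj_Obj[OF VO] fermat_obj_Obj[OF A] \<iota> PS])
  then have PV: "(?V, ?P) \<in> fplots ?Y"
    using VO P\<iota> unfolding fplots_iff by (simp only: snd_conv) 
  have cuV: "?cu \<in> fermat (fst A) V" using const_pt_in[OF VO] V(3) by simp
  have cu: "?cu = const_of A u"
    using const_pt_germ[OF V(1,3)] const_pt_germ[OF AO u] by simp
  have "std (?\<iota> ?cu) = u" using std_const_pt[OF VO] V(3) cuV by simp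
  with del_class_transition[OF PV P \<iota> P\<iota>, of u] V(3)
  have 1: "del_class ?Y (?V, ?P) u = c" by (simp add: ceq)
  have \<sigma>': "\<sigma> \<in> Hom F_site (fermat_obj ?V) (fermat_obj B)" using \<sigma> by (simp only: fst_conv snd_conv)
  have \<sigma>B: "\<sigma> v \<in> fermat_of B" if "v \<in> fermat (fst A) V" for v
    using Hom_F_in[OF \<sigma> that] .
  have q\<sigma>: "compose (fermat_of ?V) (add_incl X (B, q)) \<sigma> = ?P"
    using eq \<sigma>B by (auto simp: compose_def fun_eq_iff add_incl_eq)
  have 2: "del_class ?Y (?V, ?P) u = del_class ?Y (B, add_incl X (B, q)) (std (\<sigma> ?cu))"
    using del_class_transition[OF PV add_incl_fplot[OF q] \<sigma>' q\<sigma>, of u] V(3) by simp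
  have "canonical_inverse X c = q (std (\<sigma> ?cu))"
    unfolding ceq canonical_inverse_class[OF P u] cu[symmetric] eq[OF cuV] by (rule std_point_class[OF q \<sigma>B[OF cuV]])
  moreover have "std (\<sigma> ?cu) \<in> snd B" by (rule std_in[OF BO \<sigma>B[OF cuV]])
  ultimately show ?thesis using canonical_map_class[OF X q] 1 2 by simp
qed

theorem canonical_map_diffeomorphism:
  assumes X: "diffeological_space X"
  shows "diffeomorphism X (del_add X) (canonical_map X)"
proof -
  have "compose (points X) (canonical_inverse X) (canonical_map X) = id_on (points X)"
    unfolding compose_def by (rule restrict_ext) (rule canonical_inverse_canonical_map[OF X])
  moreover have "compose (points (del_add X)) (canonical_map X) (canonical_inverse X) = id_on (points (del_add X))"
    unfolding compose_def by (rule restrict_ext) (rule canonical_map_canonical_inverse[OF X])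
  ultimately show ?thesis
    unfolding sheaf_iso_def using canonical_map_smooth_map[OF X] canonical_inverse_smooth_map[OF X] by blast
qed

text \<open>Both sides are evaluated with the point plot at \<open>x\<close>, which \<open>g\<close> sends to the point plot at \<open>g x\<close>.\<close>

lemma canonical_map_natural:
  assumes X: "diffeological_space X" and Y: "diffeological_space Y" and g: "g \<in> smooth_maps X Y"
  shows "compose (points X) (del_add_map X Y g) (canonical_map X) = compose (points X) (canonical_map Y) g"
  unfolding compose_def
proof (rule restrict_ext)
  fix x assume x: "x \<in> points X"
  let ?O = "(0, Rn 0) :: pt obj" and ?z = "\<lambda>_::nat. 0::real" and ?G = "add_inf_map X Y g"
  have gx: "g x \<in> points Y" using sheaf_maps_fun[OF g] x by auto
  define c where "c = (\<lambda>_\<in>Rn 0. x)"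
  have pp: "point_plot x = (?O, c)" by (simp add: point_plot_def c_def)
  have c: "(?O, c) \<in> plots X" using point_plot[OF X x] pp by simp
  have ppY: "point_plot (g x) = (?O, compose (snd ?O) g c)"
    by (simp add: point_plot_def c_def compose_def fun_eq_iff)
  have z: "?z \<in> snd ?O" using zero_in_Rn by simp
  have G: "?G \<in> fermat_maps (add_inf X) (add_inf Y)" by (rule add_inf_map_fermat_map[OF X g])
  have "compose (fermat_of ?O) ?G (add_incl X (?O, c)) = add_incl Y (?O, compose (snd ?O) g c)"
    using add_inf_map_class[OF X g c] by (simp add: compose_def add_incl_eq fun_eq_iff)
  then have "del_add_map X Y g (canonical_map X x) = del_class (add_inf Y) (?O, add_incl Y (point_plot (g x))) ?z"
    unfolding canonical_map_point[OF X x] pp ppY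
    using del_inf_map_class[OF G add_incl_fplot[OF c] z] by simp
  also have "\<dots> = canonical_map Y (g x)" using canonical_map_point[OF Y gx] by simp
  finally show "del_add_map X Y g (canonical_map X x) = canonical_map Y (g x)" .
qed

theorem proposition17:
  fixes X :: "(pt, 'a) csheaf" and Y :: "(pt, 'b) csheaf" and Z :: "(pt, 'c) csheaf"
  assumes X: "diffeological_space X" and Y: "diffeological_space Y" and Z: "diffeological_space Z"
  shows
    "fermat_space (add_inf X) \<and> diffeological_space (del_add X) \<and>
     (\<forall>g\<in>smooth_maps X Y. add_inf_map X Y g \<in> fermat_maps (add_inf X) (add_inf Y) \<and>
        del_add_map X Y g \<in> smooth_maps (del_add X) (del_add Y)) \<and>
     del_add_map X X (id_on (points X)) = id_on (points (del_add X)) \<and>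
     (\<forall>g\<in>smooth_maps X Y. \<forall>h\<in>smooth_maps Y Z.
        del_add_map X Z (compose (points X) h g) =
          compose (points (del_add X)) (del_add_map Y Z h) (del_add_map X Y g)) \<and>
     diffeomorphism X (del_add X) (canonical_map X) \<and>
     (\<forall>g\<in>smooth_maps X Y.
        compose (points X) (del_add_map X Y g) (canonical_map X) =
          compose (points X) (canonical_map Y) g)"
proof (intro conjI ballI)
  show "fermat_space (add_inf X)" by (rule fermat_space_add_inf)
  show "diffeological_space (del_add X)" by (rule diffeological_space_del_inf)
  show "del_add_map X X (id_on (points X)) = id_on (points (del_add X))"
    unfolding add_inf_map_id[OF X] by (rule del_inf_map_id[OF fermat_space_add_inf])
  show "diffeomorphism X (del_add X) (canonical_map X)" by (rule canonical_map_diffeomorphism[OF X])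
  fix g assume g: "g \<in> smooth_maps X Y"
  show G: "add_inf_map X Y g \<in> fermat_maps (add_inf X) (add_inf Y)"
    by (rule add_inf_map_fermat_map[OF X g])
  show "del_add_map X Y g \<in> smooth_maps (del_add X) (del_add Y)"
    by (rule del_inf_map_smooth_map[OF G])
  show "compose (points X) (del_add_map X Y g) (canonical_map X) = compose (points X) (canonical_map Y) g"
    by (rule canonical_map_natural[OF X Y g])
  fix h assume h: "h \<in> smooth_maps Y Z"
  show "del_add_map X Z (compose (points X) h g) =
      compose (points (del_add X)) (del_add_map Y Z h) (del_add_map X Y g)"
    unfolding add_inf_map_compose[OF X Y g h]
    by (rule del_inf_map_compose[OF fermat_space_add_inf G add_inf_map_fermat_map[OF Y h]])
qed

end
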